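(* Let $b\in\mathbb{N}\setminus\{1\}$ and $X=\mathbb{R}^d$. For each linear flow $\phi$ on $X$ the following are equivalent: (i) The set $\sigma_{\rm dom}(\phi)$ is exponentially $b$-nonresonant; (ii) For (Lebesgue) almost every $H\in\mathcal{O}(X)$ the function $H(\phi_\bullet)$ is $b$-Benford.
   Context: Notation: $d$ is a positive integer, $\mathbb{N}$ is the set of positive integers, $\mathbb{R}^+=[0,\infty)$, $\lambda$ is Lebesgue measure on $\mathbb{R}^+$, $\log_b$ is the base-$b$ logarithm, and $\imath$ is the imaginary unit. $\mathcal{L}(X)$ is the space of all linear maps $A:X\to X$, $I_X$ is the identity map, and $\mathcal{O}(X)$ is the dual space of $\mathcal{L}(X)$, i.e. the space of all linear functionals $H:\mathcal{L}(X)\to\mathbb{R}$. Choosing a basis identifies $\mathcal{O}(X)$ with $\mathbb{R}^{d^2}$, and "almost every" refers to Lebesgue measure under this identification (independent of the basis). Linear flows: a linear flow on $X=\mathbb{R}^d$ is a continuous map $\phi:\mathbb{R}\times X\to X$ with $\phi(0,x)=x$ and $\phi(s,\phi(t,x))=\phi(s+t,x)$ for all $x\in X$, $s,t\in\mathbb{R}$, such that each map $\phi_t:=\phi(t,\cdot)$ is linear. There is a unique $A_\phi\in\mathcal{L}(X)$ (the generator) with $\phi_t=e^{tA_\phi}$ for all $t\in\mathbb{R}$. $H(\phi_\bullet)$ denotes the function $t\mapsto H(\phi_t)$, regarded as a function on $\mathbb{R}^+$ when asking whether it is $b$-Benford. Dominant spectrum: for $A\in\mathcal{L}(X)$ let $\sigma(A)\subset\mathbb{C}$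 be its set of eigenvalues. For $z\in\sigma(A)$ let $k_z\ge0$ be the maximal integer $k$ for which $\mathrm{rank}(A-zI_X)^{k+1}<\mathrm{rank}(A-zI_X)^k$ if $z\in\mathbb{R}$, respectively $\mathrm{rank}(A^2-2\Re z\,A+|z|^2I_X)^{k+1}<\mathrm{rank}(A^2-2\Re z\,A+|z|^2I_X)^k$ if $z\in\mathbb{C}\setminus\mathbb{R}$; equivalently, $k_z+1$ is the size of the largest block associated with $z$ in the complex Jordan normal form of $A$. Let $(r_A,k_A)$ be the element of $\{(\Re z,k_z):z\in\sigma(A)\}$ that is maximal in the lexicographic order on $\mathbb{R}\times\mathbb{Z}$, and define $\sigma_{\rm dom}(A):=\{z\in\sigma(A):\Re z=r_A,\ k_z=k_A\}$. For a linear flow $\phi$, $\sigma_{\rm dom}(\phi):=\sigma_{\rm dom}(A_\phi)$. Benford functions: for $x\in\mathbb{R}\setminus\{0\}$, $S_b(x)\in[1,b)$ is the unique number with $|x|=S_b(x)b^k$ for some integer $k$; $S_b(0):=0$. A Borel measurable function $f:\mathbb{R}^+\to\mathbb{R}$ is $b$-Benford if $\lim_{T\to+\infty}\frac1T\lambda(\{t\le T: S_b(f(t))\le s\})=\log_b s$ for all $s\in[1,b)$. Nonresonance: for $z\in\mathbb{C}\setminus\{0\}$, $\arg z\in(-\pi,\pi]$ is defined by $z=|z|e^{\imath\arg z}$. For $\mathcal{Z}\subset\mathbb{C}$, $\mathrm{span}_{\mathbb{Q}}\mathcal{Z}$ is the smallest $\mathbb{Q}$-linear subspace of $\mathbb{C}$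 containing $\mathcal{Z}$. Let $\mathbb{S}$ be the unit circle in $\mathbb{C}$. A non-empty set $\mathcal{Z}\subset r\mathbb{S}$, with $r>0$, is $b$-nonresonant if the set $\Delta_{\mathcal{Z}}:=\{1+\frac{\arg z-\arg w}{2\pi}: z,w\in\mathcal{Z}\}$ satisfies $\Delta_{\mathcal{Z}}\cap\mathbb{Q}=\{1\}$ and $\log_b r\notin\mathrm{span}_{\mathbb{Q}}\Delta_{\mathcal{Z}}$. An arbitrary set $\mathcal{Z}\subset\mathbb{C}$ is $b$-nonresonant if for every $r>0$ the set $\mathcal{Z}\cap r\mathbb{S}$ is either $b$-nonresonant or empty; otherwise it is $b$-resonant. A set $\mathcal{Z}\subset\mathbb{C}$ is exponentially $b$-nonresonant if $e^{t\mathcal{Z}}:=\{e^{tz}:z\in\mathcal{Z}\}$ is $b$-nonresonant for some $t\in\mathbb{R}^+$; otherwise it is exponentially $b$-resonant. *)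

theory Defs
  imports "HOL-Analysis.Analysis"
begin

(* X is real^'n with arbitrary finite index type 'n, so d = CARD('n) is an arbitrary positive
   integer. Linear maps on X are represented by their matrices in the standard basis. *)

section \<open>Linear flows and their generators\<close>

definition linear_flow :: "(real \<Rightarrow> real^'n \<Rightarrow> real^'n) \<Rightarrow> bool" where
  "linear_flow \<phi> \<longleftrightarrow>
     continuous_on UNIV (\<lambda>(t, x). \<phi> t x) \<and>
     (\<forall>x. \<phi> 0 x = x) \<and>
     (\<forall>s t x. \<phi> s (\<phi> t x) = \<phi> (s + t) x) \<and>
     (\<forall>t. linear (\<phi> t))"

(* The type class operations * and ^ on vectors act componentwise, hence the explicit power
   and exponential for the matrix product. *)
primrec mat_power :: "('a::semiring_1)^'n^'n \<Rightarrow> nat \<Rightarrow> 'a^'n^'n" where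
  "mat_power A 0 = mat 1"
| "mat_power A (Suc k) = A ** mat_power A k"

definition mat_exp :: "real^'n^'n \<Rightarrow> real^'n^'n" where
  "mat_exp A = (\<Sum>k. (1 / fact k) *\<^sub>R mat_power A k)"

definition generator :: "(real \<Rightarrow> real^'n \<Rightarrow> real^'n) \<Rightarrow> real^'n^'n" where
  "generator \<phi> = (THE A. \<forall>t. matrix (\<phi> t) = mat_exp (t *\<^sub>R A))"

section \<open>Dominant spectrum\<close>

definition spectrum :: "real^'n^'n \<Rightarrow> complex set" where
  "spectrum A = {z. \<exists>v :: complex^'n. v \<noteq> 0 \<and> map_matrix complex_of_real A *v v = z *s v}"

definition spec_matrix :: "real^'n^'n \<Rightarrow> complex \<Rightarrow> real^'n^'n" where
  "spec_matrix A z =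
     (if z \<in> \<real> then A - Re z *\<^sub>R mat 1
      else A ** A - (2 * Re z) *\<^sub>R A + (cmod z)\<^sup>2 *\<^sub>R mat 1)"

definition spec_index :: "real^'n^'n \<Rightarrow> complex \<Rightarrow> nat" where
  "spec_index A z =
     Max {k. rank (mat_power (spec_matrix A z) (Suc k)) < rank (mat_power (spec_matrix A z) k)}"

(* The non-strict lexicographic order. Product_Lexorder is not used, since its order instance on
   pairs clashes with the componentwise order instance of HOL-Analysis. *)
definition lex_le :: "real \<times> nat \<Rightarrow> real \<times> nat \<Rightarrow> bool" where
  "lex_le p q \<longleftrightarrow> fst p < fst q \<or> fst p = fst q \<and> snd p \<le> snd q"

definition dom_pair :: "real^'n^'n \<Rightarrow> real \<times> nat" where
  "dom_pair A =
     (THE p. p \<in> (\<lambda>z. (Re z, spec_index A z)) ` spectrum A \<and>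
             (\<forall>q \<in> (\<lambda>z. (Re z, spec_index A z)) ` spectrum A. lex_le q p))"

definition dom_spectrum :: "real^'n^'n \<Rightarrow> complex set" where
  "dom_spectrum A = {z \<in> spectrum A. (Re z, spec_index A z) = dom_pair A}"

definition flow_dom_spectrum :: "(real \<Rightarrow> real^'n \<Rightarrow> real^'n) \<Rightarrow> complex set" where
  "flow_dom_spectrum \<phi> = dom_spectrum (generator \<phi>)"

section \<open>Benford functions\<close>

definition significand :: "nat \<Rightarrow> real \<Rightarrow> real" where
  "significand b x =
     (if x = 0 then 0
      else (THE s. 1 \<le> s \<and> s < real b \<and> (\<exists>k::int. \<bar>x\<bar> = s * real b powi k)))"

(* Only the restriction of f to the nonnegative half-line matters. *)
definition benford :: "nat \<Rightarrow> (real \<Rightarrow> real) \<Rightarrow> bool" where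
  "benford b f \<longleftrightarrow>
     f \<in> borel_measurable (restrict_space borel {0..}) \<and>
     (\<forall>s \<in> {1..<real b}.
        ((\<lambda>T. measure lebesgue {t. 0 \<le> t \<and> t \<le> T \<and> significand b (f t) \<le> s} / T)
           \<longlongrightarrow> log (real b) s) at_top)"

section \<open>Nonresonance\<close>

definition span_rat :: "complex set \<Rightarrow> complex set" where
  "span_rat = module.span (\<lambda>(q::rat) z. of_rat q * z)"

lemma vector_space_rat_complex: "vector_space (\<lambda>(q::rat) (z::complex). of_rat q * z)"
  by unfold_locales (simp_all add: algebra_simps of_rat_add of_rat_mult)

definition Delta :: "complex set \<Rightarrow> real set" where
  "Delta Z = {1 + (Arg z - Arg w) / (2 * pi) | z w. z \<in> Z \<and> w \<in> Z}"

(* Nonresonance of a nonempty subset Z of the circle of radius r > 0. *)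
definition circle_nonresonant :: "nat \<Rightarrow> real \<Rightarrow> complex set \<Rightarrow> bool" where
  "circle_nonresonant b r Z \<longleftrightarrow>
     Delta Z \<inter> \<rat> = {1} \<and>
     complex_of_real (log (real b) r) \<notin> span_rat (complex_of_real ` Delta Z)"

definition nonresonant :: "nat \<Rightarrow> complex set \<Rightarrow> bool" where
  "nonresonant b Z \<longleftrightarrow>
     (\<forall>r>0. Z \<inter> sphere 0 r = {} \<or> circle_nonresonant b r (Z \<inter> sphere 0 r))"

definition exp_nonresonant :: "nat \<Rightarrow> complex set \<Rightarrow> bool" where
  "exp_nonresonant b Z \<longleftrightarrow>
     (\<exists>t\<ge>0. nonresonant b ((\<lambda>z. exp (complex_of_real t * z)) ` Z))"

section \<open>Linear functionals on the space of linear maps\<close>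

(* The identification of coefficient arrays with linear functionals by means of the basis dual to
   the matrix units; Lebesgue measure on the former gives the meaning of "almost every". *)
definition functional :: "real^'n^'n \<Rightarrow> (real^'n^'n \<Rightarrow> real)" where
  "functional c = (\<lambda>A. \<Sum>i\<in>UNIV. \<Sum>j\<in>UNIV. c $ i $ j * A $ i $ j)"

lemma functional_eq_inner: "functional c A = c \<bullet> A"
  by (simp add: functional_def inner_vec_def)

lemma bij_betw_functional:
  "bij_betw functional UNIV {H :: real^'n^'n \<Rightarrow> real. linear H}"
proof (rule bij_betw_imageI)
  show "inj (functional :: real^'n^'n \<Rightarrow> _)"
    by (rule injI) (metis functional_eq_inner vector_eq_rdot inner_commute)
  show "range functional = {H :: real^'n^'n \<Rightarrow> real. linear H}"
  proof (intro set_eqI iffI)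
    fix H :: "real^'n^'n \<Rightarrow> real"
    assume "H \<in> range functional"
    then obtain c where "H = functional c" by blast
    then have "H = (\<lambda>A. c \<bullet> A)"
      by (simp add: functional_eq_inner fun_eq_iff)
    then show "H \<in> {H. linear H}"
      by (simp add: bounded_linear.linear bounded_linear_inner_right)
  next
    fix H :: "real^'n^'n \<Rightarrow> real"
    assume "H \<in> {H. linear H}"
    then have lin: "linear H" by simp
    have "H A = adjoint H 1 \<bullet> A" for A
      using adjoint_works[OF lin, of A 1] by (simp add: inner_commute)
    then have "H = functional (adjoint H 1)"
      by (simp add: functional_eq_inner fun_eq_iff)
    then show "H \<in> range functional" by blast
  qed
qed

definition almost_every_functional :: "((real^'n^'n \<Rightarrow> real) \<Rightarrow> bool) \<Rightarrow> bool" where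
  "almost_every_functional P \<longleftrightarrow> (AE c in lebesgue. P (functional c))"

end

theory Submission
  imports Defs "HOL-Probability.Probability" "HOL-Complex_Analysis.Complex_Analysis"
    "HOL-Computational_Algebra.Computational_Algebra"
begin

text \<open>
Let \<open>A\<close> be the generator, \<open>D\<close> its dominant spectrum, \<open>r\<close> the common real part of the elements of \<open>D\<close> and
\<open>k\<close> their common index. Both statements of the theorem turn out to be equivalent to

  (*) \<open>2 * pi / ln b * r\<close> is not a rational linear combination of the numbers \<open>Im z\<close> with \<open>z \<in> D\<close>.

Exponential nonresonance of \<open>D\<close> is (*) because, for all but countably many \<open>t\<close>, the arguments of the
numbers \<open>e\<^sup>t\<^sup>z\<close> satisfy no rational relations apart from those between the imaginary parts, and because
\<open>D\<close> is closed under conjugation, so that the differences of imaginary parts have the same span as the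
imaginary parts themselves.

The flow behaves like \<open>e\<^sup>r\<^sup>t t\<^sup>k (Q(t) + o(1))\<close>, where \<open>Q\<close> is a matrix-valued trigonometric polynomial with
frequencies \<open>Im z\<close>. For a functional given by \<open>c\<close>, let \<open>G = c \<bullet> Q\<close>. By Weyl's criterion, the function is
Benford if and only if the averages over \<open>[0,T]\<close> of its phases, the product of \<open>cis (k \<beta> ln t)\<close>,
\<open>cis (\<beta> r t)\<close> and \<open>cis (\<beta> ln \<bar>G(t) + o(1)\<bar>)\<close>, tend to zero for every \<open>\<beta> = 2 \<pi> n / ln b\<close> with \<open>n \<noteq> 0\<close>.

Suppose (*). For almost every \<open>c\<close> the function \<open>G\<close> is not zero. Its translates form a precompact family
of nonzero analytic functions, so the times where \<open>G\<close> is small have small density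
(\<open>trig_sublevel_density\<close>). Elsewhere the last factor is a continuous function of \<open>G\<close>, which the
Weierstrass theorem replaces by a polynomial in \<open>G\<close>. This is a trigonometric polynomial with
frequencies in the rational span of the \<open>Im z\<close>, and by (*) none of them cancels \<open>\<beta> r\<close>. Hence all
averages vanish in the limit (\<open>nonresonant_imp_benford\<close>).

Suppose that (*) fails. A particular functional may still give a Benford function, so \<open>c\<close> is randomised.
If almost every \<open>c\<close> were good, then so would be almost every sample of any nondegenerate Gaussian law.
A law is chosen for which \<open>c \<bullet> Q(t)\<close> has variance one at all times \<open>t\<close> and mean \<open>\<epsilon> w(t)\<close>, where \<open>w\<close> is the
sum of the cosines of the frequencies in \<open>D\<close>. This is possible because the coefficients of \<open>Q\<close> are linearly
independent, so that a linear change of coordinates turns \<open>Q\<close> into a curve on a sphere. Taking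
expectations, the averages of \<open>cis (k \<beta> ln t) cis (\<beta> r t) \<Psi>(\<epsilon> w(t))\<close> tend to zero for all \<open>\<epsilon>\<close>, where
\<open>\<Psi>(y)\<close> is the expected phase \<open>gauss_phase \<beta> y\<close> of a Gaussian variable with mean \<open>y\<close> and variance one.
Now \<open>\<Psi>\<close> is even, entire, bounded on the real line and not constant, so infinitely many of its even Taylor
coefficients are nonzero. On the other hand, the mean of \<open>cis (\<beta> r t) w(t)\<^sup>N\<close> is a nonnegative number, and
for a suitable \<open>n\<close> the failure of (*) makes it positive for all large even \<open>N\<close> (\<open>rspan_mu\<close>, \<open>mu_pad\<close>). The least \<open>N\<close>
for which both numbers are nonzero gives the leading term for small \<open>\<epsilon>\<close>, and this term does not tend to
zero (\<open>gauss_phase_average_not_null\<close>, \<open>resonant_imp_not_benford\<close>).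

The asymptotics rest on a primary decomposition in place of the Jordan normal form. Bezout's identity for polynomials yields matrices \<open>E z\<close>
with sum one that commute with \<open>A\<close> and satisfy \<open>(A - z)\<^sup>N E z = 0\<close>. The drop of the rank in the definition
of the index then becomes \<open>(A - z)\<^sup>k E z \<noteq> 0\<close> (\<open>rank_drop_iff_active\<close>), and the flow is an explicit
exponential sum by uniqueness for linear differential equations.
\<close>

section \<open>Exponential nonresonance as a condition on one real number\<close>

text \<open>The rational span of a set of real numbers, expressed through the span in the complex plane, so that it
  agrees by definition with the one that occurs in the notion of nonresonance.\<close>
definition rspan :: "real set \<Rightarrow> real set" where
  "rspan W = {x. complex_of_real x \<in> span_rat (complex_of_real ` W)}"

interpretation rat_complex: vector_space "\<lambda>(q::rat) (z::complex). of_rat q * z"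
  by (rule vector_space_rat_complex)

lemma rspan_base: "x \<in> W \<Longrightarrow> x \<in> rspan W"
  by (simp add: rspan_def span_rat_def rat_complex.span_base)

lemma rspan_zero: "0 \<in> rspan W"
  by (simp add: rspan_def span_rat_def rat_complex.span_zero)

lemma rspan_add: "x \<in> rspan W \<Longrightarrow> y \<in> rspan W \<Longrightarrow> x + y \<in> rspan W"
  by (simp add: rspan_def span_rat_def rat_complex.span_add)

lemma of_real_of_rat: "complex_of_real (of_rat q) = of_rat q"
  by (cases q) (simp add: of_rat_rat)

lemma rspan_scale: "x \<in> rspan W \<Longrightarrow> of_rat q * x \<in> rspan W"
  using rat_complex.span_scale[of "complex_of_real x" _ q]
  by (simp add: rspan_def span_rat_def of_real_of_rat)

lemma rspan_scale_Rats: "x \<in> rspan W \<Longrightarrow> a \<in> \<rat> \<Longrightarrow> a * x \<in> rspan W"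
  by (metis Rats_cases rspan_scale)

lemma rspan_minus: "x \<in> rspan W \<Longrightarrow> - x \<in> rspan W"
  using rspan_scale_Rats[of x W "-1"] by simp

lemma rspan_induct [consumes 1, case_names zero add scale base]:
  assumes "x \<in> rspan W" "P 0" "\<And>x y. P x \<Longrightarrow> P y \<Longrightarrow> P (x + y)"
    and "\<And>a x. a \<in> \<rat> \<Longrightarrow> P x \<Longrightarrow> P (a * x)" and "\<And>x. x \<in> W \<Longrightarrow> P x"
  shows "P x"
proof -
  have "rat_complex.span (complex_of_real ` W) \<subseteq> complex_of_real ` {x. P x}"
  proof (rule rat_complex.span_minimal)
    show "rat_complex.subspace (complex_of_real ` {x. P x})"
      unfolding rat_complex.subspace_def
    proof (intro conjI ballI allI)
      show "0 \<in> complex_of_real ` {x. P x}" using assms(2) by (auto intro!: image_eqI[of _ _ 0])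
    next
      fix u v assume "u \<in> complex_of_real ` {x. P x}" "v \<in> complex_of_real ` {x. P x}"
      then obtain a b where "u = of_real a" "v = of_real b" "P a" "P b" by auto
      then show "u + v \<in> complex_of_real ` {x. P x}"
        using assms(3) by (auto intro!: image_eqI[of _ _ "a + b"])
    next
      fix q u assume "u \<in> complex_of_real ` {x. P x}"
      then obtain a where "u = of_real a" "P a" by auto
      then show "of_rat q * u \<in> complex_of_real ` {x. P x}"
        using assms(4)[of "of_rat q" a]
        by (auto intro!: image_eqI[of _ _ "of_rat q * a"] simp: of_real_of_rat)
    qed
  qed (use assms(5) in auto)
  then have "complex_of_real x \<in> complex_of_real ` {x. P x}"
    using assms(1) by (auto simp: rspan_def span_rat_def)
  then show ?thesis by (auto simp: image_iff)
qed

lemma rspan_linear_image: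
  assumes "x \<in> rspan W" "\<And>y. y \<in> W \<Longrightarrow> c * y \<in> rspan V"
  shows "c * x \<in> rspan V"
  using assms(1)
proof (induction rule: rspan_induct)
  case (add x y) then show ?case by (simp add: distrib_left rspan_add)
next
  case (scale a x) then show ?case using rspan_scale_Rats[of "c*x" V a] by (simp add: mult.left_commute)
qed (auto simp: rspan_zero assms(2))

text \<open>Countability is what leaves room for a generic time \<open>t\<close>.\<close>
lemma countable_rspan:
  assumes "finite W" shows "countable (rspan W)"
  using assms
proof induction
  case empty
  have "rspan {} = {0}" by (auto simp: rspan_def span_rat_def rat_complex.span_empty)
  then show ?case by simp
next
  case (insert w W)
  have "rspan (insert w W) \<subseteq> (\<lambda>(q, x). of_rat q * w + x) ` (UNIV \<times> rspan W)"
  proof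
    fix x assume "x \<in> rspan (insert w W)"
    then obtain q where "complex_of_real x - of_rat q * of_real w \<in> rat_complex.span (of_real ` W)"
      by (auto simp: rspan_def span_rat_def rat_complex.span_insert)
    then have "x - of_rat q * w \<in> rspan W"
      by (simp add: rspan_def span_rat_def of_real_of_rat)
    then show "x \<in> (\<lambda>(q, x). of_rat q * w + x) ` (UNIV \<times> rspan W)"
      by (intro image_eqI[of _ _ "(q, x - of_rat q * w)"]) auto
  qed
  moreover have "countable ((\<lambda>(q::rat, x). of_rat q * w + x) ` (UNIV \<times> rspan W))"
    using insert.IH by (intro countable_image countable_SIGMA) auto
  ultimately show ?case by (rule countable_subset)
qed

lemma Arg_exp_eq: "\<exists>m::int. Arg (exp z) = Im z + of_int m * (2 * pi)"
proof -
  have "exp z = exp (of_real (Re z)) * exp (\<i> * of_real (Im z))"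
    by (simp flip: exp_add complex_eq)
  also have "\<dots> = of_real (exp (Re z)) * exp (\<i> * of_real (Im z))" by (simp add: exp_of_real)
  finally have "exp z = of_real (exp (Re z)) * exp (\<i> * of_real (Im z))" .
  moreover have "exp z = of_real (cmod (exp z)) * exp (\<i> * of_real (Arg (exp z)))"
    by (rule Arg_eq) simp
  ultimately have "exp (\<i> * of_real (Im z)) = exp (\<i> * of_real (Arg (exp z)))"
    by (metis exp_not_eq_zero exp_of_real mult_cancel_left norm_exp_eq_Re)
  then obtain m :: int where "\<i> * complex_of_real (Arg (exp z)) = \<i> * of_real (Im z) + (of_int (2 * m) * pi) * \<i>"
    by (metis complex_exp_exists exp_eq)
  then have "\<i> * complex_of_real (Arg (exp z)) = \<i> * of_real (Im z + of_int m * (2 * pi))"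
    by (simp add: algebra_simps)
  then have "Arg (exp z) = Im z + of_int m * (2 * pi)"
    by (metis complex_i_not_zero mult_cancel_left of_real_eq_iff)
  then show ?thesis by blast
qed

text \<open>The elements of the set \<open>Delta\<close> of \<open>e\<^sup>t\<^sup>Z\<close> are differences of imaginary parts up to an integer, and 1 is always
  one of these elements. The integers are therefore harmless in every span.\<close>
lemma Arg_diff_exp:
  "\<exists>m::int. 1 + (Arg (exp z) - Arg (exp w)) / (2 * pi) = (Im z - Im w) / (2 * pi) + of_int m"
proof -
  obtain m n :: int where "Arg (exp z) = Im z + of_int m * (2 * pi)" "Arg (exp w) = Im w + of_int n * (2 * pi)"
    using Arg_exp_eq by metis
  then have "1 + (Arg (exp z) - Arg (exp w)) / (2 * pi) = (Im z - Im w) / (2 * pi) + of_int (1 + m - n)"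
    by (simp add: field_simps)
  then show ?thesis by blast
qed

text \<open>The relation between \<open>z\<close> and its conjugate puts \<open>t * Im z / pi\<close>, up to an integer, into the span
  of \<open>Delta\<close>. Multiplication by \<open>t / (2 * pi)\<close> turns a rational relation for \<open>2 * pi / ln b * r\<close> into one for the logarithm of the
  radius \<open>exp (t * r)\<close>.\<close>
lemma exp_nonresonant_imp:
  assumes Z: "Z \<noteq> {}" "\<And>z. z \<in> Z \<Longrightarrow> Re z = r" "\<And>z. z \<in> Z \<Longrightarrow> cnj z \<in> Z"
    and b: "b \<ge> 2" and nr: "exp_nonresonant b Z"
  shows "2 * pi / ln b * r \<notin> rspan (Im ` Z)"
proof
  assume r: "2 * pi / ln b * r \<in> rspan (Im ` Z)"
  obtain t where t: "t \<ge> 0" "nonresonant b ((\<lambda>z. exp (complex_of_real t * z)) ` Z)"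
    using nr by (auto simp: exp_nonresonant_def)
  define Y where "Y = (\<lambda>z. exp (complex_of_real t * z)) ` Z"
  have "Y \<inter> sphere 0 (exp (t * r)) = Y" using Z(2) by (auto simp: Y_def)
  then have "circle_nonresonant b (exp (t * r)) Y"
    using t Z(1) unfolding nonresonant_def Y_def[symmetric] by (metis Y_def exp_gt_zero image_is_empty)
  then have D: "Delta Y \<inter> \<rat> = {1}" "log b (exp (t * r)) \<notin> rspan (Delta Y)"
    by (auto simp: circle_nonresonant_def rspan_def)
  have one: "1 \<in> rspan (Delta Y)" using D(1) by (auto intro: rspan_base)
  have "(t / (2 * pi)) * (2 * pi / ln b * r) \<in> rspan (Delta Y)"
    using r
  proof (rule rspan_linear_image)
    fix y assume "y \<in> Im ` Z"
    then obtain z where z: "z \<in> Z" "y = Im z" by auto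
    have "1 + (Arg (exp (of_real t * z)) - Arg (exp (of_real t * cnj z))) / (2 * pi) \<in> rspan (Delta Y)"
      using z Z(3) by (intro rspan_base) (auto simp: Delta_def Y_def)
    then obtain m :: int where "(t * y - - (t * y)) / (2 * pi) + of_int m * 1 \<in> rspan (Delta Y)"
      using Arg_diff_exp[of "of_real t * z" "of_real t * cnj z"] z by auto
    moreover have "- of_int m * 1 \<in> rspan (Delta Y)"
      using one by (intro rspan_scale_Rats) auto
    ultimately have "(t * y - - (t * y)) / (2 * pi) \<in> rspan (Delta Y)"
      using rspan_add by fastforce
    then have "(1/2) * ((t * y - - (t * y)) / (2 * pi)) \<in> rspan (Delta Y)"
      by (intro rspan_scale_Rats) auto
    then show "t / (2 * pi) * y \<in> rspan (Delta Y)" by simp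
  qed
  moreover have "(t / (2 * pi)) * (2 * pi / ln b * r) = log b (exp (t * r))"
    by (simp add: log_def)
  ultimately show False using D(2) by simp
qed

text \<open>Choose \<open>t\<close> outside the countable set of all \<open>2 * pi * q / x\<close> with rational \<open>q\<close> and nonzero \<open>x\<close> in the span generated by the
  imaginary parts and \<open>2 * pi / ln b * r\<close>. Then a product \<open>t * x / (2 * pi)\<close> with \<open>x\<close> in this span is rational only
  for \<open>x = 0\<close>, which settles both parts of nonresonance.\<close>
lemma exp_nonresonant_if:
  assumes Z: "finite Z" "Z \<noteq> {}" "\<And>z. z \<in> Z \<Longrightarrow> Re z = r"
    and b: "b \<ge> 2" and r: "2 * pi / ln b * r \<notin> rspan (Im ` Z)"
  shows "exp_nonresonant b Z"
proof -
  define W where "W = rspan (insert (2 * pi / ln b * r) (Im ` Z))"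
  have "countable (\<Union>x\<in>W - {0}. \<Union>q::rat. {of_rat q * (2 * pi) / x})"
    unfolding W_def using Z(1) by (intro countable_UN countable_Diff countable_rspan) auto
  moreover have "uncountable {0<..<1::real}" by (simp add: uncountable_open_interval)
  ultimately have "\<not> {0<..<1::real} \<subseteq> (\<Union>x\<in>W - {0}. \<Union>q::rat. {of_rat q * (2 * pi) / x})"
    using countable_subset by blast
  then obtain t where "t \<in> {0<..<1::real}" and t2: "t \<notin> (\<Union>x\<in>W - {0}. \<Union>q::rat. {of_rat q * (2 * pi) / x})"
    by blast
  then have t: "t > 0" "t \<notin> (\<Union>x\<in>W - {0}. \<Union>q::rat. {of_rat q * (2 * pi) / x})" by auto
  have gen: "x = 0" if "x \<in> W" "t * x / (2 * pi) \<in> \<rat>" for x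
  proof (rule ccontr)
    assume x: "x \<noteq> 0"
    obtain q where "t * x / (2 * pi) = of_rat q" using \<open>t * x / (2 * pi) \<in> \<rat>\<close> by (rule Rats_cases)
    then have "t = of_rat q * (2 * pi) / x" using x by (simp add: field_simps)
    then show False using t(2) that(1) x by blast
  qed
  have W: "Im z \<in> W" if "z \<in> Z" for z using that by (auto simp: W_def intro: rspan_base)
  define Y where "Y = (\<lambda>z. exp (complex_of_real t * z)) ` Z"
  have "circle_nonresonant b (exp (t * r)) Y"
    unfolding circle_nonresonant_def
  proof
    have D: "\<exists>z w m. z \<in> Z \<and> w \<in> Z \<and> x = t * (Im z - Im w) / (2 * pi) + of_int m \<and>
         x = 1 + (Arg (exp (of_real t * z)) - Arg (exp (of_real t * w))) / (2 * pi)" if "x \<in> Delta Y" for x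
    proof -
      from that obtain z w where zw: "z \<in> Z" "w \<in> Z"
        "x = 1 + (Arg (exp (of_real t * z)) - Arg (exp (of_real t * w))) / (2 * pi)"
        by (auto simp: Delta_def Y_def)
      moreover obtain m :: int where
        "1 + (Arg (exp (of_real t * z)) - Arg (exp (of_real t * w))) / (2 * pi) =
           (Im (of_real t * z) - Im (of_real t * w)) / (2 * pi) + of_int m"
        using Arg_diff_exp by blast
      then have "1 + (Arg (exp (of_real t * z)) - Arg (exp (of_real t * w))) / (2 * pi) =
          t * (Im z - Im w) / (2 * pi) + of_int m"
        by (simp add: right_diff_distrib)
      ultimately show ?thesis by metis
    qed
    show "Delta Y \<inter> \<rat> = {1}"
    proof (intro equalityI subsetI)
      fix x assume x: "x \<in> Delta Y \<inter> \<rat>"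
      then obtain z w and m :: int where zw: "z \<in> Z" "w \<in> Z" "x = t * (Im z - Im w) / (2 * pi) + of_int m"
         "x = 1 + (Arg (exp (of_real t * z)) - Arg (exp (of_real t * w))) / (2 * pi)" using D by blast
      have "t * (Im z - Im w) / (2 * pi) \<in> \<rat>"
        using x zw(3) by (metis Int_iff Rats_add Rats_minus_iff Rats_of_int add.commute add_diff_cancel_left' diff_conv_add_uminus)
      moreover have "Im z - Im w \<in> W"
        using rspan_add[of "Im z" _ "- Im w"] rspan_minus W zw(1,2) by (auto simp: W_def)
      ultimately have "Im z = Im w" using gen by force
      then have "z = w" using zw(1,2) Z(3) by (auto simp: complex_eq_iff)
      then show "x \<in> {1}" using zw(4) by simp
    next
      fix x :: real assume "x \<in> {1}"
      moreover obtain z where "z \<in> Z" using Z(2) by auto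
      ultimately show "x \<in> Delta Y \<inter> \<rat>"
        by (auto simp: Delta_def Y_def intro!: exI[of _ "exp (of_real t * z)"])
    qed
    show "complex_of_real (log b (exp (t * r))) \<notin> span_rat (complex_of_real ` Delta Y)"
    proof
      assume "complex_of_real (log b (exp (t * r))) \<in> span_rat (complex_of_real ` Delta Y)"
      then have "log b (exp (t * r)) \<in> rspan (Delta Y)" by (simp add: rspan_def)
      \<comment> \<open>Modulo the rationals, the span of \<open>Delta Y\<close> lies in \<open>t / (2 * pi)\<close> times the span of the imaginary parts.\<close>
      then have "\<exists>s\<in>rspan (Im ` Z). log b (exp (t * r)) - t * s / (2 * pi) \<in> \<rat>"
      proof (induction rule: rspan_induct)
        case zero show ?case using rspan_zero by force
      next
        case (add x y)
        then obtain s u where "s \<in> rspan (Im ` Z)" "u \<in> rspan (Im ` Z)"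
          "x - t * s / (2 * pi) \<in> \<rat>" "y - t * u / (2 * pi) \<in> \<rat>" by auto
        then have "s + u \<in> rspan (Im ` Z)" "(x - t * s / (2 * pi)) + (y - t * u / (2 * pi)) \<in> \<rat>"
          by (auto intro: rspan_add)
        then show ?case
          by (intro bexI[of _ "s + u"]) (simp_all add: algebra_simps add_divide_distrib)
      next
        case (scale a x)
        then obtain s where s: "s \<in> rspan (Im ` Z)" "x - t * s / (2 * pi) \<in> \<rat>" by auto
        then have "a * s \<in> rspan (Im ` Z)" "a * (x - t * s / (2 * pi)) \<in> \<rat>"
          using scale(1) by (auto intro: rspan_scale_Rats)
        then show ?case by (intro bexI[of _ "a * s"]) (simp_all add: algebra_simps)
      next
        case (base x)
        then obtain z w and m :: int where zw: "z \<in> Z" "w \<in> Z" "x = t * (Im z - Im w) / (2 * pi) + of_int m"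
          using D by blast
        then show ?case
          by (intro bexI[of _ "Im z - Im w"])
             (use rspan_add[of "Im z" "Im ` Z" "- Im w"] in \<open>auto intro: rspan_minus rspan_base\<close>)
      qed
      then obtain s where s: "s \<in> rspan (Im ` Z)" "log b (exp (t * r)) - t * s / (2 * pi) \<in> \<rat>" by blast
      have "s \<in> W" using s(1) unfolding W_def
        by (induction rule: rspan_induct) (auto intro: rspan_zero rspan_add rspan_scale_Rats rspan_base)
      then have "2 * pi / ln b * r - s \<in> W"
        using rspan_add[of "2 * pi / ln b * r" _ "- s"] rspan_minus rspan_base unfolding W_def by force
      moreover have "t * (2 * pi / ln b * r - s) / (2 * pi) = log b (exp (t * r)) - t * s / (2 * pi)"
        by (simp add: log_def field_simps)
      ultimately have "2 * pi / ln b * r - s = 0" using gen s(2) by metis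
      then show False using s(1) r by simp
    qed
  qed
  moreover have "Y \<inter> sphere 0 \<rho> = (if \<rho> = exp (t * r) then Y else {})" for \<rho>
    using Z(3) by (auto simp: Y_def)
  ultimately have "nonresonant b Y" by (auto simp: nonresonant_def)
  then show ?thesis using t(1) by (auto simp: exp_nonresonant_def Y_def intro!: exI[of _ t])
qed

section \<open>Time averages and trigonometric polynomials\<close>

definition avg :: "(real \<Rightarrow> complex) \<Rightarrow> real \<Rightarrow> complex" where
  "avg g T = (LINT t:{0..T}|lborel. g t) / of_real T"

text \<open>Bounded Borel functions, the class on which time averages are linear without further side conditions.\<close>
definition bmeas :: "(real \<Rightarrow> complex) \<Rightarrow> bool" where
  "bmeas g \<longleftrightarrow> g \<in> borel_measurable borel \<and> bounded (range g)"

lemma bmeasI: "g \<in> borel_measurable borel \<Longrightarrow> (\<And>t. cmod (g t) \<le> B) \<Longrightarrow> bmeas g"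
  by (auto simp: bmeas_def bounded_iff)

lemma bmeas_measurable [measurable_dest]: "bmeas g \<Longrightarrow> g \<in> borel_measurable borel"
  by (simp add: bmeas_def)

lemma bmeas_bound: assumes "bmeas g" obtains B where "B > 0" "\<And>t. cmod (g t) \<le> B"
  using assms unfolding bmeas_def bounded_pos by auto

lemma bmeas_const: "bmeas (\<lambda>t. c)"
  by (rule bmeasI[of _ "cmod c"]) auto

lemma bmeas_add: assumes "bmeas g" "bmeas h" shows "bmeas (\<lambda>t. g t + h t)"
proof -
  obtain B C where "\<And>t. cmod (g t) \<le> B" "\<And>t. cmod (h t) \<le> C" using assms by (metis bmeas_bound)
  then have "cmod (g t + h t) \<le> B + C" for t by (intro norm_triangle_le add_mono)
  then show ?thesis using assms by (intro bmeasI) (auto simp: bmeas_def)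
qed

lemma bmeas_mult: assumes "bmeas g" "bmeas h" shows "bmeas (\<lambda>t. g t * h t)"
proof -
  obtain B C where "B > 0" "\<And>t. cmod (g t) \<le> B" "\<And>t. cmod (h t) \<le> C" using assms by (metis bmeas_bound)
  then have "cmod (g t * h t) \<le> B * C" for t unfolding norm_mult by (intro mult_mono) auto
  then show ?thesis using assms by (intro bmeasI) (auto simp: bmeas_def)
qed

lemma bmeas_cmult: "bmeas g \<Longrightarrow> bmeas (\<lambda>t. c * g t)"
  by (intro bmeas_mult bmeas_const)

lemma bmeas_diff: "bmeas g \<Longrightarrow> bmeas h \<Longrightarrow> bmeas (\<lambda>t. g t - h t)"
  using bmeas_add[of g "\<lambda>t. (-1) * h t"] bmeas_cmult[of h "-1"] by simp

lemma bmeas_sum: "(\<And>i. i \<in> I \<Longrightarrow> bmeas (g i)) \<Longrightarrow> bmeas (\<lambda>t. \<Sum>i\<in>I. g i t)"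
  by (induction I rule: infinite_finite_induct) (auto intro: bmeas_const bmeas_add)

lemma bmeas_power: "bmeas g \<Longrightarrow> bmeas (\<lambda>t. g t ^ n)"
  by (induction n) (auto intro: bmeas_const bmeas_mult)

lemma bmeas_cis: "u \<in> borel_measurable borel \<Longrightarrow> bmeas (\<lambda>t. cis (u t))"
proof (rule bmeasI[of _ 1])
  assume [measurable]: "u \<in> borel_measurable borel"
  have "cis \<in> borel_measurable borel" by (intro borel_measurable_continuous_onI continuous_intros)
  then show "(\<lambda>t. cis (u t)) \<in> borel_measurable borel" by measurable
qed simp

lemma bmeas_set_integrable: assumes "bmeas g" shows "set_integrable lborel {a..b} g"
proof -
  obtain B where B: "\<And>t. cmod (g t) \<le> B" using assms by (metis bmeas_bound)
  show ?thesis unfolding set_integrable_def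
    by (rule integrableI_bounded_set_indicator[where B = B])
       (use assms B in \<open>auto simp: bmeas_def emeasure_lborel_Icc_eq\<close>)
qed

lemma avg_add: "bmeas g \<Longrightarrow> bmeas h \<Longrightarrow> avg (\<lambda>t. g t + h t) T = avg g T + avg h T"
  by (simp add: avg_def bmeas_set_integrable set_integral_add add_divide_distrib)

lemma avg_diff: "bmeas g \<Longrightarrow> bmeas h \<Longrightarrow> avg (\<lambda>t. g t - h t) T = avg g T - avg h T"
  by (simp add: avg_def bmeas_set_integrable set_integral_diff diff_divide_distrib)

lemma avg_cmult: "avg (\<lambda>t. c * g t) T = c * avg g T"
  by (simp add: avg_def)

lemma avg_sum: "(\<And>i. i \<in> I \<Longrightarrow> bmeas (g i)) \<Longrightarrow> avg (\<lambda>t. \<Sum>i\<in>I. g i t) T = (\<Sum>i\<in>I. avg (g i) T)"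
  by (induction I rule: infinite_finite_induct)
     (auto simp: avg_add bmeas_sum, auto simp: avg_def set_lebesgue_integral_def)

lemma avg_const: "T > 0 \<Longrightarrow> avg (\<lambda>t. c) T = c"
  by (simp add: avg_def set_lebesgue_integral_def scaleR_conv_of_real)

text \<open>A bound \<open>e\<close> off a set \<open>A\<close> and a crude bound on \<open>A\<close> suffice when \<open>A\<close> has small density. All approximations below
  are of this kind.\<close>
lemma norm_avg_le:
  assumes g: "bmeas g" and T: "T > 0" and A: "A \<in> sets borel" and D: "D \<ge> 0"
    and le: "\<And>t. 0 \<le> t \<Longrightarrow> t \<le> T \<Longrightarrow> cmod (g t) \<le> e + D * indicator A t"
  shows "cmod (avg g T) \<le> e + D * (measure lborel ({0..T} \<inter> A) / T)"
proof -
  have fin: "emeasure lborel ({0..T} \<inter> A) < \<infinity>"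
    using emeasure_mono[of "{0..T} \<inter> A" "{0..T}" lborel] T
    by (auto simp: emeasure_lborel_Icc_eq intro: le_less_trans)
  have i1: "integrable lborel (\<lambda>t. e * indicator {0..T} t :: real)"
    by (intro integrable_mult_right integrable_real_indicator) (use T in auto)
  have i2: "integrable lborel (\<lambda>t. D * indicator ({0..T} \<inter> A) t :: real)"
    using fin A by (intro integrable_mult_right integrable_real_indicator) auto
  have "cmod (LINT t:{0..T}|lborel. g t) \<le> (LINT t:{0..T}|lborel. cmod (g t))"
    by (rule set_integral_norm_bound[OF bmeas_set_integrable[OF g]])
  also have "\<dots> \<le> (LINT t|lborel. e * indicator {0..T} t + D * indicator ({0..T} \<inter> A) t)"
    unfolding set_lebesgue_integral_def
  proof (rule integral_mono)
    show "integrable lborel (\<lambda>t. indicator {0..T} t *\<^sub>R cmod (g t))"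
      using set_integrable_norm[OF bmeas_set_integrable[OF g]] unfolding set_integrable_def .
    show "integrable lborel (\<lambda>t. e * indicator {0..T} t + D * indicator ({0..T} \<inter> A) t)"
      using i1 i2 by (rule Bochner_Integration.integrable_add)
  qed (use le in \<open>auto simp: indicator_def split: if_splits\<close>)
  also have "\<dots> = e * T + D * measure lborel ({0..T} \<inter> A)"
    using i1 i2 T by (subst Bochner_Integration.integral_add) auto
  finally have "cmod (LINT t:{0..T}|lborel. g t) / T \<le> (e * T + D * measure lborel ({0..T} \<inter> A)) / T"
    using T by (intro divide_right_mono) auto
  then show ?thesis using T by (simp add: avg_def norm_divide add_divide_distrib)
qed

lemma norm_avg_le_const:
  assumes g: "bmeas g" and T: "T > 0" and le: "\<And>t. cmod (g t) \<le> e"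
  shows "cmod (avg g T) \<le> e"
  using norm_avg_le[OF g T, of "{}" 0 e] le by simp

lemma avg_tendsto_0:
  assumes g: "bmeas g" and lim: "(g \<longlongrightarrow> 0) at_top"
  shows "(avg g \<longlongrightarrow> 0) at_top"
proof (rule tendstoI)
  fix e :: real assume e: "e > 0"
  obtain B where B: "B > 0" "\<And>t. cmod (g t) \<le> B" using g by (metis bmeas_bound)
  have "\<forall>\<^sub>F t in at_top. cmod (g t) < e / 2"
    using tendstoD[OF lim, of "e/2"] e by simp
  then obtain S where S: "S \<ge> 0" "\<And>t. t \<ge> S \<Longrightarrow> cmod (g t) < e / 2"
    unfolding eventually_at_top_linorder by (metis linorder_linear order_trans)
  have "\<forall>\<^sub>F T in at_top. T > 2 * B * S / e \<and> T > 0"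
    by (intro eventually_conj eventually_gt_at_top)
  then show "\<forall>\<^sub>F T in at_top. dist (avg g T) 0 < e"
  proof eventually_elim
    case (elim T)
    have "cmod (avg g T) \<le> e / 2 + B * (measure lborel ({0..T} \<inter> {0..S}) / T)"
    proof (rule norm_avg_le[OF g])
      fix t assume "0 \<le> t" "t \<le> T"
      then show "cmod (g t) \<le> e / 2 + B * indicator {0..S} t"
        using B(2)[of t] S(2)[of t] e by (cases "t \<le> S") (auto intro: add_increasing less_imp_le)
    qed (use elim B in auto)
    also have "\<dots> \<le> e / 2 + B * (S / T)"
    proof -
      have "measure lborel ({0..T} \<inter> {0..S}) \<le> S" using S elim by (simp add: Int_atLeastAtMost min_def)
      then show ?thesis using elim B by (intro add_left_mono mult_left_mono divide_right_mono) auto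
    qed
    also have "\<dots> < e" using elim e by (simp add: field_simps)
    finally show ?case by simp
  qed
qed

lemma avg_diff_tendsto_0:
  assumes "bmeas g" "bmeas h" "((\<lambda>t. g t - h t) \<longlongrightarrow> 0) at_top"
  shows "((\<lambda>T. avg g T - avg h T) \<longlongrightarrow> 0) at_top"
  using avg_tendsto_0[OF bmeas_diff[OF assms(1,2)] assms(3)]
  by (simp add: avg_diff[OF assms(1,2), abs_def])

text \<open>An explicit antiderivative need only be known on \<open>[1,\<infinity>)\<close>, away from the singularity of the logarithm, since a
  bounded time interval does not contribute to averages.\<close>
lemma avg_FTC:
  assumes f: "bmeas f" "continuous_on {1..} f"
    and F: "\<And>t. t \<ge> 1 \<Longrightarrow> (F has_vector_derivative f t) (at t)"
  shows "((\<lambda>T. avg f T - F T / of_real T) \<longlongrightarrow> 0) at_top"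
proof -
  define C where "C = (LINT t:{0..1}|lborel. f t) - F 1"
  have eq: "avg f T - F T / of_real T = C / of_real T" if "T > 1" for T
  proof -
    have "(LINT t:{0..T}|lborel. f t) = (LINT t:{0..1}|lborel. f t) + (LINT t:{1..T}|lborel. f t)"
    proof -
      have "(LINT t:{0..1} \<union> {1..T}|lborel. f t) = (LINT t:{0..1}|lborel. f t) + (LINT t:{1..T}|lborel. f t)"
      proof (rule set_integral_Un_AE)
        show "AE x in lborel. \<not> (x \<in> {0..1::real} \<and> x \<in> {1..T})"
          by (rule AE_mp[OF AE_lborel_singleton[of 1]]) auto
      qed (use bmeas_set_integrable[OF f(1)] in auto)
      moreover have "{0..1} \<union> {1..T} = {0..T}" using that by auto
      ultimately show ?thesis by simp
    qed
    moreover have "(LINT t:{1..T}|lborel. f t) = F T - F 1"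
      unfolding set_lebesgue_integral_def
    proof (rule integral_FTC_atLeastAtMost)
      show "continuous_on {1..T} f" using f(2) by (rule continuous_on_subset) auto
    qed (use that F in \<open>auto intro: has_vector_derivative_at_within\<close>)
    ultimately show ?thesis by (simp add: avg_def C_def diff_divide_distrib add_divide_distrib)
  qed
  have "((\<lambda>T. C / of_real T) \<longlongrightarrow> 0) at_top"
  proof (rule Lim_null_comparison)
    show "\<forall>\<^sub>F T in at_top. norm (C / of_real T) \<le> cmod C / T"
      using eventually_gt_at_top[of 0] by eventually_elim (simp add: norm_divide)
    show "((\<lambda>T. cmod C / T) \<longlongrightarrow> 0) at_top" by real_asymp
  qed
  moreover have "\<forall>\<^sub>F T in at_top. C / of_real T = avg f T - F T / of_real T"
    using eventually_gt_at_top[of 1] by eventually_elim (simp add: eq)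
  ultimately show ?thesis by (rule Lim_transform_eventually)
qed

lemma has_vector_derivative_cis:
  assumes "(u has_real_derivative u') (at t)"
  shows "((\<lambda>t. cis (u t)) has_vector_derivative (\<i> * of_real u' * cis (u t))) (at t)"
  unfolding has_vector_derivative_complex_iff
  by (auto intro!: derivative_eq_intros assms)

text \<open>The logarithmic phase varies slowly. Adding the correction \<open>\<kappa> / (\<theta> * t)\<close>, which tends to zero, makes the integrand
  an exact derivative of a bounded function.\<close>
lemma avg_cis_ln_cis:
  assumes "\<theta> \<noteq> 0"
  shows "(avg (\<lambda>t. cis (\<kappa> * ln t) * cis (\<theta> * t)) \<longlongrightarrow> 0) at_top"
proof -
  define g where "g = (\<lambda>t::real. cis (\<kappa> * ln t) * cis (\<theta> * t))"
  \<comment> \<open>The maximum keeps the correction bounded near zero and changes nothing on \<open>[1,\<infinity>)\<close>.\<close>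
  define q where "q = (\<lambda>t::real. complex_of_real (\<kappa> / (\<theta> * max 1 t)))"
  define f where "f = (\<lambda>t. g t + q t * g t)"
  have g: "bmeas g" unfolding g_def by (intro bmeas_mult bmeas_cis) measurable
  have q: "bmeas q"
  proof (rule bmeasI)
    fix t show "cmod (q t) \<le> \<bar>\<kappa> / \<theta>\<bar>"
      using assms by (auto simp: q_def abs_mult norm_divide norm_mult divide_simps mult_le_cancel_left1)
  qed (simp add: q_def)
  have f: "bmeas f" unfolding f_def by (intro bmeas_add bmeas_mult g q)
  have "((\<lambda>T. avg f T - (cis (\<kappa> * ln T + \<theta> * T) / (\<i> * of_real \<theta>)) / of_real T) \<longlongrightarrow> 0) at_top"
  proof (rule avg_FTC[OF f])
    show "continuous_on {1..} f" unfolding f_def g_def q_def using assms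
      by (intro continuous_intros) auto
    fix t :: real assume t: "t \<ge> 1"
    have "((\<lambda>t. cis (\<kappa> * ln t + \<theta> * t)) has_vector_derivative
            (\<i> * of_real (\<kappa> / t + \<theta>) * cis (\<kappa> * ln t + \<theta> * t))) (at t)"
      using t by (intro has_vector_derivative_cis) (auto intro!: derivative_eq_intros)
    then have "((\<lambda>t. cis (\<kappa> * ln t + \<theta> * t) / (\<i> * of_real \<theta>)) has_vector_derivative
            (\<i> * of_real (\<kappa> / t + \<theta>) * cis (\<kappa> * ln t + \<theta> * t)) / (\<i> * of_real \<theta>)) (at t)"
      by (rule has_vector_derivative_divide)
    moreover have "(\<i> * of_real (\<kappa> / t + \<theta>) * cis (\<kappa> * ln t + \<theta> * t)) / (\<i> * of_real \<theta>) = f t"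
      using assms t by (simp add: f_def g_def q_def cis_mult max_def field_simps)
    ultimately show "((\<lambda>t. cis (\<kappa> * ln t + \<theta> * t) / (\<i> * of_real \<theta>)) has_vector_derivative f t) (at t)" by simp
  qed
  moreover have "((\<lambda>T. (cis (\<kappa> * ln T + \<theta> * T) / (\<i> * of_real \<theta>)) / of_real T) \<longlongrightarrow> 0) at_top"
  proof (rule Lim_null_comparison)
    show "\<forall>\<^sub>F T in at_top. norm ((cis (\<kappa> * ln T + \<theta> * T) / (\<i> * of_real \<theta>)) / of_real T) \<le> (1 / \<bar>\<theta>\<bar>) / T"
      using eventually_gt_at_top[of 0] by eventually_elim (simp add: norm_divide norm_mult)
    show "((\<lambda>T. (1 / \<bar>\<theta>\<bar>) / T) \<longlongrightarrow> 0) at_top" by real_asymp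
  qed
  ultimately have "(avg f \<longlongrightarrow> 0) at_top" using tendsto_add by fastforce
  moreover have "((\<lambda>T. avg f T - avg g T) \<longlongrightarrow> 0) at_top"
  proof (rule avg_diff_tendsto_0[OF f g])
    have "((\<lambda>t. \<kappa> / (\<theta> * t)) \<longlongrightarrow> 0) at_top" using assms by real_asymp
    then have *: "((\<lambda>t. \<bar>\<kappa> / (\<theta> * t)\<bar>) \<longlongrightarrow> 0) at_top" by (rule tendsto_rabs_zero)
    show "((\<lambda>t. f t - g t) \<longlongrightarrow> 0) at_top"
    proof (rule Lim_null_comparison[OF _ *])
      show "\<forall>\<^sub>F t in at_top. norm (f t - g t) \<le> \<bar>\<kappa> / (\<theta> * t)\<bar>"
        using eventually_ge_at_top[of 1]
        by eventually_elim (simp add: f_def g_def q_def norm_mult norm_divide max_def abs_mult)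
    qed
  qed
  ultimately have "(avg g \<longlongrightarrow> 0) at_top"
    using tendsto_diff[of "avg f" 0 at_top "\<lambda>T. avg f T - avg g T" 0] by simp
  then show ?thesis by (simp add: g_def)
qed

text \<open>For \<open>\<kappa> \<noteq> 0\<close> these averages have no limit, but they move on a circle of fixed positive radius. This is enough to
  rule out convergence to zero.\<close>
lemma avg_cis_ln:
  "((\<lambda>T. avg (\<lambda>t. cis (\<kappa> * ln t)) T - cis (\<kappa> * ln T) / (1 + \<i> * of_real \<kappa>)) \<longlongrightarrow> 0) at_top"
proof -
  have nz: "1 + \<i> * complex_of_real \<kappa> \<noteq> 0" by (auto simp: complex_eq_iff)
  have "((\<lambda>T. avg (\<lambda>t. cis (\<kappa> * ln t)) T - (of_real T * cis (\<kappa> * ln T) / (1 + \<i> * of_real \<kappa>)) / of_real T) \<longlongrightarrow> 0) at_top"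
  proof (rule avg_FTC)
    show "bmeas (\<lambda>t. cis (\<kappa> * ln t))" by (intro bmeas_cis) measurable
    show "continuous_on {1..} (\<lambda>t. cis (\<kappa> * ln t))" by (intro continuous_intros) auto
    fix t :: real assume t: "t \<ge> 1"
    have "((\<lambda>t. cis (\<kappa> * ln t)) has_vector_derivative (\<i> * of_real (\<kappa> / t) * cis (\<kappa> * ln t))) (at t)"
      using t by (intro has_vector_derivative_cis) (auto intro!: derivative_eq_intros)
    moreover have "(of_real has_vector_derivative (1::complex)) (at t)"
      using has_vector_derivative_of_real[OF DERIV_ident] by simp
    ultimately have "((\<lambda>t. of_real t * cis (\<kappa> * ln t)) has_vector_derivative
       (of_real t * (\<i> * of_real (\<kappa> / t) * cis (\<kappa> * ln t)) + 1 * cis (\<kappa> * ln t))) (at t)"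
      by (intro has_vector_derivative_mult)
    then have "((\<lambda>t. of_real t * cis (\<kappa> * ln t) / (1 + \<i> * of_real \<kappa>)) has_vector_derivative
       (of_real t * (\<i> * of_real (\<kappa> / t) * cis (\<kappa> * ln t)) + 1 * cis (\<kappa> * ln t)) / (1 + \<i> * of_real \<kappa>)) (at t)"
      by (rule has_vector_derivative_divide)
    moreover have "(of_real t * (\<i> * of_real (\<kappa> / t) * cis (\<kappa> * ln t)) + 1 * cis (\<kappa> * ln t)) / (1 + \<i> * of_real \<kappa>)
      = cis (\<kappa> * ln t)" using t nz by (simp add: field_simps)
    ultimately show "((\<lambda>t. of_real t * cis (\<kappa> * ln t) / (1 + \<i> * of_real \<kappa>)) has_vector_derivative cis (\<kappa> * ln t)) (at t)"
      by simp
  qed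
  then show ?thesis
  proof (rule Lim_transform_eventually)
    show "\<forall>\<^sub>F T in at_top. avg (\<lambda>t. cis (\<kappa> * ln t)) T - (of_real T * cis (\<kappa> * ln T) / (1 + \<i> * of_real \<kappa>)) / of_real T
       = avg (\<lambda>t. cis (\<kappa> * ln t)) T - cis (\<kappa> * ln T) / (1 + \<i> * of_real \<kappa>)"
      using eventually_gt_at_top[of 0] by eventually_elim simp
  qed
qed

text \<open>Generated by adding one term at a time, so that closure properties and the vanishing of averages follow by
  rule induction.\<close>
inductive_set trigpoly :: "real set \<Rightarrow> (real \<Rightarrow> complex) set" for S :: "real set" where
  zero: "(\<lambda>t. 0) \<in> trigpoly S"
| add: "g \<in> trigpoly S \<Longrightarrow> \<theta> \<in> S \<Longrightarrow> (\<lambda>t. a * cis (\<theta> * t) + g t) \<in> trigpoly S"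

lemma trigpoly_add: "g \<in> trigpoly S \<Longrightarrow> h \<in> trigpoly S \<Longrightarrow> (\<lambda>t. g t + h t) \<in> trigpoly S"
  by (induction rule: trigpoly.induct) (auto simp: add.assoc intro: trigpoly.intros)

lemma trigpoly_monom: "\<theta> \<in> S \<Longrightarrow> (\<lambda>t. a * cis (\<theta> * t)) \<in> trigpoly S"
  using trigpoly.add[OF trigpoly.zero, of \<theta> S a] by simp

lemma trigpoly_sum: "(\<And>i. i \<in> I \<Longrightarrow> g i \<in> trigpoly S) \<Longrightarrow> (\<lambda>t. \<Sum>i\<in>I. g i t) \<in> trigpoly S"
  by (induction I rule: infinite_finite_induct) (auto intro: trigpoly.zero trigpoly_add)

lemma trigpoly_monom_mult:
  assumes S: "\<And>x y. x \<in> S \<Longrightarrow> y \<in> S \<Longrightarrow> x + y \<in> S" and "g \<in> trigpoly S" "\<theta> \<in> S"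
  shows "(\<lambda>t. a * cis (\<theta> * t) * g t) \<in> trigpoly S"
  using assms(2)
proof induction
  case (add g \<theta>' b)
  have "(\<lambda>t. (a * b) * cis ((\<theta> + \<theta>') * t) + a * cis (\<theta> * t) * g t) \<in> trigpoly S"
    using add S assms(3) by (intro trigpoly.add)
  then show ?case by (simp add: distrib_left distrib_right mult_ac flip: cis_mult)
qed (simp add: trigpoly.zero)

lemma trigpoly_mult:
  assumes S: "\<And>x y. x \<in> S \<Longrightarrow> y \<in> S \<Longrightarrow> x + y \<in> S" and "g \<in> trigpoly S" "h \<in> trigpoly S"
  shows "(\<lambda>t. g t * h t) \<in> trigpoly S"
  using assms(2)
proof induction
  case (add g \<theta> a)
  then show ?case
    using trigpoly_add[OF trigpoly_monom_mult[OF S assms(3), of \<theta> a]] by (simp add: distrib_right)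
qed (simp add: trigpoly.zero)

lemma trigpoly_const: "0 \<in> S \<Longrightarrow> (\<lambda>t. c) \<in> trigpoly S"
  using trigpoly_monom[of 0 S c] by simp

lemma bmeas_trigpoly: "g \<in> trigpoly S \<Longrightarrow> bmeas g"
  by (induction rule: trigpoly.induct) (auto intro!: bmeas_const bmeas_add bmeas_cmult bmeas_cis)

lemma avg_trigpoly:
  assumes "g \<in> trigpoly S" "\<And>\<theta>. \<theta> \<in> S \<Longrightarrow> \<nu> + \<theta> \<noteq> 0"
  shows "(avg (\<lambda>t. cis (\<kappa> * ln t) * cis (\<nu> * t) * g t) \<longlongrightarrow> 0) at_top"
  using assms(1)
proof induction
  case zero show ?case by (simp add: avg_def set_lebesgue_integral_def)
next
  case (add g \<theta> a)
  have b: "bmeas (\<lambda>t. cis (\<kappa> * ln t) * cis (x * t))" for x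
    by (intro bmeas_mult bmeas_cis) measurable
  have "avg (\<lambda>t. a * (cis (\<kappa> * ln t) * cis ((\<nu> + \<theta>) * t)) + cis (\<kappa> * ln t) * cis (\<nu> * t) * g t)
     = (\<lambda>T. a * avg (\<lambda>t. cis (\<kappa> * ln t) * cis ((\<nu> + \<theta>) * t)) T
        + avg (\<lambda>t. cis (\<kappa> * ln t) * cis (\<nu> * t) * g t) T)"
    by (rule ext, subst avg_add)
       (auto intro!: bmeas_cmult bmeas_mult b bmeas_trigpoly[OF add(1)] simp: avg_cmult)
  moreover have "((\<lambda>T. a * avg (\<lambda>t. cis (\<kappa> * ln t) * cis ((\<nu> + \<theta>) * t)) T
        + avg (\<lambda>t. cis (\<kappa> * ln t) * cis (\<nu> * t) * g t) T) \<longlongrightarrow> a * 0 + 0) at_top"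
    using add assms(2) by (intro tendsto_intros avg_cis_ln_cis)
  moreover have "(\<lambda>t. a * (cis (\<kappa> * ln t) * cis ((\<nu> + \<theta>) * t)) + cis (\<kappa> * ln t) * cis (\<nu> * t) * g t)
     = (\<lambda>t. cis (\<kappa> * ln t) * cis (\<nu> * t) * (a * cis (\<theta> * t) + g t))"
    by (simp add: distrib_left distrib_right mult_ac flip: cis_mult)
  ultimately show ?case by simp
qed

section \<open>Small values of trigonometric polynomials are rare\<close>

text \<open>The mean of the sum multiplied by \<open>cis (- \<theta>0 * t)\<close> is the coefficient at \<open>\<theta>0\<close>.\<close>
lemma trig_sum_coeff_zero:
  fixes a :: "real \<Rightarrow> complex"
  assumes F: "finite F" "\<theta>0 \<in> F" and z: "\<And>t. (\<Sum>\<theta>\<in>F. a \<theta> * cis (\<theta> * t)) = 0"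
  shows "a \<theta>0 = 0"
proof -
  have b: "bmeas (\<lambda>t. cis (x * t))" for x by (intro bmeas_cis) measurable
  have "(\<lambda>T. \<Sum>\<theta>\<in>F. a \<theta> * avg (\<lambda>t. cis ((\<theta> - \<theta>0) * t)) T)
    = avg (\<lambda>t. \<Sum>\<theta>\<in>F. a \<theta> * cis ((\<theta> - \<theta>0) * t))"
    by (rule ext, subst avg_sum) (auto simp: avg_cmult intro!: bmeas_cmult b)
  also have "(\<lambda>t. \<Sum>\<theta>\<in>F. a \<theta> * cis ((\<theta> - \<theta>0) * t)) = (\<lambda>t. cis (- \<theta>0 * t) * (\<Sum>\<theta>\<in>F. a \<theta> * cis (\<theta> * t)))"
    by (simp add: sum_distrib_left cis_mult left_diff_distrib mult.left_commute)
  also have "\<dots> = (\<lambda>t. 0)" using z by simp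
  finally have "(\<lambda>T. \<Sum>\<theta>\<in>F. a \<theta> * avg (\<lambda>t. cis ((\<theta> - \<theta>0) * t)) T) = (\<lambda>T. 0)"
    by (simp add: avg_def set_lebesgue_integral_def fun_eq_iff)
  moreover have "((\<lambda>T. \<Sum>\<theta>\<in>F. a \<theta> * avg (\<lambda>t. cis ((\<theta> - \<theta>0) * t)) T)
      \<longlongrightarrow> (\<Sum>\<theta>\<in>F. a \<theta> * (if \<theta> = \<theta>0 then 1 else 0))) at_top"
  proof (intro tendsto_intros)
    fix \<theta>
    have "((\<lambda>T. avg (\<lambda>t. 1) T) \<longlongrightarrow> 1) at_top"
    proof (rule tendsto_eventually)
      show "\<forall>\<^sub>F T in at_top. avg (\<lambda>t. 1) T = 1"
        using eventually_gt_at_top[of 0] by eventually_elim (rule avg_const)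
    qed
    then show "(avg (\<lambda>t. cis ((\<theta> - \<theta>0) * t)) \<longlongrightarrow> (if \<theta> = \<theta>0 then 1 else 0)) at_top"
      using avg_cis_ln_cis[of "\<theta> - \<theta>0" 0] by (cases "\<theta> = \<theta>0") simp_all
  qed
  ultimately have "((\<lambda>T. 0) \<longlongrightarrow> (\<Sum>\<theta>\<in>F. a \<theta> * (if \<theta> = \<theta>0 then 1 else 0))) (at_top :: real filter)"
    by simp
  then have "(\<Sum>\<theta>\<in>F. a \<theta> * (if \<theta> = \<theta>0 then 1 else 0)) = 0"
    using tendsto_const_iff[OF trivial_limit_at_top_linorder] by metis
  then have "(\<Sum>\<theta>\<in>F. if \<theta> = \<theta>0 then a \<theta> else 0) = 0"
    by (simp add: if_distrib cong: if_cong)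
  then show ?thesis using F by simp
qed

text \<open>The sum extends to a nonzero entire function, whose zeros are countable.\<close>
lemma trig_sum_zeros_null:
  fixes a :: "real \<Rightarrow> complex"
  assumes F: "finite F" "\<theta>0 \<in> F" "a \<theta>0 \<noteq> 0"
  shows "{t. (\<Sum>\<theta>\<in>F. a \<theta> * cis (\<theta> * t)) = 0} \<in> null_sets lborel"
proof -
  define g where "g = (\<lambda>z. \<Sum>\<theta>\<in>F. a \<theta> * exp (\<i> * of_real \<theta> * z))"
  have g: "g (of_real t) = (\<Sum>\<theta>\<in>F. a \<theta> * cis (\<theta> * t))" for t
    by (simp add: g_def cis_conv_exp mult.assoc)
  have "\<exists>t. (\<Sum>\<theta>\<in>F. a \<theta> * cis (\<theta> * t)) \<noteq> 0"
    using trig_sum_coeff_zero[OF F(1,2)] F(3) by blast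
  then obtain t0 where t0: "g (of_real t0) \<noteq> 0" using g by auto
  have "countable {z\<in>UNIV. g z = 0}"
  proof (rule ccontr)
    assume u: "uncountable {z\<in>UNIV. g z = 0}"
    have "UNIV \<subseteq> {z\<in>UNIV. g z = 0}"
    proof (rule holomorphic_countable_equal[OF _ _ _ _ _ u])
      show "g holomorphic_on UNIV" unfolding g_def by (intro holomorphic_intros)
    qed auto
    then show False using t0 by auto
  qed
  then have "countable (Re ` {z. g z = 0})" by simp
  moreover have "{t. (\<Sum>\<theta>\<in>F. a \<theta> * cis (\<theta> * t)) = 0} \<subseteq> Re ` {z. g z = 0}"
  proof
    fix t assume "t \<in> {t. (\<Sum>\<theta>\<in>F. a \<theta> * cis (\<theta> * t)) = 0}"
    then show "t \<in> Re ` {z. g z = 0}" using g[of t] by (intro image_eqI[of _ _ "of_real t"]) auto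
  qed
  ultimately have "countable {t. (\<Sum>\<theta>\<in>F. a \<theta> * cis (\<theta> * t)) = 0}" by (metis countable_subset)
  then show ?thesis by (rule countable_imp_null_set_lborel)
qed

lemma convergent_subseq_family:
  fixes u :: "nat \<Rightarrow> 'a \<Rightarrow> complex"
  assumes "finite F" "\<And>j \<theta>. cmod (u j \<theta>) \<le> 1"
  shows "\<exists>r l. strict_mono r \<and> (\<forall>\<theta>\<in>F. (\<lambda>j. u (r j) \<theta>) \<longlonglongrightarrow> l \<theta>)"
  using assms(1)
proof induction
  case empty
  then show ?case using strict_mono_id by blast
next
  case (insert x F)
  then obtain r l where r: "strict_mono r" "\<And>\<theta>. \<theta> \<in> F \<Longrightarrow> (\<lambda>j. u (r j) \<theta>) \<longlonglongrightarrow> l \<theta>" by blast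
  have "bounded (range (\<lambda>j. u (r j) x))" using assms(2) by (auto simp: bounded_iff)
  then obtain c s where s: "strict_mono s" "((\<lambda>j. u (r j) x) \<circ> s) \<longlonglongrightarrow> c"
    using bounded_imp_convergent_subsequence by blast
  have "(\<lambda>j. u ((r \<circ> s) j) \<theta>) \<longlonglongrightarrow> (l(x := c)) \<theta>" if "\<theta> \<in> insert x F" for \<theta>
  proof (cases "\<theta> = x")
    case False
    then have "(\<lambda>j. u (r j) \<theta>) \<longlonglongrightarrow> l \<theta>" using that r by auto
    then show ?thesis using LIMSEQ_subseq_LIMSEQ[OF _ s(1)] False by (fastforce simp: o_def)
  qed (use s in \<open>simp add: o_def\<close>)
  moreover have "strict_mono (r \<circ> s)" using r(1) s(1) by (rule strict_mono_o)
  ultimately show ?case by blast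
qed

text \<open>If this fails, there are translates whose sublevel sets for levels tending to zero all have measure above \<open>\<eta>\<close>. Along a
  subsequence the phases \<open>cis (\<theta> * s)\<close> converge, and so do the translates, uniformly. The limit has coefficients of the
  same moduli, is therefore not zero, and its zero set would have measure at least \<open>\<eta>\<close>, which is impossible.\<close>
lemma trig_sublevel_uniform:
  fixes a :: "real \<Rightarrow> complex" and F :: "real set"
  defines "G \<equiv> \<lambda>t. \<Sum>\<theta>\<in>F. a \<theta> * cis (\<theta> * t)"
  assumes F: "finite F" "\<theta>0 \<in> F" "a \<theta>0 \<noteq> 0" and \<eta>: "\<eta> > 0"
  shows "\<exists>e>0. \<forall>s. measure lborel {t\<in>{0..1}. cmod (G (s + t)) \<le> e} \<le> \<eta>"
proof (rule ccontr)
  assume "\<not> ?thesis"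
  then have "\<forall>j::nat. \<exists>s. measure lborel {t\<in>{0..1}. cmod (G (s + t)) \<le> 1 / (real j + 1)} > \<eta>"
    by (force simp: not_le)
  then obtain s where s: "\<And>j::nat. measure lborel {t\<in>{0..1}. cmod (G (s j + t)) \<le> 1 / (real j + 1)} > \<eta>"
    by metis
  obtain r l where r: "strict_mono (r::nat\<Rightarrow>nat)" "\<And>\<theta>. \<theta> \<in> F \<Longrightarrow> (\<lambda>j. cis (\<theta> * s (r j))) \<longlonglongrightarrow> l \<theta>"
    using convergent_subseq_family[OF F(1), of "\<lambda>j \<theta>. cis (\<theta> * s j)"] by auto
  define g where "g = (\<lambda>t. \<Sum>\<theta>\<in>F. (a \<theta> * l \<theta>) * cis (\<theta> * t))"
  define d where "d = (\<lambda>j. (\<Sum>\<theta>\<in>F. cmod (a \<theta>) * cmod (cis (\<theta> * s (r j)) - l \<theta>)) + 1 / (real j + 1))"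
  have gm [measurable]: "g \<in> borel_measurable borel" and Gm [measurable]: "G \<in> borel_measurable borel"
    unfolding g_def G_def by (intro borel_measurable_continuous_onI continuous_intros)+
  have "d \<longlonglongrightarrow> (\<Sum>\<theta>\<in>F. cmod (a \<theta>) * cmod (l \<theta> - l \<theta>)) + 0"
    unfolding d_def
    by (intro tendsto_intros r LIMSEQ_Suc[OF lim_1_over_n, simplified add.commute] )
       (use LIMSEQ_inverse_real_of_nat in \<open>simp_all add: inverse_eq_divide add.commute\<close>)
  then have d: "d \<longlonglongrightarrow> 0" by simp
  have close: "cmod (g t) \<le> d j" if "cmod (G (s (r j) + t)) \<le> 1 / (real (r j) + 1)" for j t
  proof -
    have "cmod (g t - G (s (r j) + t)) = cmod (\<Sum>\<theta>\<in>F. a \<theta> * (l \<theta> - cis (\<theta> * s (r j))) * cis (\<theta> * t))"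
      by (simp add: g_def G_def sum_subtractf[symmetric] distrib_left algebra_simps flip: cis_mult)
    also have "\<dots> \<le> (\<Sum>\<theta>\<in>F. cmod (a \<theta>) * cmod (cis (\<theta> * s (r j)) - l \<theta>))"
      by (rule sum_norm_le) (simp add: norm_mult norm_minus_commute)
    finally have "cmod (g t - G (s (r j) + t)) \<le> (\<Sum>\<theta>\<in>F. cmod (a \<theta>) * cmod (cis (\<theta> * s (r j)) - l \<theta>))" .
    moreover have "1 / (real (r j) + 1) \<le> 1 / (real j + 1)"
      using seq_suble[OF r(1), of j] by (intro divide_left_mono) auto
    ultimately show ?thesis
      using that norm_triangle_sub[of "g t" "G (s (r j) + t)"] unfolding d_def by linarith
  qed
  define B where "B = (\<lambda>n::nat. {t\<in>{0..1}. cmod (g t) \<le> 1 / (real n + 1)})"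
  have Bm: "B n \<in> sets lborel" for n unfolding B_def using gm by measurable
  have fin: "emeasure lborel {t\<in>{0..1::real}. P t} < \<infinity>" for P
  proof -
    have "emeasure lborel {t\<in>{0..1::real}. P t} \<le> emeasure lborel {0..1::real}" by (rule emeasure_mono) auto
    also have "\<dots> < \<infinity>" by simp
    finally show ?thesis .
  qed
  have lim: "(\<lambda>n. measure lborel (B n)) \<longlonglongrightarrow> measure lborel (\<Inter>n. B n)"
  proof (rule Lim_measure_decseq)
    show "decseq B"
    proof (rule decseq_SucI)
      fix n
      have "1 / (real (Suc n) + 1) \<le> 1 / (real n + 1)" by (intro divide_left_mono) auto
      then show "B (Suc n) \<subseteq> B n" unfolding B_def by auto
    qed
    show "range B \<subseteq> sets lborel" using Bm by auto
    show "emeasure lborel (B n) \<noteq> \<infinity>" for n unfolding B_def using fin less_irrefl by metis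
  qed
  have sub: "(\<Inter>n. B n) \<subseteq> {t. g t = 0}"
  proof
    fix t assume t: "t \<in> (\<Inter>n. B n)"
    have "cmod (g t) \<le> 0"
    proof (rule field_le_epsilon)
      fix e :: real assume "e > 0"
      then obtain n where "inverse (real (Suc n)) < e" using reals_Archimedean by blast
      moreover have "cmod (g t) \<le> 1 / (real n + 1)" using t by (auto simp: B_def)
      ultimately show "cmod (g t) \<le> 0 + e" by (simp add: inverse_eq_divide add.commute)
    qed
    then show "t \<in> {t. g t = 0}" by simp
  qed
  have null: "{t. g t = 0} \<in> null_sets lborel"
    unfolding g_def
  proof (rule trig_sum_zeros_null[OF F(1,2)])
    have "(\<lambda>j. cmod (cis (\<theta>0 * s (r j)))) \<longlonglongrightarrow> cmod (l \<theta>0)" by (intro tendsto_norm r F(2))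
    then have "cmod (l \<theta>0) = 1" by (simp add: LIMSEQ_const_iff)
    then show "a \<theta>0 * l \<theta>0 \<noteq> 0" using F(3) by auto
  qed
  have "(\<Inter>n. B n) \<in> sets lborel" using Bm by (intro sets.countable_INT') auto
  then have "(\<Inter>n. B n) \<in> null_sets lborel" by (rule null_sets_subset[OF null _ sub])
  then have "measure lborel (\<Inter>n. B n) = 0" by (rule measure_eq_0_null_sets)
  then have "(\<lambda>n. measure lborel (B n)) \<longlonglongrightarrow> 0"
    using lim by metis
  then have "\<forall>\<^sub>F n in sequentially. measure lborel (B n) < \<eta>" using \<eta> by (rule order_tendstoD)
  then obtain n where n: "measure lborel (B n) < \<eta>" by (auto simp: eventually_sequentially)
  have "\<forall>\<^sub>F j in sequentially. d j < 1 / (real n + 1)" using d by (rule order_tendstoD) auto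
  then obtain j where j: "d j < 1 / (real n + 1)" by (auto simp: eventually_sequentially)
  have "measure lborel {t\<in>{0..1}. cmod (G (s (r j) + t)) \<le> 1 / (real (r j) + 1)} \<le> measure lborel (B n)"
  proof (rule measure_mono_fmeasurable)
    show "{t\<in>{0..1}. cmod (G (s (r j) + t)) \<le> 1 / (real (r j) + 1)} \<subseteq> B n"
      using close[of j] j unfolding B_def by fastforce
    show "{t\<in>{0..1}. cmod (G (s (r j) + t)) \<le> 1 / (real (r j) + 1)} \<in> sets lborel"
      using Gm by measurable
    show "B n \<in> fmeasurable lborel" using Bm[of n] fin unfolding B_def by (rule fmeasurableI)
  qed
  then show False using s[of "r j"] n by linarith
qed

lemma trig_sublevel_density:
  fixes a :: "real \<Rightarrow> complex" and F :: "real set"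
  defines "G \<equiv> \<lambda>t. \<Sum>\<theta>\<in>F. a \<theta> * cis (\<theta> * t)"
  assumes F: "finite F" "\<theta>0 \<in> F" "a \<theta>0 \<noteq> 0" and \<eta>: "\<eta> > 0"
  shows "\<exists>e>0. \<forall>T\<ge>1. measure lborel ({0..T} \<inter> {t. cmod (G t) \<le> e}) / T \<le> \<eta>"
proof -
  obtain e where e: "e > 0" "\<And>s. measure lborel {t\<in>{0..1}. cmod (G (s + t)) \<le> e} \<le> \<eta> / 2"
    using trig_sublevel_uniform[of F \<theta>0 a "\<eta>/2", OF F] \<eta> unfolding G_def by auto
  have [measurable]: "G \<in> borel_measurable borel"
    unfolding G_def by (intro borel_measurable_continuous_onI continuous_intros)
  define A where "A = {t. cmod (G t) \<le> e}"
  have A [measurable]: "A \<in> sets lborel" unfolding A_def by measurable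
  have unit: "measure lborel ({s..s + 1} \<inter> A) \<le> \<eta> / 2" for s
  proof -
    have "measure lborel ({s..s + 1} \<inter> A) = measure (distr lborel borel ((+) s)) ({s..s + 1} \<inter> A)"
      by (simp add: lborel_distr_plus)
    also have "\<dots> = measure lborel ((+) s -` ({s..s + 1} \<inter> A))"
      using A by (subst measure_distr) auto
    also have "(+) s -` ({s..s + 1} \<inter> A) = {t\<in>{0..1}. cmod (G (s + t)) \<le> e}"
      by (auto simp: A_def)
    finally show ?thesis using e(2) by simp
  qed
  have "measure lborel ({0..T} \<inter> A) / T \<le> \<eta>" if T: "T \<ge> 1" for T
  proof -
    define n where "n = nat \<lceil>T\<rceil>"
    have n: "T \<le> real n" "real n \<le> 2 * T" using T unfolding n_def by linarith+
    have sub: "{0..T} \<inter> A \<subseteq> (\<Union>i<n. {real i..real i + 1} \<inter> A)"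
    proof
      fix t assume t: "t \<in> {0..T} \<inter> A"
      show "t \<in> (\<Union>i<n. {real i..real i + 1} \<inter> A)"
      proof (cases "t = real n")
        case True
        then show ?thesis using t T n by (intro UN_I[of "n - 1"]) (auto simp: of_nat_diff)
      next
        case False
        have "real (nat \<lfloor>t\<rfloor>) \<le> t" "t \<le> real (nat \<lfloor>t\<rfloor>) + 1" "nat \<lfloor>t\<rfloor> < n"
          using t False n by (auto simp: nat_less_iff) linarith+
        then show ?thesis using t by (intro UN_I[of "nat \<lfloor>t\<rfloor>"]) auto
      qed
    qed
    have "measure lborel ({0..T} \<inter> A) \<le> measure lborel (\<Union>i<n. {real i..real i + 1} \<inter> A)"
    proof (rule measure_mono_fmeasurable[OF sub])
      show "(\<Union>i<n. {real i..real i + 1} \<inter> A) \<in> fmeasurable lborel"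
        by (intro fmeasurable.finite_UN fmeasurable_Int_fmeasurable A fmeasurableI) auto
    qed (use A in auto)
    also have "\<dots> \<le> (\<Sum>i<n. measure lborel ({real i..real i + 1} \<inter> A))"
      using A by (intro measure_UNION_le) auto
    also have "\<dots> \<le> real n * (\<eta> / 2)" using sum_bounded_above[of "{..<n}" _ "\<eta>/2"] unit by simp
    also have "\<dots> \<le> T * \<eta>" using n(2) \<eta> mult_right_mono[of "real n" "2 * T" "\<eta>/2"] by simp
    finally show ?thesis using T by (simp add: field_simps)
  qed
  then show ?thesis using e(1) unfolding A_def by blast
qed

section \<open>Weyl's criterion for Benford functions\<close>

lemma avg_indicator:
  assumes "A \<in> sets borel" "T > 0"
  shows "avg (\<lambda>t. of_real (indicator A t)) T = of_real (measure lborel ({0..T} \<inter> A) / T)"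
proof -
  have "(LINT t:{0..T}|lborel. complex_of_real (indicator A t))
      = (LINT t|lborel. complex_of_real (indicator ({0..T} \<inter> A) t))"
    unfolding set_lebesgue_integral_def by (intro Bochner_Integration.integral_cong) (auto simp: indicator_def)
  also have "\<dots> = of_real (measure lborel ({0..T} \<inter> A))"
    using assms by (subst integral_complex_of_real) simp
  finally show ?thesis by (simp add: avg_def)
qed

lemma bmeas_indicator: "A \<in> sets borel \<Longrightarrow> bmeas (\<lambda>t. of_real (indicator A t))"
  by (intro bmeasI[of _ 1]) (auto simp: indicator_def)

lemma Re_avg_mono:
  assumes "bmeas (\<lambda>t. of_real (g t))" "bmeas (\<lambda>t. of_real (h t))" "T > 0" "\<And>t. g t \<le> h t"
  shows "Re (avg (\<lambda>t. of_real (g t)) T) \<le> Re (avg (\<lambda>t. of_real (h t)) T)"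
proof -
  have i: "set_integrable lborel {0..T} k" if "bmeas (\<lambda>t. of_real (k t))" for k :: "real \<Rightarrow> real"
  proof -
    have "(\<lambda>t. indicator {0..T} t *\<^sub>R complex_of_real (k t)) = (\<lambda>t. complex_of_real (indicator {0..T} t *\<^sub>R k t))"
      by (simp add: scaleR_conv_of_real)
    then show ?thesis
      using bmeas_set_integrable[OF that, of 0 T] unfolding set_integrable_def
      by (metis complex_of_real_integrable_eq)
  qed
  have "(LINT t:{0..T}|lborel. g t) \<le> (LINT t:{0..T}|lborel. h t)"
    by (rule set_integral_mono) (use assms i in auto)
  then show ?thesis using assms(3)
    by (simp add: avg_def set_integral_complex_of_real divide_right_mono)
qed

lemma avg_unit_cis:
  "avg (\<lambda>u. cis (of_int n * (2 * pi * u))) 1 = (if n = 0 then 1 else 0)"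
proof (cases "n = 0")
  case False
  have "(LINT u|lborel. indicator {0..1} u *\<^sub>R cis (of_int n * (2 * pi * u)))
      = cis (of_int n * (2 * pi * 1)) / (\<i> * of_real (of_int n * (2 * pi)))
        - cis (of_int n * (2 * pi * 0)) / (\<i> * of_real (of_int n * (2 * pi)))"
  proof (rule integral_FTC_atLeastAtMost)
    fix u :: real
    have "((\<lambda>u. cis (of_int n * (2 * pi * u))) has_vector_derivative
      \<i> * of_real (of_int n * (2 * pi)) * cis (of_int n * (2 * pi * u))) (at u)"
      by (intro has_vector_derivative_cis) (auto intro!: derivative_eq_intros)
    then have "((\<lambda>u. cis (of_int n * (2 * pi * u)) / (\<i> * of_real (of_int n * (2 * pi)))) has_vector_derivative
      (\<i> * of_real (of_int n * (2 * pi)) * cis (of_int n * (2 * pi * u))) / (\<i> * of_real (of_int n * (2 * pi)))) (at u)"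
      by (rule has_vector_derivative_divide)
    then show "((\<lambda>u. cis (of_int n * (2 * pi * u)) / (\<i> * of_real (of_int n * (2 * pi)))) has_vector_derivative
      cis (of_int n * (2 * pi * u))) (at u within {0..1})"
      using False by (auto intro: has_vector_derivative_at_within)
  qed (auto intro!: continuous_intros)
  moreover have "cis (of_int n * (2 * pi * 1)) = 1"
    using cis_multiple_2pi[of "of_int n"] by (simp add: mult_ac)
  ultimately show ?thesis using False by (simp add: avg_def set_lebesgue_integral_def)
qed (simp add: avg_const)

lemma trigpoly_real_polynomial:
  assumes "real_polynomial_function P"
  shows "(\<lambda>u. of_real (P (cis u))) \<in> trigpoly \<int>"
  using assms
proof induction
  case (linear h)
  then have l: "linear h" by (rule bounded_linear.linear)
  have h: "h z = Re z * h 1 + Im z * h \<i>" for z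
  proof -
    have "h z = h (Re z *\<^sub>R 1 + Im z *\<^sub>R \<i>)" by (simp add: scaleR_conv_of_real mult.commute flip: complex_eq)
    then show ?thesis by (simp add: linear_add[OF l] linear_scale[OF l])
  qed
  have "of_real (h (cis u)) = ((of_real (h 1) - \<i> * of_real (h \<i>)) / 2) * cis (1 * u)
      + ((of_real (h 1) + \<i> * of_real (h \<i>)) / 2) * cis (- 1 * u)" for u
    by (subst h) (simp add: complex_eq_iff field_simps)
  then show ?case
    using trigpoly_add[OF trigpoly_monom[of 1 \<int> "(of_real (h 1) - \<i> * of_real (h \<i>)) / 2"]
      trigpoly_monom[of "-1" \<int> "(of_real (h 1) + \<i> * of_real (h \<i>)) / 2"]] by simp
qed (auto intro: trigpoly_const trigpoly_add trigpoly_mult)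

lemma weyl_trigpoly:
  assumes p: "p \<in> borel_measurable borel"
    and W: "\<And>n::int. n \<noteq> 0 \<Longrightarrow> (avg (\<lambda>t. cis (of_int n * (2 * pi * p t))) \<longlongrightarrow> 0) at_top"
    and g: "g \<in> trigpoly \<int>"
  shows "(avg (\<lambda>t. g (2 * pi * p t)) \<longlongrightarrow> avg (\<lambda>u. g (2 * pi * u)) 1) at_top"
  using g
proof induction
  case zero then show ?case by (simp add: avg_def set_lebesgue_integral_def)
next
  case (add g \<theta> a)
  from \<open>\<theta> \<in> \<int>\<close> obtain n where n: "\<theta> = of_int n" by (rule Ints_cases)
  have b: "bmeas (\<lambda>t. cis (of_int n * (2 * pi * q t)))" "bmeas (\<lambda>t. g (2 * pi * q t))"
    if [measurable]: "q \<in> borel_measurable borel" for q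
  proof -
    show "bmeas (\<lambda>t. cis (of_int n * (2 * pi * q t)))" by (intro bmeas_cis) measurable
    have "bmeas g" using add(1) by (rule bmeas_trigpoly)
    then obtain B where B: "\<And>t. cmod (g t) \<le> B" and [measurable]: "g \<in> borel_measurable borel"
      by (metis bmeas_bound bmeas_def)
    show "bmeas (\<lambda>t. g (2 * pi * q t))" by (rule bmeasI[OF _ B]) measurable
  qed
  have split: "avg (\<lambda>t. a * cis (\<theta> * (2 * pi * q t)) + g (2 * pi * q t)) T =
      a * avg (\<lambda>t. cis (of_int n * (2 * pi * q t))) T + avg (\<lambda>t. g (2 * pi * q t)) T"
    if "q \<in> borel_measurable borel" for q T
    using b[OF that] by (simp add: n avg_add bmeas_cmult avg_cmult)
  have "(avg (\<lambda>t. cis (of_int n * (2 * pi * p t))) \<longlongrightarrow> avg (\<lambda>u. cis (of_int n * (2 * pi * u))) 1) at_top"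
  proof (cases "n = 0")
    case True
    show ?thesis
    proof (rule tendsto_eventually)
      show "\<forall>\<^sub>F T in at_top. avg (\<lambda>t. cis (of_int n * (2 * pi * p t))) T = avg (\<lambda>u. cis (of_int n * (2 * pi * u))) 1"
        using eventually_gt_at_top[of 0] by eventually_elim (simp add: True avg_const)
    qed
  qed (use W in \<open>simp add: avg_unit_cis\<close>)
  then show ?case
    unfolding split[OF p, abs_def] split[of "\<lambda>u. u", OF measurable_ident_sets[OF refl]]
    by (intro tendsto_intros add.IH)
qed

lemma weyl_continuous:
  assumes p: "p \<in> borel_measurable borel"
    and W: "\<And>n::int. n \<noteq> 0 \<Longrightarrow> (avg (\<lambda>t. cis (of_int n * (2 * pi * p t))) \<longlongrightarrow> 0) at_top"
    and F: "continuous_on UNIV (F :: complex \<Rightarrow> real)"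
  shows "(avg (\<lambda>t. of_real (F (cis (2 * pi * p t)))) \<longlongrightarrow> avg (\<lambda>u. of_real (F (cis (2 * pi * u)))) 1) at_top"
proof (rule tendstoI)
  fix e :: real assume e: "e > 0"
  obtain P where P: "real_polynomial_function P" "\<And>z. z \<in> sphere 0 1 \<Longrightarrow> \<bar>F z - P z\<bar> < e / 4"
    using Stone_Weierstrass_real_polynomial_function[OF compact_sphere[of "0::complex" 1] continuous_on_subset[OF F], of "e/4"] e
    by auto
  have bF: "bmeas (\<lambda>t. of_real (K (cis (2 * pi * q t))))"
    if [measurable]: "q \<in> borel_measurable borel" and K: "continuous_on UNIV K" for q :: "real \<Rightarrow> real" and K :: "complex \<Rightarrow> real"
  proof -
    have "compact (K ` sphere 0 1)"
      by (rule compact_continuous_image[OF continuous_on_subset[OF K] compact_sphere]) auto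
    then obtain B where B: "\<And>z. z \<in> sphere 0 1 \<Longrightarrow> \<bar>K z\<bar> \<le> B"
      by (metis (no_types, lifting) compact_imp_bounded bounded_iff imageI real_norm_def)
    have [measurable]: "K \<in> borel_measurable borel" "cis \<in> borel_measurable borel"
      using K by (auto intro!: borel_measurable_continuous_onI continuous_intros)
    show ?thesis by (rule bmeasI[of _ B]) (use B in auto)
  qed
  have cP: "continuous_on UNIV P" using P(1) by (intro continuous_at_imp_continuous_on ballI continuous_real_polymonial_function)
  have close: "cmod (avg (\<lambda>t. of_real (F (cis (2 * pi * q t)))) T - avg (\<lambda>t. of_real (P (cis (2 * pi * q t)))) T) \<le> e / 4"
    if q: "q \<in> borel_measurable borel" and T: "T > 0" for q T
  proof -
    have "cmod (avg (\<lambda>t. of_real (F (cis (2 * pi * q t))) - of_real (P (cis (2 * pi * q t)))) T) \<le> e / 4"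
    proof (rule norm_avg_le_const[OF _ T])
      show "bmeas (\<lambda>t. of_real (F (cis (2 * pi * q t))) - of_real (P (cis (2 * pi * q t))))"
        by (intro bmeas_diff bF q F cP)
      fix t
      show "cmod (of_real (F (cis (2 * pi * q t))) - of_real (P (cis (2 * pi * q t)))) \<le> e / 4"
        using P(2)[of "cis (2 * pi * q t)"] by (simp add: norm_of_real flip: of_real_diff)
    qed
    then show ?thesis using bF[OF q F] bF[OF q cP] by (simp add: avg_diff)
  qed
  have "(avg (\<lambda>t. of_real (P (cis (2 * pi * p t)))) \<longlongrightarrow> avg (\<lambda>u. of_real (P (cis (2 * pi * u)))) 1) at_top"
    by (rule weyl_trigpoly[OF p W trigpoly_real_polynomial[OF P(1)]])
  then have "\<forall>\<^sub>F T in at_top. dist (avg (\<lambda>t. of_real (P (cis (2 * pi * p t)))) T) (avg (\<lambda>u. of_real (P (cis (2 * pi * u)))) 1) < e / 4"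
    using e by (intro tendstoD) auto
  then show "\<forall>\<^sub>F T in at_top. dist (avg (\<lambda>t. of_real (F (cis (2 * pi * p t)))) T) (avg (\<lambda>u. of_real (F (cis (2 * pi * u)))) 1) < e"
    using eventually_gt_at_top[of 0]
  proof eventually_elim
    case (elim T)
    then show ?case
      using close[OF p elim(2)] close[OF measurable_ident_sets[OF refl], of 1] e
      unfolding dist_norm by norm
  qed
qed

text \<open>The indicator of a closed arc is a decreasing limit of continuous functions on the circle, which gives an upper
  bound. Applied to an arc and to its complement this is equidistribution. The endpoints of the unit interval are
  one point of the circle, which is why they are excluded as a null set.\<close>
lemma weyl_closed_arc:
  assumes p: "p \<in> borel_measurable borel"
    and W: "\<And>n::int. n \<noteq> 0 \<Longrightarrow> (avg (\<lambda>t. cis (of_int n * (2 * pi * p t))) \<longlongrightarrow> 0) at_top"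
    and ac: "0 \<le> a" "a \<le> c" "c \<le> 1" and e: "e > 0"
  shows "\<forall>\<^sub>F T in at_top. measure lborel ({0..T} \<inter> {t. a \<le> p t \<and> p t \<le> c}) / T < c - a + e"
proof -
  define K where "K = (\<lambda>u. cis (2 * pi * u)) ` {a..c}"
  have K: "closed K" "K \<noteq> {}" unfolding K_def using ac
    by (auto intro!: compact_imp_closed compact_continuous_image continuous_intros)
  define F where "F = (\<lambda>(m::nat) z. max 0 (1 - (real m + 1) * infdist z K))"
  have F: "continuous_on UNIV (F m)" for m unfolding F_def by (intro continuous_intros)
  have F1: "indicator K z \<le> F m z" "0 \<le> F m z" "F m z \<le> 1" for z m
    using K in_closed_iff_infdist_zero[of K z] infdist_nonneg[of z K]
    by (auto simp: F_def indicator_def)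
  have Flim: "(\<lambda>m. F m z) \<longlonglongrightarrow> indicator K z" for z
  proof (cases "z \<in> K")
    case True
    then show ?thesis using F1[where z = z] by (auto intro!: tendsto_eventually always_eventually antisym)
  next
    case False
    then have "infdist z K > 0" using K in_closed_iff_infdist_zero[of K z] infdist_nonneg[of z K] by force
    then obtain m0 :: nat where m0: "1 / infdist z K < real m0" using reals_Archimedean2 by blast
    show ?thesis
    proof (rule tendsto_eventually)
      show "\<forall>\<^sub>F m in sequentially. F m z = indicator K z"
        using eventually_ge_at_top[of m0]
      proof eventually_elim
        case (elim m)
        have "1 \<le> real m0 * infdist z K" using m0 \<open>infdist z K > 0\<close> by (simp add: field_simps)
        also have "\<dots> \<le> (real m + 1) * infdist z K" using elim \<open>infdist z K > 0\<close> by (intro mult_right_mono) auto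
        finally show ?case using False by (simp add: F_def)
      qed
    qed
  qed
  have cism: "(\<lambda>u. cis (2 * pi * u)) \<in> borel_measurable borel"
    by (intro borel_measurable_continuous_onI continuous_intros)
  have Fm: "(\<lambda>u. F m (cis (2 * pi * u))) \<in> borel_measurable borel" for m
    by (intro borel_measurable_continuous_onI continuous_intros continuous_on_compose2[OF F]) auto
  have Km [measurable]: "(\<lambda>u. indicator K (cis (2 * pi * u)) :: real) \<in> borel_measurable borel"
    using K(1) by (intro measurable_compose[OF cism borel_measurable_indicator]) auto
  have "(\<lambda>m. LINT u|lborel. indicator {0..1} u *\<^sub>R F m (cis (2 * pi * u)))
     \<longlonglongrightarrow> (LINT u|lborel. indicator {0..1} u *\<^sub>R indicator K (cis (2 * pi * u)))"
  proof (rule integral_dominated_convergence[where w = "indicator {0..1}"])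
    show "(\<lambda>u. indicator {0..1} u *\<^sub>R indicator K (cis (2 * pi * u)) :: real) \<in> borel_measurable lborel"
      by measurable
    show "(\<lambda>u. indicator {0..1} u *\<^sub>R F m (cis (2 * pi * u))) \<in> borel_measurable lborel" for m
      using Fm by measurable
    show "integrable lborel (indicator {0..1::real} :: real \<Rightarrow> real)" by simp
    show "AE u in lborel. (\<lambda>m. indicator {0..1} u *\<^sub>R F m (cis (2 * pi * u))) \<longlonglongrightarrow> indicator {0..1} u *\<^sub>R indicator K (cis (2 * pi * u))"
      by (intro AE_I2 tendsto_intros Flim)
    show "AE u in lborel. norm (indicator {0..1} u *\<^sub>R F m (cis (2 * pi * u))) \<le> indicator {0..1} u" for m
      using F1 by (intro AE_I2) (auto simp: indicator_def)
  qed
  also have "(LINT u|lborel. indicator {0..1} u *\<^sub>R indicator K (cis (2 * pi * u))) = (LINT u|lborel. indicator {a..c} u :: real)"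
  proof (rule integral_cong_AE)
    have "AE u in lborel. u \<noteq> 0 \<and> u \<noteq> (1::real)"
      by (intro AE_conjI AE_lborel_singleton)
    then show "AE u in lborel. indicator {0..1} u *\<^sub>R indicator K (cis (2 * pi * u)) = (indicator {a..c} u :: real)"
    proof eventually_elim
      case (elim u)
      have "u \<in> {a..c}" if u: "u \<in> {0..1}" "cis (2 * pi * u) \<in> K"
      proof -
        obtain v where v: "v \<in> {a..c}" "cis (2 * pi * u) = cis (2 * pi * v)" using u(2) by (auto simp: K_def)
        then have "sin (2 * pi * u) = sin (2 * pi * v) \<and> cos (2 * pi * u) = cos (2 * pi * v)"
          by (simp add: complex_eq_iff)
        then obtain n :: int where "2 * pi * u = 2 * pi * v + 2 * pi * of_int n"
          by (auto simp: sin_cos_eq_iff)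
        then have "2 * pi * u = 2 * pi * (v + of_int n)" by (simp add: distrib_left)
        then have un: "u = v + of_int n" by simp
        have "0 < u" "u < 1" using u(1) elim by auto
        then have "real_of_int n < 1" "real_of_int n > -1" using un v(1) ac by auto
        then have "n = 0" by linarith
        then show ?thesis using un v(1) by simp
      qed
      moreover have "cis (2 * pi * u) \<in> K" "u \<in> {0..1}" if "u \<in> {a..c}"
        using that ac unfolding K_def by auto
      ultimately show ?case
        by (cases "u \<in> {a..c}"; cases "u \<in> {0..1}"; cases "cis (2 * pi * u) \<in> K") (simp_all del: atLeastAtMost_iff)
    qed
  qed measurable
  also have "\<dots> = c - a" using ac by simp
  finally have "\<forall>\<^sub>F m in sequentially. (LINT u|lborel. indicator {0..1} u *\<^sub>R F m (cis (2 * pi * u))) < c - a + e"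
    using e by (intro order_tendstoD) auto
  then obtain m where m: "(LINT u:{0..1}|lborel. F m (cis (2 * pi * u))) < c - a + e"
    by (auto simp: eventually_sequentially set_lebesgue_integral_def)
  have "((\<lambda>T. Re (avg (\<lambda>t. of_real (F m (cis (2 * pi * p t)))) T)) \<longlongrightarrow> Re (avg (\<lambda>u. of_real (F m (cis (2 * pi * u)))) 1)) at_top"
    by (intro tendsto_Re weyl_continuous p W F)
  moreover have "Re (avg (\<lambda>u. of_real (F m (cis (2 * pi * u)))) 1) < c - a + e"
    using m by (simp add: avg_def set_integral_complex_of_real)
  ultimately have "\<forall>\<^sub>F T in at_top. Re (avg (\<lambda>t. of_real (F m (cis (2 * pi * p t)))) T) < c - a + e"
    by (rule order_tendstoD)
  then show ?thesis using eventually_gt_at_top[of 0]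
  proof eventually_elim
    case (elim T)
    have A: "{t. a \<le> p t \<and> p t \<le> c} \<in> sets borel" using p by measurable
    have "measure lborel ({0..T} \<inter> {t. a \<le> p t \<and> p t \<le> c}) / T
      = Re (avg (\<lambda>t. of_real (indicator {t. a \<le> p t \<and> p t \<le> c} t)) T)"
      using avg_indicator[OF A elim(2)] by simp
    also have "\<dots> \<le> Re (avg (\<lambda>t. of_real (F m (cis (2 * pi * p t)))) T)"
    proof (rule Re_avg_mono[OF bmeas_indicator[OF A] _ elim(2)])
      show "bmeas (\<lambda>t. of_real (F m (cis (2 * pi * p t))))"
      proof (rule bmeasI[of _ 1])
        show "(\<lambda>t. complex_of_real (F m (cis (2 * pi * p t)))) \<in> borel_measurable borel"
          using Fm p by measurable
      qed (use F1 in auto)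
      fix t
      have "indicator {t. a \<le> p t \<and> p t \<le> c} t \<le> (indicator K (cis (2 * pi * p t)) :: real)"
        by (auto simp: indicator_def K_def)
      then show "indicator {t. a \<le> p t \<and> p t \<le> c} t \<le> F m (cis (2 * pi * p t))" using F1(1)[of "cis (2 * pi * p t)" m] by linarith
    qed
    finally show ?case using elim(1) by linarith
  qed
qed

lemma weyl_equidistributed:
  assumes p: "p \<in> borel_measurable borel" "\<And>t. 0 \<le> p t \<and> p t < 1"
    and W: "\<And>n::int. n \<noteq> 0 \<Longrightarrow> (avg (\<lambda>t. cis (of_int n * (2 * pi * p t))) \<longlongrightarrow> 0) at_top"
    and x: "0 \<le> x" "x < 1"
  shows "((\<lambda>T. measure lborel ({0..T} \<inter> {t. p t \<le> x}) / T) \<longlongrightarrow> x) at_top"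
proof (rule tendstoI)
  fix e :: real assume e: "e > 0"
  have up: "\<forall>\<^sub>F T in at_top. measure lborel ({0..T} \<inter> {t. 0 \<le> p t \<and> p t \<le> x}) / T < x - 0 + e"
    using x by (intro weyl_closed_arc[OF p(1) W _ _ _ e]) auto
  have lo: "\<forall>\<^sub>F T in at_top. measure lborel ({0..T} \<inter> {t. x \<le> p t \<and> p t \<le> 1}) / T < 1 - x + e"
    using x by (intro weyl_closed_arc[OF p(1) W _ _ _ e]) auto
  show "\<forall>\<^sub>F T in at_top. dist (measure lborel ({0..T} \<inter> {t. p t \<le> x}) / T) x < e"
    using up lo eventually_gt_at_top[of 0]
  proof eventually_elim
    case (elim T)
    have m: "{t. p t \<le> x} \<in> sets lborel" "{t. x \<le> p t \<and> p t \<le> 1} \<in> sets lborel" using p(1) by measurable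
    have "T = measure lborel {0..T}" using elim by simp
    also have "\<dots> \<le> measure lborel (({0..T} \<inter> {t. p t \<le> x}) \<union> ({0..T} \<inter> {t. x \<le> p t \<and> p t \<le> 1}))"
    proof (rule measure_mono_fmeasurable)
      show "{0..T} \<subseteq> ({0..T} \<inter> {t. p t \<le> x}) \<union> ({0..T} \<inter> {t. x \<le> p t \<and> p t \<le> 1})"
        using p(2) by (auto simp: less_imp_le)
      show "({0..T} \<inter> {t. p t \<le> x}) \<union> ({0..T} \<inter> {t. x \<le> p t \<and> p t \<le> 1}) \<in> fmeasurable lborel"
        using m by (intro fmeasurable.Un fmeasurable_Int_fmeasurable fmeasurableI)
          (auto simp: emeasure_lborel_Icc_eq)
    qed auto
    also have "\<dots> \<le> measure lborel ({0..T} \<inter> {t. p t \<le> x}) + measure lborel ({0..T} \<inter> {t. x \<le> p t \<and> p t \<le> 1})"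
      using m by (intro measure_Un_le) auto
    finally have "1 \<le> measure lborel ({0..T} \<inter> {t. p t \<le> x}) / T + measure lborel ({0..T} \<inter> {t. x \<le> p t \<and> p t \<le> 1}) / T"
      using elim(3) by (simp add: field_simps)
    moreover have "{t. 0 \<le> p t \<and> p t \<le> x} = {t. p t \<le> x}" using p(2) by auto
    ultimately show ?case using elim by (simp add: dist_real_def)
  qed
qed

lemma significand_eq:
  assumes b: "b \<ge> 2" and x: "x \<noteq> 0"
  shows "significand b x = real b powr frac (log b \<bar>x\<bar>)"
proof -
  have b1: "real b > 1" using b by simp
  have powi: "real b powi k = real b powr of_int k" for k
    using b1 by (simp add: powr_real_of_int')
  have "(THE s. 1 \<le> s \<and> s < real b \<and> (\<exists>k::int. \<bar>x\<bar> = s * real b powi k)) = real b powr frac (log b \<bar>x\<bar>)"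
  proof (rule the_equality)
    have "real b powr frac (log b \<bar>x\<bar>) < real b powr 1"
      using b1 frac_lt_1 by (intro powr_less_mono) auto
    moreover have "real b powr frac (log b \<bar>x\<bar>) \<ge> 1"
      using b1 by (intro ge_one_powr_ge_zero) auto
    moreover have "\<bar>x\<bar> = real b powr frac (log b \<bar>x\<bar>) * real b powi \<lfloor>log b \<bar>x\<bar>\<rfloor>"
      using b1 x unfolding powi powr_add[symmetric] by (simp add: frac_def)
    ultimately show "1 \<le> real b powr frac (log b \<bar>x\<bar>) \<and> real b powr frac (log b \<bar>x\<bar>) < real b \<and>
       (\<exists>k::int. \<bar>x\<bar> = real b powr frac (log b \<bar>x\<bar>) * real b powi k)" using b1 by auto
  next
    fix s assume s: "1 \<le> s \<and> s < real b \<and> (\<exists>k::int. \<bar>x\<bar> = s * real b powi k)"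
    then obtain k :: int where k: "\<bar>x\<bar> = s * real b powi k" by blast
    have "log b \<bar>x\<bar> = log b s + of_int k"
      using k s b1 by (simp add: powi log_mult)
    moreover have "0 \<le> log b s" "log b s < 1" using s b1 by auto
    ultimately have "frac (log b \<bar>x\<bar>) = log b s" by (simp add: frac_eq frac_unique_iff)
    then show "s = real b powr frac (log b \<bar>x\<bar>)" using s b1 by simp
  qed
  then show ?thesis using x by (simp add: significand_def)
qed

text \<open>Zero has significand zero, hence belongs to every sublevel set, and its phase is also zero because of
  \<open>ln 0 = 0\<close>. The equivalence therefore holds for all \<open>x\<close>.\<close>
lemma significand_le_iff:
  assumes b: "b \<ge> 2" and s: "1 \<le> s"
  shows "significand b x \<le> s \<longleftrightarrow> frac (ln \<bar>x\<bar> / ln b) \<le> log b s"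
proof (cases "x = 0")
  case True
  then show ?thesis using assms by (simp add: significand_def)
next
  case False
  have "real b > 1" using b by simp
  then show ?thesis using significand_eq[OF b False] s
    by (simp add: log_def powr_le_iff)
qed

lemma benford_iff_phase:
  assumes b: "b \<ge> 2" and f: "f \<in> borel_measurable borel"
  shows "benford b f \<longleftrightarrow> (\<forall>x\<in>{0..<1}.
    ((\<lambda>T. measure lborel ({0..T} \<inter> {t. frac (ln \<bar>f t\<bar> / ln b) \<le> x}) / T) \<longlongrightarrow> x) at_top)"
proof -
  have b1: "real b > 1" using b by simp
  have [measurable]: "(\<lambda>t. frac (ln \<bar>f t\<bar> / ln b)) \<in> borel_measurable borel"
    using f unfolding frac_def by measurable
  have eq: "measure lebesgue {t. 0 \<le> t \<and> t \<le> T \<and> significand b (f t) \<le> s}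
     = measure lborel ({0..T} \<inter> {t. frac (ln \<bar>f t\<bar> / ln b) \<le> log b s})" if "1 \<le> s" for s T
  proof -
    have "{t. 0 \<le> t \<and> t \<le> T \<and> significand b (f t) \<le> s} = {0..T} \<inter> {t. frac (ln \<bar>f t\<bar> / ln b) \<le> log b s}"
      using significand_le_iff[OF b that] by auto
    moreover have "{0..T} \<inter> {t. frac (ln \<bar>f t\<bar> / ln b) \<le> log b s} \<in> sets lborel" by measurable
    ultimately show ?thesis by (simp add: measure_completion)
  qed
  have "benford b f \<longleftrightarrow> (\<forall>s\<in>{1..<real b}.
    ((\<lambda>T. measure lborel ({0..T} \<inter> {t. frac (ln \<bar>f t\<bar> / ln b) \<le> log b s}) / T) \<longlongrightarrow> log b s) at_top)"
    using f eq by (auto simp: benford_def measurable_restrict_space1)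
  also have "\<dots> \<longleftrightarrow> (\<forall>x\<in>log b ` {1..<real b}.
    ((\<lambda>T. measure lborel ({0..T} \<inter> {t. frac (ln \<bar>f t\<bar> / ln b) \<le> x}) / T) \<longlongrightarrow> x) at_top)"
    by blast
  also have "log b ` {1..<real b} = {0..<1}"
  proof (intro equalityI subsetI)
    fix x :: real assume "x \<in> {0..<1}"
    then show "x \<in> log b ` {1..<real b}"
      using b1 powr_less_mono[of x 1 b] by (intro image_eqI[of _ _ "b powr x"]) (auto intro: ge_one_powr_ge_zero)
  qed (use b1 in auto)
  finally show ?thesis .
qed

lemma cis_frac: "cis (of_int n * (2 * pi * frac x)) = cis (of_int n * (2 * pi * x))"
proof -
  have "cis (of_int n * (2 * pi * x)) = cis (of_int n * (2 * pi * frac x) + 2 * pi * of_int (n * \<lfloor>x\<rfloor>))"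
    by (simp add: frac_def algebra_simps)
  also have "\<dots> = cis (of_int n * (2 * pi * frac x))"
    by (simp only: cis_multiple_2pi[OF Ints_of_int] mult_1_right flip: cis_mult)
  finally show ?thesis by simp
qed

lemma benfordI_weyl:
  assumes b: "b \<ge> 2" and f: "f \<in> borel_measurable borel"
    and W: "\<And>n::int. n \<noteq> 0 \<Longrightarrow> (avg (\<lambda>t. cis (of_int n * (2 * pi / ln b) * ln \<bar>f t\<bar>)) \<longlongrightarrow> 0) at_top"
  shows "benford b f"
  unfolding benford_iff_phase[OF b f]
proof
  fix x :: real assume x: "x \<in> {0..<1}"
  show "((\<lambda>T. measure lborel ({0..T} \<inter> {t. frac (ln \<bar>f t\<bar> / ln b) \<le> x}) / T) \<longlongrightarrow> x) at_top"
  proof (rule weyl_equidistributed)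
    show "(\<lambda>t. frac (ln \<bar>f t\<bar> / ln b)) \<in> borel_measurable borel"
      using f unfolding frac_def by measurable
    show "(avg (\<lambda>t. cis (of_int n * (2 * pi * frac (ln \<bar>f t\<bar> / ln b)))) \<longlongrightarrow> 0) at_top" if "n \<noteq> 0" for n :: int
      using W[OF that] unfolding cis_frac by (simp add: mult.assoc)
  qed (use x in \<open>auto simp: frac_lt_1\<close>)
qed

lemma cis_sum_zero:
  assumes "0 < n" "n < N"
  shows "(\<Sum>j<N. cis (2 * pi * real n * real (Suc j) / real N)) = 0"
proof -
  define w where "w = cis (2 * pi * real n / real N)"
  have w: "cis (2 * pi * real n * real k / real N) = w ^ k" for k
    unfolding w_def Complex.DeMoivre by (rule arg_cong[where f = cis]) simp
  have "w ^ N = 1"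
    using w[of N] assms cis_multiple_2pi[of "real n"] by simp
  moreover have "w \<noteq> 1"
  proof
    assume "w = 1"
    then have "sin (2 * pi * real n / real N) = sin 0 \<and> cos (2 * pi * real n / real N) = cos 0"
      by (simp add: w_def complex_eq_iff)
    then obtain m :: int where "2 * pi * real n / real N = 0 + 2 * pi * of_int m"
      unfolding sin_cos_eq_iff by blast
    then have "real n = real N * of_int m" using assms by (simp add: field_simps)
    then have "int n = int N * m" by (metis of_int_eq_iff of_int_mult of_int_of_nat_eq)
    then have "N dvd n" by (metis dvd_triv_left int_dvd_int_iff)
    then show False using assms by (auto dest: dvd_imp_le)
  qed
  moreover have "(\<Sum>j<N. cis (2 * pi * real n * real (Suc j) / real N)) = w * (\<Sum>j<N. w ^ j)"
    unfolding w by (simp add: sum_distrib_left)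
  ultimately show ?thesis by (simp add: geometric_sum)
qed

lemma cis_dist_le: "cmod (cis x - cis y) \<le> \<bar>x - y\<bar>"
proof -
  have "cmod (cis x - cis y) = cmod (cis y * (cis (x - y) - 1))"
    by (simp add: right_diff_distrib cis_mult)
  also have "\<dots> = cmod (exp (\<i> * of_real (x - y)) - 1)" by (simp add: norm_mult cis_conv_exp)
  also have "\<dots> \<le> \<bar>x - y\<bar>" using iexp_approx1[of "x - y" 0] by simp
  finally show ?thesis .
qed

text \<open>The phase function is approximated by a step function on \<open>N\<close> intervals of length \<open>1 / N\<close>. Their densities are all
  \<open>1 / N\<close>, and the values of the step function are the powers of a root of unity, which sum to zero.\<close>
lemma benford_imp_weyl:
  assumes b: "b \<ge> 2" and f: "f \<in> borel_measurable borel" and bf: "benford b f" and n: "n \<ge> (1::nat)"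
  shows "(avg (\<lambda>t. cis (real n * (2 * pi / ln b) * ln \<bar>f t\<bar>)) \<longlongrightarrow> 0) at_top"
proof (rule tendstoI)
  fix e :: real assume e: "e > 0"
  define p where "p = (\<lambda>t. frac (ln \<bar>f t\<bar> / ln b))"
  have pm [measurable]: "p \<in> borel_measurable borel" unfolding p_def frac_def using f by measurable
  have p01: "0 \<le> p t" "p t < 1" for t by (auto simp: p_def frac_lt_1)
  \<comment> \<open>The condition \<open>n < N\<close> makes the root of unity different from one. The other bound makes the steps finer than \<open>e / 2\<close>.\<close>
  define N where "N = nat \<lceil>max (real n + 1) (4 * pi * n / e + 1)\<rceil>"
  have N: "n < N" "4 * pi * n / e < N" unfolding N_def by linarith+
  then have N': "2 * pi * n / N < e / 2" using e by (simp add: field_simps)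
  define A where "A = (\<lambda>j::nat. {t. p t \<le> real j / real N})"
  have Am: "A j \<in> sets borel" for j unfolding A_def by measurable
  have dens: "((\<lambda>T. measure lborel ({0..T} \<inter> A j) / T) \<longlongrightarrow> real j / real N) at_top" if "j \<le> N" for j
  proof (cases "j = N")
    case True
    have "A N = UNIV" using p01 N(1) by (auto simp: A_def less_imp_le)
    have "\<forall>\<^sub>F T in at_top. measure lborel ({0..T} \<inter> A j) / T = 1"
      using eventually_gt_at_top[of 0] by eventually_elim (simp add: True \<open>A N = UNIV\<close>)
    then show ?thesis using True N(1) by (auto intro: tendsto_eventually)
  next
    case False
    then have "real j / real N \<in> {0..<1}" using that N by auto
    then show ?thesis using bf unfolding benford_iff_phase[OF b f] A_def p_def by blast
  qed
  define c where "c = (\<lambda>j. cis (2 * pi * real n * real (Suc j) / real N))"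
  define q where "q = (\<lambda>t. \<Sum>j<N. c j * (of_real (indicator (A (Suc j)) t) - of_real (indicator (A j) t)))"
  have qb: "bmeas q" unfolding q_def by (intro bmeas_sum bmeas_cmult bmeas_diff bmeas_indicator Am)
  define g where "g = (\<lambda>t. cis (real n * (2 * pi * p t)))"
  have gb: "bmeas g" unfolding g_def by (intro bmeas_cis) measurable
  \<comment> \<open>The intervals are open on the left and miss phase zero, whose times form the set \<open>A 0\<close> of density zero.\<close>
  have near: "cmod (g t - q t) \<le> e / 2 + 1 * indicator (A 0) t" for t
  proof (cases "p t = 0")
    case True
    then have "q t = 0" "t \<in> A 0" by (simp_all add: q_def A_def)
    then show ?thesis using e by (simp add: g_def)
  next
    case False
    then have pos: "p t > 0" using p01[of t] by simp
    define i where "i = nat (\<lceil>p t * N\<rceil> - 1)"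
    have "0 < p t * N" "p t * N \<le> N" using pos N(1) p01(2)[of t] by (auto intro: mult_left_le_one_le less_imp_le)
    then have i: "i < N" "real i < p t * N" "p t * N \<le> real i + 1" unfolding i_def by linarith+
    have jump: "of_real (indicator (A (Suc j)) t) - of_real (indicator (A j) t) = (if j = i then 1 else 0 :: complex)" for j
    proof -
      have "t \<in> A j \<longleftrightarrow> j > i" for j
      proof -
        have "t \<in> A j \<longleftrightarrow> p t * N \<le> j" using N(1) by (simp add: A_def field_simps)
        also have "\<dots> \<longleftrightarrow> j > i" using i by linarith
        finally show ?thesis .
      qed
      then show ?thesis by (auto simp: indicator_def)
    qed
    have "q t = c i" unfolding q_def jump using i(1) by (simp add: if_distrib cong: if_cong)
    then have "cmod (g t - q t) \<le> \<bar>real n * (2 * pi * p t) - 2 * pi * real n * real (Suc i) / real N\<bar>"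
      unfolding g_def c_def using cis_dist_le by simp
    also have "real n * (2 * pi * p t) - 2 * pi * real n * real (Suc i) / real N = 2 * pi * n / N * (p t * N - real (Suc i))"
      using N(1) by (simp add: field_simps)
    also have "\<bar>2 * pi * n / N * (p t * N - real (Suc i))\<bar> = 2 * pi * n / N * \<bar>p t * N - real (Suc i)\<bar>"
      by (simp add: abs_mult)
    also have "\<dots> \<le> 2 * pi * n / N * 1" using i by (intro mult_left_mono) auto
    finally show ?thesis using N' by (simp add: add_increasing2)
  qed
  have "avg q T = (\<Sum>j<N. c j * (avg (\<lambda>t. of_real (indicator (A (Suc j)) t)) T - avg (\<lambda>t. of_real (indicator (A j) t)) T))" for T
    unfolding q_def
    by (subst avg_sum) (auto intro!: bmeas_cmult bmeas_diff bmeas_indicator Am simp: avg_cmult avg_diff[OF bmeas_indicator[OF Am] bmeas_indicator[OF Am]])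
  then have avgq: "avg q = (\<lambda>T. \<Sum>j<N. c j * (avg (\<lambda>t. of_real (indicator (A (Suc j)) t)) T - avg (\<lambda>t. of_real (indicator (A j) t)) T))"
    by (rule ext)
  have lim: "((\<lambda>T. \<Sum>j<N. c j * (avg (\<lambda>t. of_real (indicator (A (Suc j)) t)) T - avg (\<lambda>t. of_real (indicator (A j) t)) T))
      \<longlongrightarrow> (\<Sum>j<N. c j * (of_real (real (Suc j) / real N) - of_real (real j / real N)))) at_top"
  proof (intro tendsto_intros)
    have *: "(avg (\<lambda>t. of_real (indicator (A j) t)) \<longlongrightarrow> of_real (real j / real N)) at_top" if "j \<le> N" for j
    proof (rule Lim_transform_eventually[OF tendsto_of_real[OF dens[OF that]]])
      show "\<forall>\<^sub>F T in at_top. of_real (measure lborel ({0..T} \<inter> A j) / T) = avg (\<lambda>t. of_real (indicator (A j) t)) T"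
        using eventually_gt_at_top[of 0] by eventually_elim (simp add: avg_indicator Am)
    qed
    fix j assume "j \<in> {..<N}"
    then show "(avg (\<lambda>t. of_real (indicator (A (Suc j)) t)) \<longlongrightarrow> of_real (real (Suc j) / real N)) at_top"
      "(avg (\<lambda>t. of_real (indicator (A j) t)) \<longlongrightarrow> of_real (real j / real N)) at_top"
      by (auto intro!: * simp del: of_nat_Suc of_real_divide)
  qed
  have sum1: "(\<Sum>j<N. c j * (of_real (real (Suc j) / real N) - of_real (real j / real N))) = (\<Sum>j<N. c j) / of_nat N"
    unfolding sum_divide_distrib by (intro sum.cong) (auto simp: field_simps)
  have sum2: "(\<Sum>j<N. c j) = 0" unfolding c_def using n N by (intro cis_sum_zero) auto
  have "(avg q \<longlongrightarrow> 0) at_top" using lim unfolding avgq sum1 sum2 div_0 .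
  then have "\<forall>\<^sub>F T in at_top. dist (avg q T) 0 < e / 4" using e by (intro tendstoD) auto
  moreover have "((\<lambda>T. measure lborel ({0..T} \<inter> A 0) / T) \<longlongrightarrow> 0) at_top" using dens[of 0] by simp
  then have "\<forall>\<^sub>F T in at_top. measure lborel ({0..T} \<inter> A 0) / T < e / 4"
    using e by (intro order_tendstoD) auto
  ultimately have "\<forall>\<^sub>F T in at_top. dist (avg g T) 0 < e"
    using eventually_gt_at_top[of 0]
  proof eventually_elim
    case (elim T)
    have "cmod (avg (\<lambda>t. g t - q t) T) \<le> e / 2 + 1 * (measure lborel ({0..T} \<inter> A 0) / T)"
      by (rule norm_avg_le[OF bmeas_diff[OF gb qb] elim(3) Am]) (use near in auto)
    then have "cmod (avg g T - avg q T) < e / 2 + e / 4"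
      using elim(2) unfolding avg_diff[OF gb qb] by linarith
    then show ?case using elim(1) norm_triangle_sub[of "avg g T" "avg q T"] by simp
  qed
  moreover have "g = (\<lambda>t. cis (real n * (2 * pi / ln b) * ln \<bar>f t\<bar>))"
    unfolding g_def p_def using cis_frac[of "int n"] by (simp add: fun_eq_iff mult.assoc)
  ultimately show "\<forall>\<^sub>F T in at_top. dist (avg (\<lambda>t. cis (real n * (2 * pi / ln b) * ln \<bar>f t\<bar>)) T) 0 < e" by simp
qed

section \<open>Nonresonance implies the Benford property\<close>

lemma trigpoly_real_polynomial_comp:
  fixes P :: "real \<Rightarrow> real"
  assumes S: "\<And>x y. x \<in> S \<Longrightarrow> y \<in> S \<Longrightarrow> x + y \<in> S" "0 \<in> S"
    and G: "(\<lambda>t. complex_of_real (G t)) \<in> trigpoly S" and P: "real_polynomial_function P"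
  shows "(\<lambda>t. complex_of_real (P (G t))) \<in> trigpoly S"
  using P
proof induction
  case (linear h)
  then have l: "linear h" by (rule bounded_linear.linear)
  have "h x = h 1 * x" for x using linear_scale[OF l, of x 1] by simp
  then have "(\<lambda>t. complex_of_real (h (G t))) = (\<lambda>t. complex_of_real (h 1) * complex_of_real (G t))"
    by (metis of_real_mult)
  also have "\<dots> \<in> trigpoly S" by (intro trigpoly_mult[OF S(1)] trigpoly_const S(2) G)
  finally show ?case .
qed (auto intro: trigpoly_const trigpoly_add trigpoly_mult S)

text \<open>The phase of \<open>x\<close>, damped linearly on \<open>[-e,e]\<close> in order to be continuous at zero, and unchanged outside.\<close>
definition soft_phase :: "real \<Rightarrow> real \<Rightarrow> real \<Rightarrow> complex" where
  "soft_phase e \<beta> x = of_real (min 1 (\<bar>x\<bar> / e)) * cis (\<beta> * ln \<bar>x\<bar>)"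

lemma norm_soft_phase: "e > 0 \<Longrightarrow> cmod (soft_phase e \<beta> x) \<le> 1"
  by (simp add: soft_phase_def norm_mult)

lemma continuous_soft_phase:
  assumes e: "e > 0" shows "continuous_on UNIV (soft_phase e \<beta>)"
proof (intro continuous_at_imp_continuous_on ballI)
  fix x :: real
  show "isCont (soft_phase e \<beta>) x"
  proof (cases "x = 0")
    case True
    have "((\<lambda>x. \<bar>x\<bar> / e) \<longlongrightarrow> \<bar>0\<bar> / e) (at 0)" using e by (intro tendsto_intros) auto
    then have "((\<lambda>x. \<bar>x\<bar> / e) \<longlongrightarrow> 0) (at 0)" by simp
    then have "(soft_phase e \<beta> \<longlongrightarrow> 0) (at 0)"
      by (rule Lim_null_comparison[rotated])
         (use e in \<open>auto simp: soft_phase_def norm_mult intro!: always_eventually\<close>)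
    then show ?thesis using True e by (simp add: isCont_def soft_phase_def)
  next
    case False
    then show ?thesis unfolding soft_phase_def cis_conv_exp using e by (intro continuous_intros) auto
  qed
qed

text \<open>Up to sets of small density, the phase of \<open>f\<close> is \<open>H t * P (G t)\<close> with a polynomial \<open>P\<close> that approximates the damped phase,
  and \<open>H\<close> carries the frequency \<open>\<beta> * r\<close>. As the frequencies of \<open>P (G t)\<close> lie in the rational span of \<open>F\<close>, no frequency
  of the product is zero.\<close>
lemma nonresonant_imp_benford:
  fixes f G \<rho> :: "real \<Rightarrow> real" and a :: "real \<Rightarrow> complex"
  assumes b: "b \<ge> 2" and fm: "f \<in> borel_measurable borel"
    and f: "\<And>t. t > 0 \<Longrightarrow> f t = exp (r * t) * t ^ k * (G t + \<rho> t)"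
    and G: "\<And>t. complex_of_real (G t) = (\<Sum>\<theta>\<in>F. a \<theta> * cis (\<theta> * t))"
    and F: "finite F" "\<theta>0 \<in> F" "a \<theta>0 \<noteq> 0"
    and \<rho>: "(\<rho> \<longlongrightarrow> 0) at_top"
    and nr: "2 * pi / ln b * r \<notin> rspan F"
  shows "benford b f"
proof (rule benfordI_weyl[OF b fm])
  fix n :: int assume n: "n \<noteq> 0"
  define \<beta> where "\<beta> = of_int n * (2 * pi / ln b)"
  define H where "H = (\<lambda>t. cis (k * \<beta> * ln t) * cis (\<beta> * r * t))"
  define U where "U = (\<lambda>t. cis (\<beta> * ln \<bar>f t\<bar>))"
  have Ub: "bmeas U" unfolding U_def using fm by (intro bmeas_cis) measurable
  have Hb: "bmeas H" unfolding H_def by (intro bmeas_mult bmeas_cis) measurable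
  have nr': "\<beta> * r + \<theta> \<noteq> 0" if "\<theta> \<in> rspan F" for \<theta>
  proof
    assume "\<beta> * r + \<theta> = 0"
    then have "(1 / of_int n) * (- \<theta>) = 2 * pi / ln b * r" using n by (simp add: \<beta>_def field_simps)
    moreover have "(1 / of_int n) * (- \<theta>) \<in> rspan F" using that by (intro rspan_scale_Rats rspan_minus) auto
    ultimately show False using nr by simp
  qed
  have Gt: "(\<lambda>t. complex_of_real (G t)) \<in> trigpoly (rspan F)"
    unfolding G by (intro trigpoly_sum trigpoly_monom rspan_base)
  have Gm [measurable]: "G \<in> borel_measurable borel"
    using measurable_compose[OF bmeas_measurable[OF bmeas_trigpoly[OF Gt]] borel_measurable_Re] by simp
  obtain B where B: "\<And>t. \<bar>G t\<bar> \<le> B" using bmeas_bound[OF bmeas_trigpoly[OF Gt]] by auto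
  show "(avg (\<lambda>t. cis (of_int n * (2 * pi / ln b) * ln \<bar>f t\<bar>)) \<longlongrightarrow> 0) at_top"
    unfolding \<beta>_def[symmetric] U_def[symmetric]
  proof (rule tendstoI)
    fix e :: real assume e: "e > 0"
    \<comment> \<open>The errors add up to \<open>9 * \<eta>\<close>: approximation \<open>2 * \<eta>\<close>, exceptional sets \<open>3 * 2 * \<eta>\<close>, average of the approximant \<open>\<eta>\<close>.\<close>
    define \<eta> where "\<eta> = min 1 (e / 10)"
    have \<eta>: "\<eta> > 0" "\<eta> \<le> 1" "10 * \<eta> \<le> e" using e by (auto simp: \<eta>_def)
    obtain \<epsilon> where \<epsilon>: "\<epsilon> > 0"
      and dens: "\<And>T. T \<ge> 1 \<Longrightarrow> measure lborel ({0..T} \<inter> {t. cmod (\<Sum>\<theta>\<in>F. a \<theta> * cis (\<theta> * t)) \<le> \<epsilon>}) / T \<le> \<eta>"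
      using trig_sublevel_density[of F \<theta>0 a, OF F \<eta>(1)] by blast
    define A where "A = {t. \<bar>G t\<bar> \<le> \<epsilon>}"
    have A: "A \<in> sets borel" unfolding A_def by measurable
    have dens: "measure lborel ({0..T} \<inter> A) / T \<le> \<eta>" if "T \<ge> 1" for T
      using dens[OF that] unfolding G[symmetric] A_def by simp
    \<comment> \<open>Half of the level \<open>\<epsilon>\<close> leaves room for the perturbation \<open>\<rho>\<close>.\<close>
    define \<Phi> where "\<Phi> = soft_phase (\<epsilon> / 2) \<beta>"
    have \<Phi>1: "cmod (\<Phi> x) \<le> 1" for x unfolding \<Phi>_def using \<epsilon> by (intro norm_soft_phase) simp
    have \<Phi>c: "continuous_on S \<Phi>" for S
      unfolding \<Phi>_def using continuous_on_subset[OF continuous_soft_phase] \<epsilon> by auto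
    obtain P1 where P1: "real_polynomial_function P1" "\<And>x. x \<in> {-B..B} \<Longrightarrow> \<bar>Re (\<Phi> x) - P1 x\<bar> < \<eta> / 2"
      using Stone_Weierstrass_real_polynomial_function[of "{-B..B}" "\<lambda>x. Re (\<Phi> x)" "\<eta> / 2"] \<eta>
      by (auto intro: continuous_intros \<Phi>c)
    obtain P2 where P2: "real_polynomial_function P2" "\<And>x. x \<in> {-B..B} \<Longrightarrow> \<bar>Im (\<Phi> x) - P2 x\<bar> < \<eta> / 2"
      using Stone_Weierstrass_real_polynomial_function[of "{-B..B}" "\<lambda>x. Im (\<Phi> x)" "\<eta> / 2"] \<eta>
      by (auto intro: continuous_intros \<Phi>c)
    define P where "P = (\<lambda>x. complex_of_real (P1 x) + \<i> * complex_of_real (P2 x))"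
    have P: "cmod (\<Phi> x - P x) \<le> \<eta>" if "x \<in> {-B..B}" for x
    proof -
      have "cmod (\<Phi> x - P x) \<le> \<bar>Re (\<Phi> x - P x)\<bar> + \<bar>Im (\<Phi> x - P x)\<bar>" by (rule cmod_le)
      then show ?thesis using P1(2)[OF that] P2(2)[OF that] by (simp add: P_def)
    qed
    have PG: "(\<lambda>t. P (G t)) \<in> trigpoly (rspan F)"
      unfolding P_def
      by (rule trigpoly_add[OF trigpoly_real_polynomial_comp[OF rspan_add rspan_zero Gt P1(1)]
          trigpoly_mult[OF rspan_add trigpoly_const[OF rspan_zero]
            trigpoly_real_polynomial_comp[OF rspan_add rspan_zero Gt P2(1)]]])
    have HPb: "bmeas (\<lambda>t. H t * P (G t))" by (intro bmeas_mult Hb bmeas_trigpoly[OF PG])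
    have avgP: "(avg (\<lambda>t. H t * P (G t)) \<longlongrightarrow> 0) at_top"
      unfolding H_def by (rule avg_trigpoly[OF PG nr'])
    have "uniformly_continuous_on {-B-1..B+1} \<Phi>"
      by (intro compact_uniformly_continuous \<Phi>c) auto
    then obtain d where d: "d > 0" "\<And>x y. x \<in> {-B-1..B+1} \<Longrightarrow> y \<in> {-B-1..B+1} \<Longrightarrow> \<bar>x - y\<bar> < d \<Longrightarrow> cmod (\<Phi> x - \<Phi> y) < \<eta>"
      using \<eta>(1) unfolding uniformly_continuous_on_def dist_norm real_norm_def by metis
    have "\<forall>\<^sub>F t in at_top. dist (\<rho> t) 0 < min (min d 1) (\<epsilon> / 2)"
      using d(1) \<epsilon> by (intro tendstoD[OF \<rho>]) auto
    then obtain S0 where S0: "\<And>t. t \<ge> S0 \<Longrightarrow> \<bar>\<rho> t\<bar> < min (min d 1) (\<epsilon> / 2)"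
      unfolding eventually_at_top_linorder dist_real_def by auto
    define S where "S = max 1 S0"
    have S: "S > 0" "\<And>t. t \<ge> S \<Longrightarrow> \<bar>\<rho> t\<bar> < min (min d 1) (\<epsilon> / 2)"
      using S0 by (auto simp: S_def)
    have near: "cmod (U t - H t * P (G t)) \<le> 2 * \<eta> + 3 * indicator (A \<union> {0..S}) t" if t: "0 \<le> t" for t
    proof -
      have GB: "G t \<in> {-B..B}" using B[of t] by (auto simp: abs_le_iff)
      have H1: "cmod (H t) = 1" by (simp add: H_def norm_mult)
      show ?thesis
      proof (cases "t \<in> A \<union> {0..S}")
        case True
        have "cmod (P (G t)) \<le> 2" using P[OF GB] \<Phi>1[of "G t"] \<eta>(2) norm_triangle_sub[of "P (G t)" "\<Phi> (G t)"]
          by (simp add: norm_minus_commute)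
        then have "cmod (U t - H t * P (G t)) \<le> 1 + 2"
          by (intro norm_triangle_le_diff add_mono) (simp_all add: U_def norm_mult H1)
        then show ?thesis using True \<eta> by simp
      next
        case False
        then have t': "t > S" "\<bar>G t\<bar> > \<epsilon>" using t by (auto simp: A_def)
        then have \<rho>t: "\<bar>\<rho> t\<bar> < d" "\<bar>\<rho> t\<bar> < 1" "\<bar>\<rho> t\<bar> < \<epsilon> / 2" using S(2)[of t] by auto
        then have big: "\<bar>G t + \<rho> t\<bar> \<ge> \<epsilon> / 2" "G t + \<rho> t \<noteq> 0"
          using t'(2) \<epsilon> abs_triangle_ineq2[of "G t" "- \<rho> t"] by auto
        have tpos: "t > 0" using t'(1) S(1) by simp
        have "ln \<bar>f t\<bar> = r * t + real k * ln t + ln \<bar>G t + \<rho> t\<bar>"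
          unfolding f[OF tpos] using tpos big(2) by (simp add: abs_mult ln_mult ln_realpow)
        then have "U t = H t * cis (\<beta> * ln \<bar>G t + \<rho> t\<bar>)"
          by (simp add: U_def H_def cis_mult algebra_simps)
        also have "cis (\<beta> * ln \<bar>G t + \<rho> t\<bar>) = \<Phi> (G t + \<rho> t)"
          using big \<epsilon> by (simp add: \<Phi>_def soft_phase_def min_def field_simps)
        finally have "cmod (U t - H t * P (G t)) = cmod (\<Phi> (G t + \<rho> t) - P (G t))"
          by (simp add: norm_mult H1 flip: right_diff_distrib)
        also have "\<dots> \<le> cmod (\<Phi> (G t + \<rho> t) - \<Phi> (G t)) + cmod (\<Phi> (G t) - P (G t))"
          using norm_triangle_ineq[of "\<Phi> (G t + \<rho> t) - \<Phi> (G t)" "\<Phi> (G t) - P (G t)"] by simp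
        also have "\<dots> \<le> \<eta> + \<eta>"
        proof (rule add_mono[OF less_imp_le P[OF GB]])
          show "cmod (\<Phi> (G t + \<rho> t) - \<Phi> (G t)) < \<eta>"
            using \<rho>t GB by (intro d(2)) (auto simp: abs_less_iff)
        qed
        finally show ?thesis using False by simp
      qed
    qed
    have "\<forall>\<^sub>F T in at_top. dist (avg (\<lambda>t. H t * P (G t)) T) 0 < \<eta>"
      using \<eta>(1) by (intro tendstoD avgP)
    moreover have "\<forall>\<^sub>F T in at_top. T \<ge> max 1 (S / \<eta>)" by (rule eventually_ge_at_top)
    ultimately show "\<forall>\<^sub>F T in at_top. dist (avg U T) 0 < e"
    proof eventually_elim
      case (elim T)
      have T: "T \<ge> 1" "S / T \<le> \<eta>" using elim(2) \<eta>(1) by (auto simp: field_simps)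
      have "measure lborel ({0..T} \<inter> (A \<union> {0..S})) \<le> measure lborel ({0..T} \<inter> A) + measure lborel {0..S}"
      proof -
        have "measure lborel ({0..T} \<inter> (A \<union> {0..S})) \<le> measure lborel (({0..T} \<inter> A) \<union> {0..S})"
          using A by (intro measure_mono_fmeasurable fmeasurable.Un fmeasurable_Int_fmeasurable fmeasurableI)
            (auto simp: emeasure_lborel_Icc_eq)
        also have "\<dots> \<le> measure lborel ({0..T} \<inter> A) + measure lborel {0..S}"
          using A by (intro measure_Un_le) auto
        finally show ?thesis .
      qed
      then have "measure lborel ({0..T} \<inter> (A \<union> {0..S})) / T \<le> measure lborel ({0..T} \<inter> A) / T + S / T"
        using T(1) S(1) by (simp add: divide_right_mono flip: add_divide_distrib)
      also have "\<dots> \<le> \<eta> + \<eta>" using dens[OF T(1)] T(2) by (rule add_mono)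
      finally have "cmod (avg (\<lambda>t. U t - H t * P (G t)) T) \<le> 2 * \<eta> + 3 * (\<eta> + \<eta>)"
        using norm_avg_le[OF bmeas_diff[OF Ub HPb], of T "A \<union> {0..S}" 3 "2 * \<eta>"] near T(1) A
        by fastforce
      then have "cmod (avg U T - avg (\<lambda>t. H t * P (G t)) T) \<le> 8 * \<eta>"
        unfolding avg_diff[OF Ub HPb] by simp
      then show ?case
        using elim(1) norm_triangle_sub[of "avg U T" "avg (\<lambda>t. H t * P (G t)) T"] \<eta> by simp
    qed
  qed
qed

section \<open>The expected phase of a shifted Gaussian variable\<close>

text \<open>The expectation of \<open>cis (\<beta> * ln \<bar>y + X\<bar>)\<close> for a standard Gaussian variable \<open>X\<close>. In contrast to the phase of a single
  number it is an entire function of \<open>y\<close>, which is the gain from randomisation.\<close>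
definition gauss_phase :: "real \<Rightarrow> real \<Rightarrow> complex" where
  "gauss_phase \<beta> y = (LINT x|lborel. std_normal_density x *\<^sub>R cis (\<beta> * ln \<bar>y + x\<bar>))"

lemma phase_measurable: "(\<lambda>x. cis (\<beta> * ln \<bar>y + x\<bar>)) \<in> borel_measurable borel"
  by (intro bmeas_measurable bmeas_cis) measurable

lemma normal_phase_integrable:
  assumes "\<sigma> > 0" "u \<in> borel_measurable borel"
  shows "integrable lborel (\<lambda>x. normal_density \<mu> \<sigma> x *\<^sub>R cis (u x))"
proof (rule Bochner_Integration.integrable_bound[OF integrable_normal_density[OF assms(1)]])
  show "(\<lambda>x. normal_density \<mu> \<sigma> x *\<^sub>R cis (u x)) \<in> borel_measurable lborel"
    using bmeas_measurable[OF bmeas_cis[OF assms(2)]] by measurable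
qed (auto intro!: AE_I2)

lemma norm_gauss_phase: "cmod (gauss_phase \<beta> y) \<le> 1"
proof -
  have "cmod (gauss_phase \<beta> y) \<le> (LINT x|lborel. norm (std_normal_density x *\<^sub>R cis (\<beta> * ln \<bar>y + x\<bar>)))"
    unfolding gauss_phase_def by (rule integral_norm_bound)
  also have "\<dots> = 1" by simp
  finally show ?thesis .
qed

lemma gauss_phase_even: "gauss_phase \<beta> (- y) = gauss_phase \<beta> y"
proof -
  have "gauss_phase \<beta> (- y) = (LINT x|lborel. std_normal_density (- x) *\<^sub>R cis (\<beta> * ln \<bar>- y - x\<bar>))"
    unfolding gauss_phase_def by (subst lborel_integral_real_affine[where c = "-1" and t = 0]) auto
  also have "\<dots> = gauss_phase \<beta> y"
    unfolding gauss_phase_def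
  proof (rule Bochner_Integration.integral_cong[OF refl])
    fix x
    have "\<bar>- y - x\<bar> = \<bar>y + x\<bar>" by simp
    then show "std_normal_density (- x) *\<^sub>R cis (\<beta> * ln \<bar>- y - x\<bar>) = std_normal_density x *\<^sub>R cis (\<beta> * ln \<bar>y + x\<bar>)"
      by (simp add: std_normal_density_def)
  qed
  finally show ?thesis .
qed

lemma isCont_cis: "isCont cis x"
proof -
  have "cis = (\<lambda>x. exp (\<i> * of_real x))" by (simp add: fun_eq_iff cis_conv_exp)
  moreover have "isCont (\<lambda>x. exp (\<i> * of_real x)) x" by (intro continuous_intros)
  ultimately show ?thesis by simp
qed

text \<open>For a large mean the fluctuation is negligible, so that the phase keeps turning: this is why the expected phase
  is not constant.\<close>
lemma gauss_phase_asymp: "((\<lambda>y. gauss_phase \<beta> y - cis (\<beta> * ln y)) \<longlongrightarrow> 0) at_top"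
proof -
  have int1: "integrable lborel (\<lambda>x. std_normal_density x *\<^sub>R cis (\<beta> * ln \<bar>y + x\<bar>))" for y
    by (rule normal_phase_integrable) auto
  have "((\<lambda>y. LINT x|lborel. std_normal_density x *\<^sub>R (cis (\<beta> * ln \<bar>y + x\<bar>) - cis (\<beta> * ln y)))
     \<longlongrightarrow> (LINT x::real|lborel. (0::complex))) at_top"
  proof (rule integral_dominated_convergence_at_top[where w = "\<lambda>x. 2 * std_normal_density x"])
    show "integrable lborel (\<lambda>x. 2 * std_normal_density x)" by simp
    show "(\<lambda>x. std_normal_density x *\<^sub>R (cis (\<beta> * ln \<bar>y + x\<bar>) - cis (\<beta> * ln y))) \<in> borel_measurable lborel" for y
      using phase_measurable[of \<beta> y] by measurable
    show "\<forall>\<^sub>F y in at_top. AE x in lborel. norm (std_normal_density x *\<^sub>R (cis (\<beta> * ln \<bar>y + x\<bar>) - cis (\<beta> * ln y)))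
        \<le> 2 * std_normal_density x"
    proof (intro always_eventually allI AE_I2)
      fix x y
      have "cmod (cis (\<beta> * ln \<bar>y + x\<bar>) - cis (\<beta> * ln y)) \<le> 2"
        using norm_triangle_ineq4[of "cis (\<beta> * ln \<bar>y + x\<bar>)" "cis (\<beta> * ln y)"] by simp
      then show "norm (std_normal_density x *\<^sub>R (cis (\<beta> * ln \<bar>y + x\<bar>) - cis (\<beta> * ln y))) \<le> 2 * std_normal_density x"
        using mult_right_mono[of "cmod (cis (\<beta> * ln \<bar>y + x\<bar>) - cis (\<beta> * ln y))" 2 "std_normal_density x"]
        by (simp add: mult.commute)
    qed
    show "AE x in lborel. ((\<lambda>y. std_normal_density x *\<^sub>R (cis (\<beta> * ln \<bar>y + x\<bar>) - cis (\<beta> * ln y))) \<longlongrightarrow> 0) at_top"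
    proof (rule AE_I2)
      fix x :: real
      have "((\<lambda>y. \<beta> * ln (1 + x / y)) \<longlongrightarrow> 0) at_top" by real_asymp
      then have lim1: "((\<lambda>y. cis (\<beta> * ln (1 + x / y))) \<longlongrightarrow> cis 0) at_top"
        by (rule isCont_tendsto_compose[OF isCont_cis])
      have "((\<lambda>y. std_normal_density x * cmod (cis (\<beta> * ln (1 + x / y)) - cis 0))
          \<longlongrightarrow> std_normal_density x * cmod (cis 0 - cis 0)) at_top"
        by (intro tendsto_mult tendsto_norm tendsto_diff lim1 tendsto_const)
      then have lim: "((\<lambda>y. std_normal_density x * cmod (cis (\<beta> * ln (1 + x / y)) - 1)) \<longlongrightarrow> 0) at_top"
        by simp
      show "((\<lambda>y. std_normal_density x *\<^sub>R (cis (\<beta> * ln \<bar>y + x\<bar>) - cis (\<beta> * ln y))) \<longlongrightarrow> 0) at_top"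
      proof (rule Lim_null_comparison[OF _ lim])
        show "\<forall>\<^sub>F y in at_top. norm (std_normal_density x *\<^sub>R (cis (\<beta> * ln \<bar>y + x\<bar>) - cis (\<beta> * ln y)))
          \<le> std_normal_density x * cmod (cis (\<beta> * ln (1 + x / y)) - 1)"
          using eventually_gt_at_top[of "\<bar>x\<bar>"]
        proof eventually_elim
          case (elim y)
          then have pos: "y > 0" "1 + x / y > 0" "y + x > 0" by (auto simp: field_simps)
          have "\<bar>y + x\<bar> = y * (1 + x / y)" using pos(1,3) by (simp add: distrib_left)
          then have "ln \<bar>y + x\<bar> = ln (y * (1 + x / y))" by (rule arg_cong)
          also have "\<dots> = ln y + ln (1 + x / y)" using pos by (intro ln_mult_pos)
          finally have "cis (\<beta> * ln \<bar>y + x\<bar>) - cis (\<beta> * ln y) = cis (\<beta> * ln y) * (cis (\<beta> * ln (1 + x / y)) - 1)"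
            by (simp add: distrib_left right_diff_distrib cis_mult)
          then show ?case by (simp add: norm_mult)
        qed
      qed
    qed
  qed simp
  moreover have "(LINT x|lborel. std_normal_density x *\<^sub>R (cis (\<beta> * ln \<bar>y + x\<bar>) - cis (\<beta> * ln y)))
     = gauss_phase \<beta> y - cis (\<beta> * ln y)" for y
    unfolding gauss_phase_def scaleR_diff_right
    by (subst Bochner_Integration.integral_diff[OF int1])
       (auto intro!: integrable_scaleR_left)
  ultimately show ?thesis by simp
qed

lemma normal_density_shift:
  "std_normal_density x * exp (\<mu> * x) = exp (\<mu>\<^sup>2 / 2) * normal_density \<mu> 1 x"
proof -
  have "- x\<^sup>2 / 2 + \<mu> * x = \<mu>\<^sup>2 / 2 + - (x - \<mu>)\<^sup>2 / 2" by (simp add: power2_eq_square field_simps)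
  then show ?thesis by (simp add: std_normal_density_def normal_density_def mult.assoc flip: exp_add)
qed

lemma normal_exp_abs_integrable:
  "integrable lborel (\<lambda>x. std_normal_density x * exp (r * \<bar>x\<bar>))"
proof (rule Bochner_Integration.integrable_bound)
  show "integrable lborel (\<lambda>x. exp (r\<^sup>2 / 2) * normal_density r 1 x + exp ((-r)\<^sup>2 / 2) * normal_density (-r) 1 x)"
    by (intro Bochner_Integration.integrable_add integrable_mult_right integrable_normal_density) auto
  have "norm (std_normal_density x * exp (r * \<bar>x\<bar>))
     \<le> norm (exp (r\<^sup>2 / 2) * normal_density r 1 x + exp ((-r)\<^sup>2 / 2) * normal_density (-r) 1 x)" for x
    unfolding normal_density_shift[symmetric] by (cases "x \<ge> 0") auto
  then show "AE x in lborel. norm (std_normal_density x * exp (r * \<bar>x\<bar>))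
     \<le> norm (exp (r\<^sup>2 / 2) * normal_density r 1 x + exp ((-r)\<^sup>2 / 2) * normal_density (-r) 1 x)"
    by (rule AE_I2)
qed measurable

lemma exp_partial_sum_bound: "cmod (\<Sum>l<n. (of_real x * z) ^ l / fact l) \<le> exp (cmod z * \<bar>x\<bar>)"
proof -
  have "cmod (\<Sum>l<n. (of_real x * z) ^ l / fact l) \<le> (\<Sum>l<n. (cmod z * \<bar>x\<bar>) ^ l / fact l)"
    by (rule sum_norm_le) (simp add: norm_divide norm_mult norm_power mult.commute)
  also have "\<dots> \<le> exp (cmod z * \<bar>x\<bar>)"
    using sum_le_suminf[OF summable_exp_generic, of "{..<n}" "cmod z * \<bar>x\<bar>"]
    by (auto simp: exp_def scaleR_conv_of_real divide_inverse mult.commute)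
  finally show ?thesis .
qed

text \<open>Completing the square in the Gaussian density separates the entire factor \<open>exp (- z\<^sup>2 / 2)\<close> from this Laplace
  transform, which may be expanded under the integral.\<close>
definition phase_laplace :: "real \<Rightarrow> complex \<Rightarrow> complex" where
  "phase_laplace \<beta> z = (LINT x|lborel. std_normal_density x *\<^sub>R (exp (of_real x * z) * cis (\<beta> * ln \<bar>x\<bar>)))"

lemma phase_laplace_sums:
  "(\<lambda>l. (LINT x|lborel. std_normal_density x *\<^sub>R (of_real x ^ l / fact l * cis (\<beta> * ln \<bar>x\<bar>))) * z ^ l) sums phase_laplace \<beta> z"
proof -
  have hm: "(\<lambda>x. cis (\<beta> * ln \<bar>x\<bar>)) \<in> borel_measurable borel" using phase_measurable[of \<beta> 0] by simp
  define f where "f = (\<lambda>l x. std_normal_density x *\<^sub>R ((of_real x * z) ^ l / fact l * cis (\<beta> * ln \<bar>x\<bar>)))"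
  have bound: "cmod (\<Sum>l<n. f l x) \<le> std_normal_density x * exp (cmod z * \<bar>x\<bar>)" for n x
  proof -
    have "(\<Sum>l<n. f l x) = std_normal_density x *\<^sub>R ((\<Sum>l<n. (of_real x * z) ^ l / fact l) * cis (\<beta> * ln \<bar>x\<bar>))"
      by (simp add: f_def scaleR_sum_right sum_distrib_right)
    then show ?thesis using mult_left_mono[OF exp_partial_sum_bound[of x z n], of "std_normal_density x"]
      by (simp add: norm_mult)
  qed
  have fm: "f l \<in> borel_measurable borel" for l
    unfolding f_def using hm by measurable
  have fi: "integrable lborel (f l)" for l
  proof (rule Bochner_Integration.integrable_bound[OF integrable_mult_right[OF normal_exp_abs_integrable[of "cmod z"], of 2]])
    show "AE x in lborel. norm (f l x) \<le> norm (2 * (std_normal_density x * exp (cmod z * \<bar>x\<bar>)))"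
    proof (rule AE_I2)
      fix x
      have "f l x = (\<Sum>i<Suc l. f i x) - (\<Sum>i<l. f i x)" by simp
      then have "norm (f l x) \<le> cmod (\<Sum>i<Suc l. f i x) + cmod (\<Sum>i<l. f i x)"
        by (metis norm_triangle_ineq4)
      then show "norm (f l x) \<le> norm (2 * (std_normal_density x * exp (cmod z * \<bar>x\<bar>)))"
        using bound[where n = "Suc l" and x = x] bound[where n = l and x = x] by simp
    qed
  qed (use fm in simp)
  have "(\<lambda>n. LINT x|lborel. (\<Sum>l<n. f l x)) \<longlonglongrightarrow> phase_laplace \<beta> z"
    unfolding phase_laplace_def
  proof (rule integral_dominated_convergence[where w = "\<lambda>x. std_normal_density x * exp (cmod z * \<bar>x\<bar>)"])
    show "AE x in lborel. (\<lambda>n. \<Sum>l<n. f l x) \<longlonglongrightarrow> std_normal_density x *\<^sub>R (exp (of_real x * z) * cis (\<beta> * ln \<bar>x\<bar>))"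
    proof (rule AE_I2)
      fix x
      have "(\<lambda>l. (of_real x * z) ^ l / fact l) sums exp (of_real x * z)"
        using exp_converges[of "of_real x * z"] by (simp add: scaleR_conv_of_real divide_inverse mult.commute)
      then have "(\<lambda>l. f l x) sums (std_normal_density x *\<^sub>R (exp (of_real x * z) * cis (\<beta> * ln \<bar>x\<bar>)))"
        unfolding f_def by (intro sums_scaleR_right sums_mult2)
      then show "(\<lambda>n. \<Sum>l<n. f l x) \<longlonglongrightarrow> std_normal_density x *\<^sub>R (exp (of_real x * z) * cis (\<beta> * ln \<bar>x\<bar>))"
        by (simp add: sums_def)
    qed
    show "integrable lborel (\<lambda>x. std_normal_density x * exp (cmod z * \<bar>x\<bar>))" by (rule normal_exp_abs_integrable)
    have "exp \<in> borel_measurable (borel :: complex measure)"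
      by (intro borel_measurable_continuous_onI continuous_intros)
    then show "(\<lambda>x. std_normal_density x *\<^sub>R (exp (of_real x * z) * cis (\<beta> * ln \<bar>x\<bar>))) \<in> borel_measurable lborel"
      using hm by measurable
  qed (use fm bound in auto)
  then have "(\<lambda>l. LINT x|lborel. f l x) sums phase_laplace \<beta> z"
    using fi by (simp add: sums_def)
  moreover have "(LINT x|lborel. f l x) = (LINT x|lborel. std_normal_density x *\<^sub>R (of_real x ^ l / fact l * cis (\<beta> * ln \<bar>x\<bar>))) * z ^ l" for l
    unfolding f_def integral_mult_left_zero[symmetric]
    by (intro Bochner_Integration.integral_cong) (simp_all add: power_mult_distrib mult_ac)
  ultimately show ?thesis by simp
qed

lemma gauss_phase_laplace:
  "gauss_phase \<beta> y = exp (- (of_real y)\<^sup>2 / 2) * phase_laplace \<beta> (of_real y)"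
proof -
  have "gauss_phase \<beta> y = (LINT x|lborel. std_normal_density (x - y) *\<^sub>R cis (\<beta> * ln \<bar>x\<bar>))"
    unfolding gauss_phase_def by (subst lborel_integral_real_affine[where c = 1 and t = "- y"]) auto
  also have "\<dots> = (LINT x|lborel. exp (- (of_real y)\<^sup>2 / 2) *
      (std_normal_density x *\<^sub>R (exp (of_real x * of_real y) * cis (\<beta> * ln \<bar>x\<bar>))))"
  proof (rule Bochner_Integration.integral_cong[OF refl])
    fix x
    have "std_normal_density (x - y) = normal_density y 1 x"
      by (simp add: std_normal_density_def normal_density_def)
    also have "\<dots> = exp (- y\<^sup>2 / 2) * (std_normal_density x * exp (y * x))"
      unfolding normal_density_shift by (simp add: exp_minus)
    finally have "complex_of_real (std_normal_density (x - y)) =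
       exp (- (of_real y)\<^sup>2 / 2) * (of_real (std_normal_density x) * exp (of_real x * of_real y))"
      by (simp add: mult.commute flip: exp_of_real)
    then show "std_normal_density (x - y) *\<^sub>R cis (\<beta> * ln \<bar>x\<bar>) = exp (- (of_real y)\<^sup>2 / 2) *
      (std_normal_density x *\<^sub>R (exp (of_real x * of_real y) * cis (\<beta> * ln \<bar>x\<bar>)))"
      by (simp add: scaleR_conv_of_real mult_ac)
  qed
  finally show ?thesis unfolding phase_laplace_def by (simp only: integral_mult_right_zero)
qed

lemma gauss_phase_entire:
  shows continuous_gauss_phase: "continuous_on S (gauss_phase \<beta>)"
    and gauss_phase_power_series: "\<exists>c. \<forall>y. (\<lambda>l. c l * of_real y ^ l) sums gauss_phase \<beta> y"
proof -
  define \<Phi> where "\<Phi> = (\<lambda>z. exp (- z\<^sup>2 / 2) * phase_laplace \<beta> z)"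
  have "phase_laplace \<beta> holomorphic_on ball 0 r" for r
    by (rule power_series_holomorphic) (use phase_laplace_sums in simp)
  then have hol: "\<Phi> holomorphic_on ball 0 r" for r
    unfolding \<Phi>_def by (intro holomorphic_intros) auto
  have "(\<lambda>l. (deriv ^^ l) \<Phi> 0 / fact l * of_real y ^ l) sums gauss_phase \<beta> y" for y
    using holomorphic_power_series[OF hol, of "of_real y" "\<bar>y\<bar> + 1"]
    by (simp add: gauss_phase_laplace \<Phi>_def)
  then show "\<exists>c. \<forall>y. (\<lambda>l. c l * of_real y ^ l) sums gauss_phase \<beta> y"
    by (intro exI[of _ "\<lambda>l. (deriv ^^ l) \<Phi> 0 / fact l"] allI)
  have "isCont (gauss_phase \<beta>) y" for y
  proof -
    have "continuous_on (ball 0 (\<bar>y\<bar> + 1)) \<Phi>"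
      using hol by (rule holomorphic_on_imp_continuous_on)
    then have "isCont \<Phi> (of_real y)"
      by (rule continuous_on_interior) (simp add: interior_open)
    then have "isCont (\<lambda>y. \<Phi> (of_real y)) y"
      by (rule isCont_o2[rotated]) (intro continuous_intros)
    moreover have "gauss_phase \<beta> = (\<lambda>y. \<Phi> (of_real y))" by (rule ext) (simp add: gauss_phase_laplace \<Phi>_def)
    ultimately show ?thesis by simp
  qed
  then show "continuous_on S (gauss_phase \<beta>)" by (simp add: continuous_at_imp_continuous_on)
qed

text \<open>A bounded polynomial is constant, but along \<open>y = exp (j * pi / \<beta>)\<close> the values approach \<open>1\<close> and \<open>-1\<close> alternately.\<close>
lemma gauss_phase_not_polynomial:
  assumes \<beta>: "\<beta> > 0"
  shows "\<not> (\<forall>y. gauss_phase \<beta> y = poly p (of_real y))"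
proof
  assume "\<forall>y. gauss_phase \<beta> y = poly p (of_real y)"
  then have that: "gauss_phase \<beta> y = poly p (of_real y)" for y by blast
  obtain a q where p: "p = pCons a q" by (cases p)
  have "q = 0"
  proof (rule ccontr)
    assume "q \<noteq> 0"
    then obtain r where r: "\<And>z. r \<le> cmod z \<Longrightarrow> 2 \<le> cmod (poly p z)"
      using poly_infinity[of q 2 a] p by auto
    have "2 \<le> cmod (poly p (of_real \<bar>r\<bar>))" by (rule r) simp
    then show False using that norm_gauss_phase[of \<beta> "\<bar>r\<bar>"] by simp
  qed
  then have "gauss_phase \<beta> y = a" for y using that p by simp
  then have "((\<lambda>y. a - cis (\<beta> * ln y)) \<longlongrightarrow> 0) at_top" using gauss_phase_asymp[of \<beta>] by simp
  then have *: "((\<lambda>y. cis (\<beta> * ln y)) \<longlongrightarrow> a) at_top"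
    using tendsto_diff[OF tendsto_const[of a], of "\<lambda>y. a - cis (\<beta> * ln y)" 0] by simp
  have "(\<lambda>j::nat. cis (\<beta> * ln (exp (pi * real (2 * j) / \<beta>)))) \<longlonglongrightarrow> a"
    by (rule filterlim_compose[OF *]) (use \<beta> in real_asymp)
  moreover have "(\<lambda>j::nat. cis (\<beta> * ln (exp (pi * real (2 * j + 1) / \<beta>)))) \<longlonglongrightarrow> a"
    by (rule filterlim_compose[OF *]) (use \<beta> in real_asymp)
  moreover have "cis (\<beta> * ln (exp (pi * real (2 * j) / \<beta>))) = 1" "cis (\<beta> * ln (exp (pi * real (2 * j + 1) / \<beta>))) = -1" for j
    using \<beta> cos_npi2[of "2 * j"] sin_npi2[of "2 * j"] cos_npi2[of "2 * j + 1"] sin_npi2[of "2 * j + 1"]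
    by (auto simp: complex_eq_iff simp del: of_nat_mult of_nat_add of_nat_Suc)
  ultimately have "1 = a" "-1 = a" by (simp_all add: LIMSEQ_const_iff)
  then show False by simp
qed

text \<open>The function is even, so it equals the even part of its power series. With finitely many even terms it would be a
  polynomial.\<close>
lemma gauss_phase_even_coeffs:
  assumes \<beta>: "\<beta> > 0" and c: "\<And>y. (\<lambda>l. c l * of_real y ^ l) sums gauss_phase \<beta> y"
  shows "\<exists>l\<ge>m. even l \<and> c l \<noteq> 0"
proof (rule ccontr)
  assume "\<not> ?thesis"
  then have z: "c l = 0" if "l \<ge> m" "even l" for l using that by blast
  define d where "d = (\<lambda>l. if even l then c l else 0)"
  define p where "p = (\<Sum>l<m. monom (d l) l)"
  have "gauss_phase \<beta> y = poly p (of_real y)" for y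
  proof -
    have "(\<lambda>l. (c l * of_real y ^ l + c l * of_real (- y) ^ l) / 2) sums ((gauss_phase \<beta> y + gauss_phase \<beta> (- y)) / 2)"
      by (intro sums_divide sums_add c)
    moreover have "(c l * of_real y ^ l + c l * of_real (- y) ^ l) / 2 = d l * of_real y ^ l" for l
      by (cases "even l") (auto simp: d_def)
    ultimately have "(\<lambda>l. d l * of_real y ^ l) sums gauss_phase \<beta> y" by (simp add: gauss_phase_even)
    moreover have "(\<lambda>l. d l * of_real y ^ l) sums (\<Sum>l<m. d l * of_real y ^ l)"
      using z by (intro sums_finite) (auto simp: d_def)
    ultimately have "gauss_phase \<beta> y = (\<Sum>l<m. d l * of_real y ^ l)" by (rule sums_unique2)
    then show ?thesis by (simp add: p_def poly_sum poly_monom)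
  qed
  then show False using gauss_phase_not_polynomial[OF \<beta>] by blast
qed

section \<open>Standard Gaussian measure on a Euclidean space\<close>

abbreviation std_gauss :: "real measure" where
  "std_gauss \<equiv> density lborel (\<lambda>x. ennreal (std_normal_density x))"

definition gauss_measure :: "'a::euclidean_space measure" where
  "gauss_measure = distr (Pi\<^sub>M Basis (\<lambda>_. std_gauss)) borel (\<lambda>f. \<Sum>b\<in>Basis. f b *\<^sub>R b)"

lemma prob_space_std_gauss: "prob_space std_gauss"
  by (rule prob_space_normal_density) simp

lemma basis_sum_measurable:
  "(\<lambda>f. \<Sum>b\<in>Basis. f b *\<^sub>R b) \<in> borel_measurable (Pi\<^sub>M (Basis :: 'a::euclidean_space set) (\<lambda>_. borel))"
  by measurable

lemma sets_PiM_std_gauss: "sets (Pi\<^sub>M I (\<lambda>_. std_gauss)) = sets (Pi\<^sub>M I (\<lambda>_. borel))"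
  by (rule sets_PiM_cong) auto

lemma basis_sum_measurable_gauss:
  "(\<lambda>f. \<Sum>b\<in>Basis. f b *\<^sub>R b) \<in> borel_measurable (Pi\<^sub>M (Basis :: 'a::euclidean_space set) (\<lambda>_. std_gauss))"
  using basis_sum_measurable by (simp cong: measurable_cong_sets add: sets_PiM_std_gauss)

lemma prob_space_gauss_measure: "prob_space (gauss_measure :: 'a::euclidean_space measure)"
  unfolding gauss_measure_def
  by (intro prob_space.prob_space_distr prob_space_PiM prob_space_std_gauss basis_sum_measurable_gauss)

lemma sets_gauss_measure [measurable_cong]: "sets gauss_measure = sets borel"
  by (simp add: gauss_measure_def)

lemma PiM_std_gauss_density:
  assumes I: "finite I"
  shows "Pi\<^sub>M I (\<lambda>_. std_gauss) = density (Pi\<^sub>M I (\<lambda>_. lborel)) (\<lambda>f. \<Prod>i\<in>I. ennreal (std_normal_density (f i)))"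
proof -
  interpret P: product_sigma_finite "\<lambda>_. std_gauss"
    by (intro product_sigma_finite.intro prob_space_imp_sigma_finite prob_space_std_gauss)
  interpret L: product_sigma_finite "\<lambda>_. lborel :: real measure"
    by (intro product_sigma_finite.intro) (rule sigma_finite_lborel)
  have sets_eq: "sets (Pi\<^sub>M I (\<lambda>_. lborel)) = sets (Pi\<^sub>M I (\<lambda>_. std_gauss))"
    by (rule sets_PiM_cong) auto
  have dm: "(\<lambda>f. \<Prod>i\<in>I. ennreal (std_normal_density (f i))) \<in> borel_measurable (Pi\<^sub>M I (\<lambda>_. lborel))"
    by measurable
  show ?thesis
  proof (rule P.PiM_eqI[OF I, symmetric])
    show "sets (density (Pi\<^sub>M I (\<lambda>_. lborel)) (\<lambda>f. \<Prod>i\<in>I. ennreal (std_normal_density (f i)))) = sets (Pi\<^sub>M I (\<lambda>_. std_gauss))"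
      by (simp add: sets_eq)
    fix A assume A: "\<And>i. i \<in> I \<Longrightarrow> A i \<in> sets std_gauss"
    have AP: "Pi\<^sub>E I A \<in> sets (Pi\<^sub>M I (\<lambda>_. lborel))" using A I by (intro sets_PiM_I_finite) auto
    have "emeasure (density (Pi\<^sub>M I (\<lambda>_. lborel)) (\<lambda>f. \<Prod>i\<in>I. ennreal (std_normal_density (f i)))) (Pi\<^sub>E I A)
      = (\<integral>\<^sup>+f. (\<Prod>i\<in>I. ennreal (std_normal_density (f i))) * indicator (Pi\<^sub>E I A) f \<partial>Pi\<^sub>M I (\<lambda>_. lborel))"
      by (rule emeasure_density[OF dm AP])
    also have "\<dots> = (\<integral>\<^sup>+f. (\<Prod>i\<in>I. ennreal (std_normal_density (f i)) * indicator (A i) (f i)) \<partial>Pi\<^sub>M I (\<lambda>_. lborel))"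
    proof (rule nn_integral_cong)
      fix f assume f: "f \<in> space (Pi\<^sub>M I (\<lambda>_. lborel :: real measure))"
      have "indicator (Pi\<^sub>E I A) f = (\<Prod>i\<in>I. indicator (A i) (f i) :: ennreal)"
      proof (cases "f \<in> Pi\<^sub>E I A")
        case False
        then obtain i where "i \<in> I" "f i \<notin> A i" using f by (auto simp: space_PiM PiE_iff)
        then have "(\<Prod>i\<in>I. indicator (A i) (f i) :: ennreal) = 0" using I by (intro prod_zero bexI[of _ i]) auto
        then show ?thesis using False by simp
      qed (auto simp: PiE_iff)
      then show "(\<Prod>i\<in>I. ennreal (std_normal_density (f i))) * indicator (Pi\<^sub>E I A) f
        = (\<Prod>i\<in>I. ennreal (std_normal_density (f i)) * indicator (A i) (f i))"
        by (simp add: prod.distrib)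
    qed
    also have "\<dots> = (\<Prod>i\<in>I. \<integral>\<^sup>+x. ennreal (std_normal_density x) * indicator (A i) x \<partial>lborel)"
      using A by (intro L.product_nn_integral_prod[OF I]) auto
    also have "\<dots> = (\<Prod>i\<in>I. emeasure std_gauss (A i))"
      using A by (intro prod.cong) (auto simp: emeasure_density)
    finally show "emeasure (density (Pi\<^sub>M I (\<lambda>_. lborel)) (\<lambda>f. \<Prod>i\<in>I. ennreal (std_normal_density (f i)))) (Pi\<^sub>E I A)
      = (\<Prod>i\<in>I. emeasure std_gauss (A i))" .
  qed
qed

text \<open>The Gaussian measure has a density with respect to Lebesgue measure.\<close>
lemma AE_gauss_measure:
  fixes P :: "'a::euclidean_space \<Rightarrow> bool"
  assumes "AE x in lborel. P x" shows "AE x in gauss_measure. P x"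
proof -
  obtain N where N: "{x. \<not> P x} \<subseteq> N" "N \<in> null_sets (lborel :: 'a measure)"
    using assms by (auto elim!: AE_E simp: null_sets_def)
  let ?S = "\<lambda>f. \<Sum>b\<in>Basis. f b *\<^sub>R b :: 'a"
  let ?L = "Pi\<^sub>M (Basis :: 'a set) (\<lambda>_. lborel :: real measure)"
  have Sm: "?S \<in> measurable ?L borel"
    using basis_sum_measurable by measurable
  have Nb: "N \<in> sets borel" using N(2) by auto
  have "emeasure (distr ?L borel ?S) N = 0" using N(2) by (simp add: lborel_eq[symmetric] null_sets_def)
  then have "?S -` N \<inter> space ?L \<in> null_sets ?L"
    using Nb Sm by (auto simp: emeasure_distr null_sets_def intro: measurable_sets)
  then have "?S -` N \<inter> space ?L \<in> null_sets (Pi\<^sub>M (Basis :: 'a set) (\<lambda>_. std_gauss))"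
    using absolutely_continuousI_density[of "\<lambda>f. \<Prod>i\<in>Basis. ennreal (std_normal_density (f i))" ?L]
    unfolding absolutely_continuous_def PiM_std_gauss_density[OF finite_Basis] by auto
  then have "emeasure gauss_measure N = 0"
    unfolding gauss_measure_def using Nb basis_sum_measurable_gauss
    by (subst emeasure_distr) (auto simp: null_sets_def space_PiM)
  then have "N \<in> null_sets gauss_measure" using Nb by (simp add: null_sets_def sets_gauss_measure)
  then show ?thesis by (rule AE_I') (use N(1) in auto)
qed

text \<open>The projection is a sum of independent centred Gaussian variables whose variances \<open>(e \<bullet> b)\<^sup>2\<close> add up to one. Only
  the indices with \<open>e \<bullet> b \<noteq> 0\<close> are summed, because a normal density needs positive variance.\<close>
lemma gauss_measure_projection:
  fixes e :: "'a::euclidean_space"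
  assumes e: "norm e = 1"
  shows "distr gauss_measure borel (\<lambda>g. g \<bullet> e) = std_gauss"
proof -
  let ?B = "Basis :: 'a set"
  let ?P = "Pi\<^sub>M ?B (\<lambda>_. std_gauss)"
  interpret P: prob_space ?P by (intro prob_space_PiM prob_space_std_gauss)
  define I where "I = {b\<in>?B. e \<bullet> b \<noteq> 0}"
  define X where "X = (\<lambda>b (f :: 'a \<Rightarrow> real). 0 + (e \<bullet> b) * f b)"
  have comp: "(\<lambda>f. f b) \<in> borel_measurable ?P" if "b \<in> ?B" for b
    using measurable_component_singleton[OF that, of "\<lambda>_. std_gauss"] by (simp cong: measurable_cong_sets)
  have dist: "distributed ?P lborel (\<lambda>f. f b) (\<lambda>x. ennreal (std_normal_density x))" if b: "b \<in> ?B" for b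
    unfolding distributed_def
  proof (intro conjI)
    have "distr ?P lborel (\<lambda>f. f b) = distr ?P std_gauss (\<lambda>f. f b)" by (rule distr_cong) auto
    also have "\<dots> = std_gauss"
      by (rule distr_PiM_component[OF _ b]) (rule prob_space_std_gauss)
    finally show "distr ?P lborel (\<lambda>f. f b) = std_gauss" .
  qed (use comp[OF b] in auto)
  have indep: "P.indep_vars (\<lambda>_. borel) (\<lambda>b f. f b) ?B"
  proof (subst P.indep_vars_iff_distr_eq_PiM')
    show "distr ?P (Pi\<^sub>M ?B (\<lambda>_. borel)) (\<lambda>f. \<lambda>b\<in>?B. f b) = Pi\<^sub>M ?B (\<lambda>b. distr ?P borel (\<lambda>f. f b))"
    proof -
      have "distr ?P (Pi\<^sub>M ?B (\<lambda>_. borel)) (\<lambda>f. \<lambda>b\<in>?B. f b) = distr ?P ?P (\<lambda>f. f)"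
        by (rule distr_cong) (auto simp: sets_PiM_std_gauss space_PiM PiE_restrict)
      also have "\<dots> = ?P" by (rule distr_id[unfolded id_def])
      also have "\<dots> = Pi\<^sub>M ?B (\<lambda>b. distr ?P borel (\<lambda>f. f b))"
      proof (rule PiM_cong[OF refl])
        fix b assume "b \<in> ?B"
        then have "distr ?P lborel (\<lambda>f. f b) = std_gauss" using dist unfolding distributed_def by blast
        moreover have "distr ?P lborel (\<lambda>f. f b) = distr ?P borel (\<lambda>f. f b)" by (rule distr_cong) auto
        ultimately show "std_gauss = distr ?P borel (\<lambda>f. f b)" by simp
      qed
      finally show ?thesis .
    qed
  qed (use comp in auto)
  have I: "finite I" "I \<subseteq> ?B" by (auto simp: I_def)
  have "e \<noteq> 0" using e by auto
  then have "I \<noteq> {}" unfolding I_def using euclidean_all_zero_iff[of e] by auto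
  moreover have "P.indep_vars (\<lambda>_. borel) X I"
    unfolding X_def using P.indep_vars_compose2[OF P.indep_vars_subset[OF indep I(2)], of "\<lambda>b x. 0 + (e \<bullet> b) * x"] by simp
  moreover have "distributed ?P lborel (X b) (\<lambda>x. ennreal (normal_density 0 \<bar>e \<bullet> b\<bar> x))" if "b \<in> I" for b
    using P.normal_density_affine[OF dist[of b], of "e \<bullet> b" 0] that by (auto simp: X_def I_def)
  ultimately have "distributed ?P lborel (\<lambda>f. \<Sum>b\<in>I. X b f) (normal_density (\<Sum>b\<in>I. 0) (sqrt (\<Sum>b\<in>I. \<bar>e \<bullet> b\<bar>\<^sup>2)))"
    using I(1) by (intro P.sum_indep_normal) (auto simp: I_def)
  moreover have "(\<Sum>b\<in>I. \<bar>e \<bullet> b\<bar>\<^sup>2) = (\<Sum>b\<in>?B. (e \<bullet> b)\<^sup>2)"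
    by (rule sum.mono_neutral_cong_left) (auto simp: I_def)
  moreover have "(\<Sum>b\<in>?B. (e \<bullet> b)\<^sup>2) = 1"
    using e by (simp add: norm_eq_1 euclidean_inner[of e e] power2_eq_square)
  moreover have "(\<lambda>f. \<Sum>b\<in>I. X b f) = (\<lambda>f. (\<Sum>b\<in>?B. f b *\<^sub>R b) \<bullet> e)"
  proof
    fix f
    have "(\<Sum>b\<in>I. X b f) = (\<Sum>b\<in>?B. X b f)" using I(2)
      by (intro sum.mono_neutral_cong_left) (auto simp: I_def X_def)
    also have "\<dots> = (\<Sum>b\<in>?B. f b *\<^sub>R b) \<bullet> e"
      by (simp add: X_def inner_sum_left inner_commute[of e] mult.commute)
    finally show "(\<Sum>b\<in>I. X b f) = (\<Sum>b\<in>?B. f b *\<^sub>R b) \<bullet> e" .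
  qed
  ultimately have "distributed ?P lborel (\<lambda>f. (\<Sum>b\<in>?B. f b *\<^sub>R b) \<bullet> e) (\<lambda>x. ennreal (std_normal_density x))"
    by simp
  then have "distr ?P lborel (\<lambda>f. (\<Sum>b\<in>?B. f b *\<^sub>R b) \<bullet> e) = std_gauss"
    by (simp add: distributed_def)
  moreover have "distr gauss_measure borel (\<lambda>g. g \<bullet> e) = distr ?P borel (\<lambda>f. (\<Sum>b\<in>?B. f b *\<^sub>R b) \<bullet> e)"
    unfolding gauss_measure_def
    by (subst distr_distr) (use basis_sum_measurable_gauss in \<open>auto simp: o_def\<close>)
  moreover have "distr ?P borel (\<lambda>f. (\<Sum>b\<in>?B. f b *\<^sub>R b) \<bullet> e) = distr ?P lborel (\<lambda>f. (\<Sum>b\<in>?B. f b *\<^sub>R b) \<bullet> e)"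
    by (rule distr_cong) auto
  ultimately show ?thesis by simp
qed

section \<open>Resonance excludes the Benford property for almost every functional\<close>

text \<open>The mean of \<open>cis (\<nu> * t) * w t ^ N\<close>, where \<open>w\<close> is the sum of the functions \<open>cos (\<theta> * t)\<close> with \<open>\<theta> \<in> F\<close>. It is the weight of
  the walks of \<open>N\<close> steps \<open>\<plusminus>\<theta>\<close> that lead from \<open>\<nu>\<close> to zero, and is positive as soon as there is such a walk.\<close>
primrec mu :: "real set \<Rightarrow> nat \<Rightarrow> real \<Rightarrow> real" where
  "mu F 0 \<nu> = (if \<nu> = 0 then 1 else 0)"
| "mu F (Suc N) \<nu> = (\<Sum>\<theta>\<in>F. mu F N (\<nu> + \<theta>) + mu F N (\<nu> - \<theta>)) / 2"

lemma mu_nonneg: "mu F N \<nu> \<ge> 0"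
  by (induction N arbitrary: \<nu>) (auto intro!: sum_nonneg divide_nonneg_pos)

lemma mu_Suc_pos_iff:
  assumes "finite F"
  shows "mu F (Suc N) \<nu> > 0 \<longleftrightarrow> (\<exists>\<theta>\<in>F. mu F N (\<nu> + \<theta>) > 0 \<or> mu F N (\<nu> - \<theta>) > 0)"
proof -
  have "(\<Sum>\<theta>\<in>F. mu F N (\<nu> + \<theta>) + mu F N (\<nu> - \<theta>)) = 0 \<longleftrightarrow> (\<forall>\<theta>\<in>F. mu F N (\<nu> + \<theta>) + mu F N (\<nu> - \<theta>) = 0)"
    using assms mu_nonneg by (intro sum_nonneg_eq_0_iff add_nonneg_nonneg) auto
  moreover have "mu F N (\<nu> + \<theta>) + mu F N (\<nu> - \<theta>) = 0 \<longleftrightarrow> \<not> (mu F N (\<nu> + \<theta>) > 0 \<or> mu F N (\<nu> - \<theta>) > 0)" for \<theta>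
    using mu_nonneg[of F N "\<nu> + \<theta>"] mu_nonneg[of F N "\<nu> - \<theta>"] by linarith
  ultimately show ?thesis using mu_nonneg[of F "Suc N" \<nu>] by (simp add: less_le)
qed

text \<open>Walks can be concatenated.\<close>
lemma mu_add:
  assumes F: "finite F" and "mu F M x > 0" "mu F N y > 0"
  shows "mu F (M + N) (x + y) > 0"
  using assms(2)
proof (induction M arbitrary: x)
  case 0
  then show ?case using assms(3) by (simp split: if_splits)
next
  case (Suc M)
  then obtain \<theta> where "\<theta> \<in> F" "mu F M (x + \<theta>) > 0 \<or> mu F M (x - \<theta>) > 0"
    unfolding mu_Suc_pos_iff[OF F] by blast
  then have "mu F (M + N) (x + y + \<theta>) > 0 \<or> mu F (M + N) (x + y - \<theta>) > 0"
    using Suc.IH[of "x + \<theta>"] Suc.IH[of "x - \<theta>"] by (auto simp: algebra_simps)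
  then show ?case using \<open>\<theta> \<in> F\<close> mu_Suc_pos_iff[OF F, of "M + N" "x + y"] by auto
qed

lemma mu_minus: "mu F N (- x) = mu F N x"
proof (induction N arbitrary: x)
  case (Suc N)
  have "mu F N (- x + \<theta>) + mu F N (- x - \<theta>) = mu F N (x + \<theta>) + mu F N (x - \<theta>)" for \<theta>
  proof -
    have "- x + \<theta> = - (x - \<theta>)" "- x - \<theta> = - (x + \<theta>)" by simp_all
    then show ?thesis using Suc[of "x - \<theta>"] Suc[of "x + \<theta>"] by (simp only:)
  qed
  then show ?case by simp
qed simp

lemma mu_mult: "finite F \<Longrightarrow> mu F M x > 0 \<Longrightarrow> mu F (j * M) (real j * x) > 0"
  by (induction j) (auto simp: distrib_right intro: mu_add)

lemma mu_one: "finite F \<Longrightarrow> \<theta> \<in> F \<Longrightarrow> mu F 1 \<theta> > 0"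
  unfolding One_nat_def by (subst mu_Suc_pos_iff) (auto intro!: bexI[of _ \<theta>])

text \<open>A step followed by its reverse changes nothing, so an even length can be increased to any larger even length.\<close>
lemma mu_pad:
  assumes F: "finite F" "F \<noteq> {}" and x: "mu F M x > 0" and N: "even M" "even N" "M \<le> N"
  shows "mu F N x > 0"
proof -
  obtain \<theta> where "\<theta> \<in> F" using F by auto
  then have "mu F (1 + 1) (\<theta> + - \<theta>) > 0" using F mu_one[of F \<theta>] mu_minus[of F 1 \<theta>] by (intro mu_add) simp_all
  then have "mu F 2 0 > 0" by (simp add: numeral_2_eq_2)
  then have "mu F ((N - M) div 2 * 2) (real ((N - M) div 2) * 0) > 0" using F by (intro mu_mult)
  then have "mu F (M + (N - M) div 2 * 2) (x + real ((N - M) div 2) * 0) > 0" using F x by (intro mu_add)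
  moreover have "M + (N - M) div 2 * 2 = N" using N by (auto elim!: evenE)
  ultimately show ?thesis by simp
qed

text \<open>Clearing denominators writes a multiple of \<open>x\<close> as an integer combination of \<open>F\<close>, that is, as a walk. Doubling the
  multiple makes its length even, as is needed since only even powers of \<open>w\<close> are certain to occur in the expansion
  of the expected phase.\<close>
lemma rspan_mu:
  assumes F: "finite F" "F \<noteq> {}" and x: "x \<in> rspan F"
  shows "\<exists>n\<ge>1. \<exists>M. even M \<and> mu F M (real n * x) > 0"
  using x
proof (induction rule: rspan_induct)
  case zero
  show ?case by (intro exI[of _ 1] conjI exI[of _ 0]) auto
next
  case (add x y)
  then obtain n M n' M' where h: "n \<ge> 1" "even M" "mu F M (real n * x) > 0" "n' \<ge> 1" "even M'" "mu F M' (real n' * y) > 0"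
    by blast
  have "mu F (n' * M + n * M') (real n' * (real n * x) + real n * (real n' * y)) > 0"
    using h F by (intro mu_add mu_mult)
  moreover have "real n' * (real n * x) + real n * (real n' * y) = real (n * n') * (x + y)" by (simp add: algebra_simps)
  ultimately show ?case using h
    by (intro exI[of _ "n * n'"] conjI exI[of _ "n' * M + n * M'"]) auto
next
  case (scale a x)
  then obtain n M where h: "n \<ge> 1" "even M" "mu F M (real n * x) > 0" by blast
  from \<open>a \<in> \<rat>\<close> obtain p q :: int where a: "q > 0" "a = of_int p / of_int q" by (auto elim!: Rats_cases')
  have "mu F (nat \<bar>p\<bar> * M) (real (nat \<bar>p\<bar>) * (real n * x)) > 0" using h F by (intro mu_mult)
  moreover have "mu F (nat \<bar>p\<bar> * M) (real (nat \<bar>p\<bar>) * (real n * x)) = mu F (nat \<bar>p\<bar> * M) (of_int p * (real n * x))"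
    using mu_minus[of F "nat \<bar>p\<bar> * M" "of_int p * (real n * x)"] by (cases "p \<ge> 0") auto
  moreover have "of_int p * (real n * x) = real (nat q * n) * (a * x)" using a by simp
  ultimately have "mu F (nat \<bar>p\<bar> * M) (real (nat q * n) * (a * x)) > 0" by simp
  then show ?case using h a
    by (intro exI[of _ "nat q * n"] conjI exI[of _ "nat \<bar>p\<bar> * M"]) (auto simp: Suc_le_eq)
next
  case (base x)
  have "mu F (2 * 1) (real 2 * x) > 0" using F base by (intro mu_mult mu_one)
  then show ?case by (intro exI[of _ 2] conjI exI[of _ "2 * 1"]) auto
qed

text \<open>Each factor \<open>w\<close> shifts the frequency \<open>\<nu>\<close> by \<open>\<plusminus>\<theta>\<close>, which is the recursion of \<open>mu\<close>. At frequency zero there remains the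
  average of the logarithmic phase.\<close>
lemma avg_cos_power:
  assumes F: "finite F"
  shows "((\<lambda>T. avg (\<lambda>t. cis (\<kappa> * ln t) * cis (\<nu> * t) * of_real (\<Sum>\<theta>\<in>F. cos (\<theta> * t)) ^ N) T
      - of_real (mu F N \<nu>) * (cis (\<kappa> * ln T) / (1 + \<i> * of_real \<kappa>))) \<longlongrightarrow> 0) at_top"
proof (induction N arbitrary: \<nu>)
  case 0
  show ?case using avg_cis_ln[of \<kappa>] avg_cis_ln_cis[of \<nu> \<kappa>] by (cases "\<nu> = 0") simp_all
next
  case (Suc N)
  define w where "w = (\<lambda>t. complex_of_real (\<Sum>\<theta>\<in>F. cos (\<theta> * t)))"
  define h where "h = (\<lambda>\<nu> t. cis (\<kappa> * ln t) * cis (\<nu> * t) * w t ^ N)"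
  have wb: "bmeas w"
  proof (rule bmeasI)
    fix t
    have "cmod (w t) \<le> (\<Sum>\<theta>\<in>F. \<bar>cos (\<theta> * t)\<bar>)" unfolding w_def norm_of_real by (rule sum_abs)
    also have "\<dots> \<le> real (card F) * 1" by (intro sum_bounded_above) auto
    finally show "cmod (w t) \<le> real (card F)" by simp
  qed (simp add: w_def)
  have hb: "bmeas (h \<nu>)" for \<nu>
    unfolding h_def by (intro bmeas_mult bmeas_cis bmeas_power wb) measurable
  have "cis (\<kappa> * ln t) * cis (\<nu> * t) * w t ^ Suc N = (\<Sum>\<theta>\<in>F. (1/2) * (h (\<nu> + \<theta>) t + h (\<nu> - \<theta>) t))" for t
  proof -
    have c: "complex_of_real (cos x) = (1/2) * (cis x + cis (- x))" for x by (simp add: complex_eq_iff)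
    have "w t = (\<Sum>\<theta>\<in>F. (1/2) * (cis (\<theta> * t) + cis (- \<theta> * t)))" unfolding w_def of_real_sum c by simp
    then have "cis (\<kappa> * ln t) * cis (\<nu> * t) * w t ^ Suc N
      = (\<Sum>\<theta>\<in>F. (1/2) * (cis (\<kappa> * ln t) * (cis (\<nu> * t) * cis (\<theta> * t) + cis (\<nu> * t) * cis (- \<theta> * t)) * w t ^ N))"
      by (simp add: sum_distrib_left sum_distrib_right algebra_simps)
    also have "\<dots> = (\<Sum>\<theta>\<in>F. (1/2) * (h (\<nu> + \<theta>) t + h (\<nu> - \<theta>) t))"
    proof (intro sum.cong refl)
      fix \<theta>
      have "cis (\<nu> * t) * cis (\<theta> * t) = cis ((\<nu> + \<theta>) * t)" "cis (\<nu> * t) * cis (- \<theta> * t) = cis ((\<nu> - \<theta>) * t)"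
        by (simp_all add: cis_mult distrib_right left_diff_distrib)
      then show "(1/2) * (cis (\<kappa> * ln t) * (cis (\<nu> * t) * cis (\<theta> * t) + cis (\<nu> * t) * cis (- \<theta> * t)) * w t ^ N)
        = (1/2) * (h (\<nu> + \<theta>) t + h (\<nu> - \<theta>) t)"
        unfolding h_def by (simp only:) (simp add: distrib_left distrib_right)
    qed
    finally show ?thesis .
  qed
  then have "avg (\<lambda>t. cis (\<kappa> * ln t) * cis (\<nu> * t) * w t ^ Suc N) T
      = (\<Sum>\<theta>\<in>F. avg (\<lambda>t. (1/2) * (h (\<nu> + \<theta>) t + h (\<nu> - \<theta>) t)) T)" for T
    by (simp only:) (intro avg_sum bmeas_cmult bmeas_add hb)
  then have eq: "avg (\<lambda>t. cis (\<kappa> * ln t) * cis (\<nu> * t) * w t ^ Suc N) T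
      = (\<Sum>\<theta>\<in>F. (1/2) * (avg (h (\<nu> + \<theta>)) T + avg (h (\<nu> - \<theta>)) T))" for T
    by (simp only: avg_cmult avg_add[OF hb hb])
  define \<tau> where "\<tau> = (\<lambda>T. cis (\<kappa> * ln T) / (1 + \<i> * of_real \<kappa>))"
  have IH: "((\<lambda>T. avg (h \<nu>) T - of_real (mu F N \<nu>) * \<tau> T) \<longlongrightarrow> 0) at_top" for \<nu>
    using Suc.IH[of \<nu>] by (simp add: h_def w_def \<tau>_def)
  have "((\<lambda>T. \<Sum>\<theta>\<in>F. (1/2) * ((avg (h (\<nu> + \<theta>)) T - of_real (mu F N (\<nu> + \<theta>)) * \<tau> T)
      + (avg (h (\<nu> - \<theta>)) T - of_real (mu F N (\<nu> - \<theta>)) * \<tau> T))) \<longlongrightarrow> (\<Sum>\<theta>\<in>F. (1/2) * (0 + 0))) at_top"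
    by (intro tendsto_intros IH)
  moreover have "(\<Sum>\<theta>\<in>F. (1/2) * ((avg (h (\<nu> + \<theta>)) T - of_real (mu F N (\<nu> + \<theta>)) * \<tau> T)
      + (avg (h (\<nu> - \<theta>)) T - of_real (mu F N (\<nu> - \<theta>)) * \<tau> T)))
    = avg (\<lambda>t. cis (\<kappa> * ln t) * cis (\<nu> * t) * w t ^ Suc N) T - of_real (mu F (Suc N) \<nu>) * \<tau> T" for T
    unfolding eq by (simp add: sum_subtractf sum.distrib sum_distrib_left sum_distrib_right sum_divide_distrib algebra_simps)
  ultimately show ?case by (simp add: w_def \<tau>_def)
qed

lemma power_series_tail_bound:
  fixes c :: "nat \<Rightarrow> complex"
  assumes c: "\<And>y. (\<lambda>l. c l * of_real y ^ l) sums f y"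
  shows "\<exists>C. \<forall>y. \<bar>y\<bar> \<le> 1 \<longrightarrow> cmod (f y - (\<Sum>l\<le>m. c l * of_real y ^ l)) \<le> C * \<bar>y\<bar> ^ Suc m"
proof -
  have "summable (\<lambda>l. norm (c l * 1 ^ l))"
    by (rule powser_insidea[of c "of_real 2"]) (use sums_summable[OF c[of 2]] in auto)
  then have s: "summable (\<lambda>l. cmod (c (l + Suc m)))" by (intro summable_ignore_initial_segment) simp
  define C where "C = (\<Sum>l. cmod (c (l + Suc m)))"
  have "cmod (f y - (\<Sum>l\<le>m. c l * of_real y ^ l)) \<le> C * \<bar>y\<bar> ^ Suc m" if y: "\<bar>y\<bar> \<le> 1" for y
  proof -
    have "(\<lambda>l. c (l + Suc m) * of_real y ^ (l + Suc m)) sums (f y - (\<Sum>l<Suc m. c l * of_real y ^ l))"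
      by (rule sums_split_initial_segment[OF c])
    then have e: "f y - (\<Sum>l\<le>m. c l * of_real y ^ l) = (\<Sum>l. c (l + Suc m) * of_real y ^ (l + Suc m))"
      by (simp add: sums_iff lessThan_Suc_atMost)
    have b: "norm (c (l + Suc m) * of_real y ^ (l + Suc m)) \<le> cmod (c (l + Suc m)) * \<bar>y\<bar> ^ Suc m" for l
    proof -
      have "\<bar>y\<bar> ^ (l + Suc m) \<le> \<bar>y\<bar> ^ Suc m" using y by (intro power_decreasing) auto
      then show ?thesis unfolding norm_mult norm_power norm_of_real by (rule mult_left_mono) simp
    qed
    have "norm (\<Sum>l. c (l + Suc m) * of_real y ^ (l + Suc m)) \<le> (\<Sum>l. cmod (c (l + Suc m)) * \<bar>y\<bar> ^ Suc m)"
      by (rule norm_suminf_le[OF b]) (rule summable_mult2[OF s])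
    also have "\<dots> = C * \<bar>y\<bar> ^ Suc m" unfolding C_def by (rule suminf_mult2[OF s, symmetric])
    finally show ?thesis unfolding e .
  qed
  then show ?thesis by blast
qed

text \<open>Expand in powers of \<open>\<epsilon>\<close>. By the choice of the least index \<open>m\<close> at which both the Taylor coefficient and the mean
  are nonzero, all lower terms vanish in the limit. The term of order \<open>m\<close> has modulus bounded below, whereas
  the remainder is of order \<open>\<epsilon> ^ Suc m\<close>.\<close>
lemma gauss_phase_average_not_null:
  assumes F: "finite F" "F \<noteq> {}" and \<beta>: "\<beta> > 0" and M: "even M" "mu F M \<nu> > 0"
  shows "\<not> (\<forall>\<epsilon>. (avg (\<lambda>t. cis (\<kappa> * ln t) * cis (\<nu> * t) * gauss_phase \<beta> (\<epsilon> * (\<Sum>\<theta>\<in>F. cos (\<theta> * t)))) \<longlongrightarrow> 0) at_top)"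
proof
  assume null: "\<forall>\<epsilon>. (avg (\<lambda>t. cis (\<kappa> * ln t) * cis (\<nu> * t) * gauss_phase \<beta> (\<epsilon> * (\<Sum>\<theta>\<in>F. cos (\<theta> * t)))) \<longlongrightarrow> 0) at_top"
  obtain c where c: "\<And>y. (\<lambda>l. c l * of_real y ^ l) sums gauss_phase \<beta> y"
    using gauss_phase_power_series by blast
  obtain l0 where l0: "l0 \<ge> M" "even l0" "c l0 \<noteq> 0" using gauss_phase_even_coeffs[OF \<beta> c] by blast
  have "mu F l0 \<nu> > 0" using mu_pad[OF F M(2) M(1) l0(2,1)] .
  then have ex: "c l0 \<noteq> 0 \<and> mu F l0 \<nu> \<noteq> 0" using l0 by auto
  define m where "m = (LEAST l. c l \<noteq> 0 \<and> mu F l \<nu> \<noteq> 0)"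
  have m: "c m \<noteq> 0" "mu F m \<nu> \<noteq> 0" using LeastI[of "\<lambda>l. c l \<noteq> 0 \<and> mu F l \<nu> \<noteq> 0", OF ex] by (auto simp: m_def)
  have least: "c l = 0 \<or> mu F l \<nu> = 0" if "l < m" for l using not_less_Least that unfolding m_def by blast
  obtain C where C: "\<And>y. \<bar>y\<bar> \<le> 1 \<Longrightarrow> cmod (gauss_phase \<beta> y - (\<Sum>l\<le>m. c l * of_real y ^ l)) \<le> C * \<bar>y\<bar> ^ Suc m"
    using power_series_tail_bound[OF c, of m] by blast
  have C0: "C \<ge> 0" using order_trans[OF norm_ge_zero C[of 1]] by simp
  define K where "K = real (card F)"
  have K: "K > 0" using F by (simp add: K_def card_gt_0_iff)
  define w where "w = (\<lambda>t. \<Sum>\<theta>\<in>F. cos (\<theta> * t))"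
  define H where "H = (\<lambda>t. cis (\<kappa> * ln t) * cis (\<nu> * t))"
  have wK: "\<bar>w t\<bar> \<le> K" for t
  proof -
    have "\<bar>w t\<bar> \<le> (\<Sum>\<theta>\<in>F. \<bar>cos (\<theta> * t)\<bar>)" unfolding w_def by (rule sum_abs)
    also have "\<dots> \<le> real (card F) * 1" by (intro sum_bounded_above) auto
    finally show ?thesis by (simp add: K_def)
  qed
  have wm [measurable]: "w \<in> borel_measurable borel" unfolding w_def by measurable
  have Hb: "bmeas H" unfolding H_def by (intro bmeas_mult bmeas_cis) measurable
  have wb: "bmeas (\<lambda>t. of_real (w t))" by (rule bmeasI[of _ K]) (use wK in auto)
  have gm [measurable]: "gauss_phase \<beta> \<in> borel_measurable borel"
    by (intro borel_measurable_continuous_onI continuous_gauss_phase)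
  have gb: "bmeas (\<lambda>t. gauss_phase \<beta> (\<epsilon> * w t))" for \<epsilon>
    by (rule bmeasI[of _ 1]) (use norm_gauss_phase in auto)
  define \<tau>0 where "\<tau>0 = 1 / cmod (1 + \<i> * of_real \<kappa>)"
  have nz: "1 + \<i> * complex_of_real \<kappa> \<noteq> 0" by (auto simp: complex_eq_iff)
  have \<tau>0: "\<tau>0 > 0" using nz by (simp add: \<tau>0_def)
  have main: "cmod (c m) * \<epsilon> ^ m * mu F m \<nu> * \<tau>0 \<le> C * (\<epsilon> * K) ^ Suc m" if \<epsilon>: "\<epsilon> > 0" "\<epsilon> * K \<le> 1" for \<epsilon>
  proof -
    define \<tau> where "\<tau> = (\<lambda>T. cis (\<kappa> * ln T) / (1 + \<i> * of_real \<kappa>))"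
    define P where "P = (\<lambda>t. \<Sum>l\<le>m. c l * of_real \<epsilon> ^ l * (H t * of_real (w t) ^ l))"
    have Pb: "bmeas P" unfolding P_def by (intro bmeas_sum bmeas_cmult bmeas_mult Hb bmeas_power wb)
    have avgP: "avg P T = (\<Sum>l\<le>m. c l * of_real \<epsilon> ^ l * avg (\<lambda>t. H t * of_real (w t) ^ l) T)" for T
      unfolding P_def by (subst avg_sum) (auto intro!: bmeas_cmult bmeas_mult Hb bmeas_power wb simp: avg_cmult)
    have "((\<lambda>T. \<Sum>l\<le>m. c l * of_real \<epsilon> ^ l * (avg (\<lambda>t. H t * of_real (w t) ^ l) T - of_real (mu F l \<nu>) * \<tau> T))
        \<longlongrightarrow> (\<Sum>l\<le>m. c l * of_real \<epsilon> ^ l * 0)) at_top"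
      using avg_cos_power[OF F(1), of \<kappa> \<nu>] unfolding H_def w_def \<tau>_def by (intro tendsto_intros)
    moreover have "(\<Sum>l\<le>m. c l * of_real \<epsilon> ^ l * (avg (\<lambda>t. H t * of_real (w t) ^ l) T - of_real (mu F l \<nu>) * \<tau> T))
        = avg P T - c m * of_real \<epsilon> ^ m * of_real (mu F m \<nu>) * \<tau> T" for T
    proof -
      have "(\<Sum>l\<le>m. c l * of_real \<epsilon> ^ l * (of_real (mu F l \<nu>) * \<tau> T)) = (\<Sum>l\<in>{m}. c l * of_real \<epsilon> ^ l * (of_real (mu F l \<nu>) * \<tau> T))"
      proof (intro sum.mono_neutral_right ballI)
        fix i assume "i \<in> {..m} - {m}"
        then have "i < m" by auto
        then show "c i * of_real \<epsilon> ^ i * (of_real (mu F i \<nu>) * \<tau> T) = 0" using least[of i] by auto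
      qed auto
      then show ?thesis by (simp add: avgP right_diff_distrib sum_subtractf mult.assoc)
    qed
    ultimately have l1: "((\<lambda>T. avg P T - c m * of_real \<epsilon> ^ m * of_real (mu F m \<nu>) * \<tau> T) \<longlongrightarrow> 0) at_top" by simp
    have l2: "(avg (\<lambda>t. H t * gauss_phase \<beta> (\<epsilon> * w t)) \<longlongrightarrow> 0) at_top"
      using null unfolding H_def w_def by blast
    have diff: "cmod (avg (\<lambda>t. H t * gauss_phase \<beta> (\<epsilon> * w t)) T - avg P T) \<le> C * (\<epsilon> * K) ^ Suc m" if "T > 0" for T
    proof -
      have "cmod (H t * gauss_phase \<beta> (\<epsilon> * w t) - P t) \<le> C * (\<epsilon> * K) ^ Suc m" for t
      proof -
        have ew: "\<bar>\<epsilon> * w t\<bar> \<le> \<epsilon> * K" using \<epsilon>(1) wK[of t] by (simp add: abs_mult)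
        have "H t * gauss_phase \<beta> (\<epsilon> * w t) - P t = H t * (gauss_phase \<beta> (\<epsilon> * w t) - (\<Sum>l\<le>m. c l * of_real (\<epsilon> * w t) ^ l))"
          by (simp add: P_def right_diff_distrib sum_distrib_left power_mult_distrib mult_ac)
        also have "cmod \<dots> = cmod (gauss_phase \<beta> (\<epsilon> * w t) - (\<Sum>l\<le>m. c l * of_real (\<epsilon> * w t) ^ l))"
          by (simp add: H_def norm_mult)
        also have "\<dots> \<le> C * \<bar>\<epsilon> * w t\<bar> ^ Suc m" using ew \<epsilon>(2) by (intro C) linarith
        also have "\<dots> \<le> C * (\<epsilon> * K) ^ Suc m" using ew C0 by (intro mult_left_mono power_mono) auto
        finally show ?thesis .
      qed
      then have "cmod (avg (\<lambda>t. H t * gauss_phase \<beta> (\<epsilon> * w t) - P t) T) \<le> C * (\<epsilon> * K) ^ Suc m"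
        by (intro norm_avg_le_const bmeas_diff bmeas_mult Hb gb Pb that)
      then show ?thesis using avg_diff[OF bmeas_mult[OF Hb gb] Pb] by simp
    qed
    have "((\<lambda>T. cmod (avg (\<lambda>t. H t * gauss_phase \<beta> (\<epsilon> * w t)) T)
        + cmod (avg P T - c m * of_real \<epsilon> ^ m * of_real (mu F m \<nu>) * \<tau> T) + C * (\<epsilon> * K) ^ Suc m)
        \<longlongrightarrow> cmod 0 + cmod 0 + C * (\<epsilon> * K) ^ Suc m) at_top"
      by (intro tendsto_intros l1 l2)
    then have "cmod (c m) * \<epsilon> ^ m * mu F m \<nu> * \<tau>0 \<le> cmod 0 + cmod 0 + C * (\<epsilon> * K) ^ Suc m"
    proof (rule tendsto_lowerbound)
      show "\<forall>\<^sub>F T in at_top. cmod (c m) * \<epsilon> ^ m * mu F m \<nu> * \<tau>0 \<le> cmod (avg (\<lambda>t. H t * gauss_phase \<beta> (\<epsilon> * w t)) T)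
        + cmod (avg P T - c m * of_real \<epsilon> ^ m * of_real (mu F m \<nu>) * \<tau> T) + C * (\<epsilon> * K) ^ Suc m"
        using eventually_gt_at_top[of 0]
      proof eventually_elim
        case (elim T)
        define a1 where "a1 = avg (\<lambda>t. H t * gauss_phase \<beta> (\<epsilon> * w t)) T"
        define a2 where "a2 = c m * of_real \<epsilon> ^ m * of_real (mu F m \<nu>) * \<tau> T"
        have "cmod a2 = cmod (c m) * \<epsilon> ^ m * mu F m \<nu> * \<tau>0"
          using \<epsilon>(1) mu_nonneg[of F m \<nu>] by (simp add: a2_def \<tau>_def \<tau>0_def norm_mult norm_divide norm_power)
        moreover have "a2 = a1 - (avg P T - a2) - (a1 - avg P T)" by simp
        then have "cmod a2 \<le> cmod a1 + cmod (avg P T - a2) + cmod (a1 - avg P T)"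
          by (metis (no_types, opaque_lifting) add_le_cancel_right norm_triangle_ineq4 order_trans)
        ultimately show ?case using diff[OF elim] unfolding a1_def a2_def by linarith
      qed
    qed simp
    then show ?thesis by simp
  qed
  define A where "A = cmod (c m) * mu F m \<nu> * \<tau>0"
  have A: "A > 0" using m \<tau>0 mu_nonneg[of F m \<nu>] by (auto simp: A_def)
  define D where "D = C * K ^ Suc m + 1"
  \<comment> \<open>Small enough for the remainder estimate, and for the remainder to be at most half of the leading term.\<close>
  define \<epsilon> where "\<epsilon> = min (1 / K) (A / (2 * D))"
  have D: "D > 0" "C * K ^ Suc m \<le> D" using C0 K by (auto simp: D_def intro: add_nonneg_pos)
  have "\<epsilon> \<le> 1 / K" by (simp add: \<epsilon>_def)
  then have \<epsilon>: "\<epsilon> * K \<le> 1" "\<epsilon> \<le> A / (2 * D)"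
    using K by (simp add: pos_le_divide_eq, simp add: \<epsilon>_def)
  have "A / (2 * D) > 0" using A D by simp
  then have \<epsilon>0: "\<epsilon> > 0" using K by (simp add: \<epsilon>_def)
  have "A * \<epsilon> ^ m \<le> (C * K ^ Suc m * \<epsilon>) * \<epsilon> ^ m"
    using main[OF \<epsilon>0 \<epsilon>(1)] by (simp add: A_def power_mult_distrib mult_ac)
  then have "A \<le> C * K ^ Suc m * \<epsilon>" using \<epsilon>0 by simp
  also have "\<dots> \<le> D * \<epsilon>" using \<epsilon>0 D by (intro mult_right_mono) auto
  also have "\<dots> \<le> D * (A / (2 * D))" using \<epsilon>(2) D by (intro mult_left_mono) auto
  also have "\<dots> = A / 2" using D by simp
  finally show False using A by simp
qed

lemma AE_affine_pullback:
  fixes L :: "'a::euclidean_space \<Rightarrow> 'a"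
  assumes L: "linear L" "bij L" and P: "AE x in lborel. P x"
  shows "AE g in lborel. P (x0 + L g)"
proof -
  have neg: "negligible {x. \<not> P x}"
    using P AE_completion_iff[of P lborel] eventually_ae_filter_negligible[of P] negligible_subset by blast
  obtain K where K: "linear K" "\<And>x. K (L x) = x"
    using linear_injective_left_inverse[OF L(1) bij_is_inj[OF L(2)]] by (auto simp: fun_eq_iff)
  have "negligible ((\<lambda>x. K (x - x0)) ` {x. \<not> P x})"
  proof (rule negligible_differentiable_image_negligible[OF _ neg])
    show "(\<lambda>x. K (x - x0)) differentiable_on {x. \<not> P x}"
      unfolding linear_diff[OF K(1)]
      by (intro differentiable_on_diff linear_imp_differentiable_on K(1) differentiable_on_const)
  qed simp
  moreover have "{g. \<not> P (x0 + L g)} \<subseteq> (\<lambda>x. K (x - x0)) ` {x. \<not> P x}"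
    using K(2) by (auto intro!: image_eqI[of _ _ "x0 + L _"])
  ultimately have "negligible {g. \<not> P (x0 + L g)}" by (rule negligible_subset)
  then have "AE g in lebesgue. P (x0 + L g)" using eventually_ae_filter_negligible by blast
  then show ?thesis by (simp add: AE_completion_iff)
qed

lemma integral_gauss_projection:
  fixes e :: "'a::euclidean_space"
  assumes e: "norm e = 1" and u: "u \<in> borel_measurable borel"
  shows "(LINT g|gauss_measure. cis (u (g \<bullet> e))) = (LINT x|lborel. std_normal_density x *\<^sub>R cis (u x))"
proof -
  have cm: "(\<lambda>x. cis (u x)) \<in> borel_measurable borel" using bmeas_cis[OF u] by (rule bmeas_measurable)
  have "(LINT g|gauss_measure. cis (u (g \<bullet> e))) = (LINT x|distr gauss_measure borel (\<lambda>g. g \<bullet> e). cis (u x))"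
    by (rule integral_distr[symmetric]) (use cm in measurable)
  also have "\<dots> = (LINT x|lborel. std_normal_density x *\<^sub>R cis (u x))"
    unfolding gauss_measure_projection[OF e]
    by (rule integral_density) (use cm in auto)
  finally show ?thesis .
qed

text \<open>The variable \<open>g \<bullet> v\<close> is Gaussian with standard deviation \<open>norm v\<close>. Scaling by \<open>s * norm v\<close> only shifts the phase.\<close>
lemma integral_gauss_phase:
  fixes p v :: "'a::euclidean_space"
  assumes s: "s > 0" and v: "v \<noteq> 0"
  shows "(LINT g|gauss_measure. cis (\<beta> * ln \<bar>s * (m + g \<bullet> v)\<bar>))
       = cis (\<beta> * ln s) * (cis (\<beta> * ln (norm v)) * gauss_phase \<beta> (m / norm v))"
proof -
  define e where "e = v /\<^sub>R norm v"
  have e: "norm e = 1" using v by (simp add: e_def)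
  have ve: "g \<bullet> v = norm v * (g \<bullet> e)" for g using v by (simp add: e_def)
  define k where "k = s * norm v"
  have k: "k > 0" using s v by (simp add: k_def)
  have "(LINT g|gauss_measure. cis (\<beta> * ln \<bar>s * (m + g \<bullet> v)\<bar>))
      = (LINT g|gauss_measure. cis (\<beta> * ln \<bar>k * (m / norm v + g \<bullet> e)\<bar>))"
    using v by (intro Bochner_Integration.integral_cong refl) (simp add: ve k_def distrib_left mult.assoc)
  also have "\<dots> = (LINT x|lborel. std_normal_density x *\<^sub>R cis (\<beta> * ln \<bar>k * (m / norm v + x)\<bar>))"
    by (rule integral_gauss_projection[OF e]) measurable
  also have "\<dots> = (LINT x|lborel. cis (\<beta> * ln k) * (std_normal_density x *\<^sub>R cis (\<beta> * ln \<bar>m / norm v + x\<bar>)))"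
  proof (rule integral_cong_AE)
    show "AE x in lborel. std_normal_density x *\<^sub>R cis (\<beta> * ln \<bar>k * (m / norm v + x)\<bar>)
       = cis (\<beta> * ln k) * (std_normal_density x *\<^sub>R cis (\<beta> * ln \<bar>m / norm v + x\<bar>))"
      using AE_lborel_singleton[of "- m / norm v"]
    proof eventually_elim
      case (elim x)
      then have "m / norm v + x \<noteq> 0" by auto
      then have "ln \<bar>k * (m / norm v + x)\<bar> = ln k + ln \<bar>m / norm v + x\<bar>" using k by (simp add: abs_mult ln_mult)
      then show ?case by (simp add: distrib_left cis_mult[symmetric])
    qed
    have "(\<lambda>x. cis (\<beta> * ln \<bar>k * (m / norm v + x)\<bar>)) \<in> borel_measurable borel"
      by (intro bmeas_measurable bmeas_cis) measurable
    then show "(\<lambda>x. std_normal_density x *\<^sub>R cis (\<beta> * ln \<bar>k * (m / norm v + x)\<bar>)) \<in> borel_measurable lborel" by measurable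
    show "(\<lambda>x. cis (\<beta> * ln k) * (std_normal_density x *\<^sub>R cis (\<beta> * ln \<bar>m / norm v + x\<bar>))) \<in> borel_measurable lborel"
      using phase_measurable[of \<beta> "m / norm v"] by measurable
  qed
  also have "\<dots> = cis (\<beta> * ln k) * gauss_phase \<beta> (m / norm v)"
    unfolding gauss_phase_def by (rule integral_mult_right_zero)
  also have "cis (\<beta> * ln k) = cis (\<beta> * ln s) * cis (\<beta> * ln (norm v))"
    using s v by (simp add: k_def ln_mult cis_mult distrib_left)
  finally show ?thesis by (simp add: mult.assoc)
qed

text \<open>Functionals are sampled as \<open>\<epsilon> c0 + L\<^sup>* g\<close> with a standard Gaussian \<open>g\<close> and the adjoint \<open>L\<^sup>*\<close> of \<open>L\<close>. The hypothesis on \<open>L\<close> says that the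
  sampled value at \<open>Q t\<close> has variance one for all \<open>t\<close>, so that its expected phase depends on \<open>t\<close> only through the
  mean \<open>\<epsilon> * w t\<close>. Fubini and dominated convergence interchange expectation, average and limit.\<close>
lemma resonant_imp_not_benford:
  fixes M Q R :: "real \<Rightarrow> 'a::euclidean_space" and L :: "'a \<Rightarrow> 'a"
  assumes b: "b \<ge> 2" and Mc: "continuous_on UNIV M"
    and M: "\<And>t. t > 0 \<Longrightarrow> M t = (exp (r * t) * t ^ k) *\<^sub>R (Q t + R t)"
    and R: "(R \<longlongrightarrow> 0) at_top"
    and L: "linear L" "bij L" "\<And>t. norm (L (Q t)) = 1"
    and F: "finite F" "F \<noteq> {}" and c0: "\<And>t. c0 \<bullet> Q t = (\<Sum>\<theta>\<in>F. cos (\<theta> * t))"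
    and res: "2 * pi / ln b * r \<in> rspan F"
  shows "\<not> (AE c in lborel. benford b (\<lambda>t. c \<bullet> M t))"
proof
  assume AE: "AE c in lborel. benford b (\<lambda>t. c \<bullet> M t)"
  obtain n K where n: "n \<ge> (1::nat)" "even K" "mu F K (real n * (2 * pi / ln b * r)) > 0"
    using rspan_mu[OF F res] by blast
  define \<beta> where "\<beta> = real n * (2 * pi / ln b)"
  have \<beta>: "\<beta> > 0" using n(1) b by (simp add: \<beta>_def)
  define w where "w = (\<lambda>t. \<Sum>\<theta>\<in>F. cos (\<theta> * t))"
  have "mu F K (\<beta> * r) > 0" using n(3) by (simp add: \<beta>_def mult.assoc)
  then obtain \<epsilon> where \<epsilon>: "\<not> (avg (\<lambda>t. cis (k * \<beta> * ln t) * cis (\<beta> * r * t) * gauss_phase \<beta> (\<epsilon> * w t)) \<longlongrightarrow> 0) at_top"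
    using gauss_phase_average_not_null[OF F \<beta> n(2)] unfolding w_def by blast
  define L' where "L' = adjoint L"
  have L': "linear L'" "g \<bullet> L x = L' g \<bullet> x" for g x
    unfolding L'_def using L(1) by (simp add: adjoint_linear, metis adjoint_works inner_commute)
  have "inj L'"
    unfolding linear_injective_0[OF L'(1)]
  proof (intro allI impI)
    fix g assume "L' g = 0"
    then have "g \<bullet> L x = 0" for x using L'(2) by simp
    moreover obtain x where "L x = g" using bij_is_surj[OF L(2)] by (metis surjD)
    ultimately show "g = 0" by (metis inner_eq_zero_iff)
  qed
  then have bijL': "bij L'" using L'(1) linear_injective_imp_surjective by (auto simp: bij_def)
  have Mm [measurable]: "M \<in> borel_measurable borel" using Mc by (rule borel_measurable_continuous_onI)
  define U where "U = (\<lambda>g t. cis (\<beta> * ln \<bar>(\<epsilon> *\<^sub>R c0 + L' g) \<bullet> M t\<bar>))"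
  have cL': "continuous_on UNIV L'" using L'(1) by (rule linear_continuous_on[OF linear_conv_bounded_linear[THEN iffD1]])
  have "(\<lambda>p. \<beta> * ln \<bar>(\<epsilon> *\<^sub>R c0 + L' (fst p)) \<bullet> M (snd p)\<bar>) \<in> borel_measurable (borel \<Otimes>\<^sub>M borel :: ('a \<times> real) measure)"
  proof -
    have "continuous_on UNIV (\<lambda>p::'a \<times> real. (\<epsilon> *\<^sub>R c0 + L' (fst p)) \<bullet> M (snd p))"
      by (intro continuous_intros continuous_on_compose2[OF cL'] continuous_on_compose2[OF Mc]) auto
    then have "(\<lambda>p::'a \<times> real. (\<epsilon> *\<^sub>R c0 + L' (fst p)) \<bullet> M (snd p)) \<in> borel_measurable borel"
      by (rule borel_measurable_continuous_onI)
    then have "(\<lambda>p::'a \<times> real. (\<epsilon> *\<^sub>R c0 + L' (fst p)) \<bullet> M (snd p)) \<in> borel_measurable (borel \<Otimes>\<^sub>M borel)"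
      by (simp add: borel_prod)
    then show ?thesis by measurable
  qed
  moreover have cism: "cis \<in> borel_measurable borel" by (intro borel_measurable_continuous_onI continuous_intros)
  ultimately have Upair: "(\<lambda>(g, t). U g t) \<in> borel_measurable (gauss_measure \<Otimes>\<^sub>M lborel)"
    unfolding U_def case_prod_beta
    by (subst measurable_cong_sets[OF sets_pair_measure_cong[OF sets_gauss_measure sets_lborel] refl])
       (rule measurable_compose)
  interpret G: prob_space "gauss_measure :: 'a measure" by (rule prob_space_gauss_measure)
  interpret P: pair_sigma_finite "gauss_measure :: 'a measure" "lborel :: real measure"
    by unfold_locales
  have Ub: "bmeas (U g)" for g
  proof -
    have "(\<lambda>t. (\<epsilon> *\<^sub>R c0 + L' g) \<bullet> M t) \<in> borel_measurable borel"
      by (intro borel_measurable_continuous_onI continuous_intros Mc)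
    then show ?thesis unfolding U_def by (intro bmeas_cis) measurable
  qed
  define E where "E = (\<lambda>t. LINT g|gauss_measure. U g t)"
  have Eb: "bmeas E"
  proof (rule bmeasI)
    have "(\<lambda>(t, g). U g t) \<in> borel_measurable (lborel \<Otimes>\<^sub>M gauss_measure)"
      using measurable_compose[OF measurable_pair_swap' Upair] by (simp add: case_prod_beta)
    then have "E \<in> borel_measurable lborel" unfolding E_def
      by (intro G.borel_measurable_lebesgue_integral)
    then show "E \<in> borel_measurable borel" by simp
    fix t
    have "cmod (E t) \<le> (LINT g|gauss_measure. norm (U g t))" unfolding E_def by (rule integral_norm_bound)
    also have "\<dots> = 1" by (simp add: U_def G.prob_space)
    finally show "cmod (E t) \<le> 1" .
  qed
  have avgE: "avg E T = (LINT g|gauss_measure. avg (U g) T)" for T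
  proof -
    have "(LINT t|lborel. LINT g|gauss_measure. indicator {0..T} t *\<^sub>R U g t)
        = (LINT g|gauss_measure. LINT t|lborel. indicator {0..T} t *\<^sub>R U g t)"
    proof (rule P.Fubini_integral)
      show "integrable (gauss_measure \<Otimes>\<^sub>M lborel) (\<lambda>(g, t). indicator {0..T} t *\<^sub>R U g t)"
      proof (rule integrableI_bounded_set[where A = "UNIV \<times> {0..T}" and B = 1])
        show "(UNIV :: 'a set) \<times> {0..T} \<in> sets (gauss_measure \<Otimes>\<^sub>M (lborel :: real measure))"
          using sets_gauss_measure by (intro pair_measureI) auto
        show "(\<lambda>(g, t). indicator {0..T} t *\<^sub>R U g t) \<in> borel_measurable (gauss_measure \<Otimes>\<^sub>M lborel)"
          using Upair by (simp add: case_prod_beta) measurable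
        have "emeasure (gauss_measure \<Otimes>\<^sub>M lborel) ((UNIV :: 'a set) \<times> {0..T}) = emeasure (gauss_measure :: 'a measure) UNIV * emeasure lborel {0..T}"
          using sets_gauss_measure by (intro lborel.emeasure_pair_measure_Times) auto
        also have "\<dots> < \<infinity>"
        proof -
          have "emeasure (gauss_measure :: 'a measure) UNIV < \<infinity>"
            unfolding infinity_ennreal_def by (rule top.not_eq_extremum[THEN iffD1]) (rule G.emeasure_finite)
          then show ?thesis by (auto simp: ennreal_mult_less_top emeasure_lborel_Icc_eq)
        qed
        finally show "emeasure (gauss_measure \<Otimes>\<^sub>M lborel) ((UNIV :: 'a set) \<times> {0..T}) < \<infinity>" .
      qed (auto simp: U_def indicator_def)
    qed
    then show ?thesis by (simp add: avg_def set_lebesgue_integral_def E_def)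
  qed
  have "AE g in lborel. benford b (\<lambda>t. (\<epsilon> *\<^sub>R c0 + L' g) \<bullet> M t)"
    by (rule AE_affine_pullback[OF L'(1) bijL' AE])
  then have "AE g in gauss_measure. benford b (\<lambda>t. (\<epsilon> *\<^sub>R c0 + L' g) \<bullet> M t)"
    by (rule AE_gauss_measure)
  then have AEU: "AE g in gauss_measure. (avg (U g) \<longlongrightarrow> 0) at_top"
  proof eventually_elim
    case (elim g)
    have "(\<lambda>t. (\<epsilon> *\<^sub>R c0 + L' g) \<bullet> M t) \<in> borel_measurable borel"
      by (intro borel_measurable_continuous_onI continuous_intros Mc)
    then show ?case using benford_imp_weyl[OF b _ elim n(1)] by (simp add: U_def \<beta>_def)
  qed
  have "((\<lambda>T. LINT g|gauss_measure. avg (U g) T) \<longlongrightarrow> (LINT g|(gauss_measure :: 'a measure). 0)) at_top"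
  proof (rule integral_dominated_convergence_at_top[where w = "\<lambda>_. 1"])
    show "(\<lambda>g. avg (U g) T) \<in> borel_measurable gauss_measure" for T
    proof -
      have "(\<lambda>(g, t). indicator {0..T} t *\<^sub>R U g t) \<in> borel_measurable (gauss_measure \<Otimes>\<^sub>M lborel)"
        using Upair by (simp add: case_prod_beta) measurable
      then have "(\<lambda>g. LINT t|lborel. indicator {0..T} t *\<^sub>R U g t) \<in> borel_measurable gauss_measure"
        by (intro lborel.borel_measurable_lebesgue_integral)
      then show ?thesis unfolding avg_def set_lebesgue_integral_def by measurable
    qed
    show "\<forall>\<^sub>F T in at_top. AE g in gauss_measure. norm (avg (U g) T) \<le> 1"
      using eventually_gt_at_top[of 0]
    proof eventually_elim
      case (elim T)
      show ?case by (intro AE_I2 norm_avg_le_const Ub elim) (simp add: U_def)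
    qed
  qed (use AEU in auto)
  moreover have "avg E = (\<lambda>T. LINT g|gauss_measure. avg (U g) T)" by (rule ext) (rule avgE)
  ultimately have avgE0: "(avg E \<longlongrightarrow> 0) at_top" by simp
  define X where "X = (\<lambda>t. cis (k * \<beta> * ln t) * cis (\<beta> * r * t) * gauss_phase \<beta> (\<epsilon> * w t))"
  have gm [measurable]: "gauss_phase \<beta> \<in> borel_measurable borel"
    by (intro borel_measurable_continuous_onI continuous_gauss_phase)
  have Xb: "bmeas X"
    unfolding X_def
  proof (intro bmeas_mult bmeas_cis)
    show "bmeas (\<lambda>t. gauss_phase \<beta> (\<epsilon> * w t))"
      by (rule bmeasI[of _ 1]) (auto simp: w_def norm_gauss_phase)
  qed measurable
  \<comment> \<open>The remainder \<open>R\<close> perturbs mean and standard deviation by quantities tending to zero, and the expected phase is uniformly continuous on bounded sets.\<close>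
  have "((\<lambda>t. X t - E t) \<longlongrightarrow> 0) at_top"
  proof -
    define v where "v = (\<lambda>t. norm (L (Q t + R t)))"
    have LR: "((\<lambda>t. L (R t)) \<longlongrightarrow> 0) at_top"
      using isCont_tendsto_compose[OF linear_continuous_at[OF linear_conv_bounded_linear[THEN iffD1, OF L(1)]] R] linear_0[OF L(1)] by simp
    have v1: "(v \<longlongrightarrow> 1) at_top"
    proof -
      have "((\<lambda>t. v t - 1) \<longlongrightarrow> 0) at_top"
      proof (rule Lim_null_comparison[OF _ tendsto_norm_zero[OF LR]])
        have "norm (v t - 1) \<le> norm (L (R t))" for t
          using norm_triangle_ineq3[of "L (Q t + R t)" "L (Q t)"] L(3)[of t]
          by (simp add: v_def linear_add[OF L(1)])
        then show "\<forall>\<^sub>F t in at_top. norm (v t - 1) \<le> norm (L (R t))" by simp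
      qed
      then show ?thesis by (simp add: LIM_zero_iff)
    qed
    define y where "y = (\<lambda>t. \<epsilon> * (c0 \<bullet> (Q t + R t)) / v t)"
    have wK: "\<bar>w t\<bar> \<le> card F" for t
    proof -
      have "\<bar>w t\<bar> \<le> (\<Sum>\<theta>\<in>F. \<bar>cos (\<theta> * t)\<bar>)" unfolding w_def by (rule sum_abs)
      also have "\<dots> \<le> real (card F) * 1" by (intro sum_bounded_above) auto
      finally show ?thesis by simp
    qed
    have ylim: "((\<lambda>t. y t - \<epsilon> * w t) \<longlongrightarrow> 0) at_top"
    proof -
      have "((\<lambda>t. \<epsilon> * (c0 \<bullet> R t) / v t + \<epsilon> * (w t * (1 / v t - 1))) \<longlongrightarrow> \<epsilon> * (c0 \<bullet> 0) / 1 + \<epsilon> * 0) at_top"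
      proof (intro tendsto_intros R v1)
        have "((\<lambda>t. real (card F) * \<bar>1 / v t - 1\<bar>) \<longlongrightarrow> real (card F) * \<bar>1 / 1 - 1\<bar>) at_top"
          by (intro tendsto_intros v1) auto
        then have *: "((\<lambda>t. real (card F) * \<bar>1 / v t - 1\<bar>) \<longlongrightarrow> 0) at_top" by simp
        show "((\<lambda>t. w t * (1 / v t - 1)) \<longlongrightarrow> 0) at_top"
          by (rule Lim_null_comparison[OF _ *])
             (use wK in \<open>auto simp: abs_mult intro!: always_eventually mult_right_mono\<close>)
      qed auto
      moreover have "\<epsilon> * (c0 \<bullet> R t) / v t + \<epsilon> * (w t * (1 / v t - 1)) = y t - \<epsilon> * w t" for t
        using c0[of t] by (simp add: y_def w_def inner_add_right algebra_simps add_divide_distrib)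
      ultimately show ?thesis by simp
    qed
    have E: "\<forall>\<^sub>F t in at_top. X t - E t = cis (k * \<beta> * ln t) * cis (\<beta> * r * t) *
        (gauss_phase \<beta> (\<epsilon> * w t) - cis (\<beta> * ln (v t)) * gauss_phase \<beta> (y t))"
    proof -
      have "\<forall>\<^sub>F t in at_top. v t > 0" using v1 by (rule order_tendstoD) simp
      then show ?thesis using eventually_gt_at_top[of 0]
      proof eventually_elim
        case (elim t)
        have s: "exp (r * t) * t ^ k > 0" using elim by simp
        have vz: "L (Q t + R t) \<noteq> 0" using elim by (auto simp: v_def)
        have "E t = (LINT g|gauss_measure. cis (\<beta> * ln \<bar>(exp (r * t) * t ^ k) * (\<epsilon> * (c0 \<bullet> (Q t + R t)) + g \<bullet> L (Q t + R t))\<bar>))"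
          unfolding E_def U_def M[OF elim(2)]
          by (intro Bochner_Integration.integral_cong refl) (simp add: inner_add_left L'(2))
        also have "\<dots> = cis (\<beta> * ln (exp (r * t) * t ^ k)) * (cis (\<beta> * ln (v t)) * gauss_phase \<beta> (y t))"
          unfolding v_def y_def by (rule integral_gauss_phase[OF s vz])
        also have "ln (exp (r * t) * t ^ k) = r * t + real k * ln t"
          using elim(2) by (simp add: ln_mult ln_realpow)
        also have "cis (\<beta> * (r * t + real k * ln t)) = cis (k * \<beta> * ln t) * cis (\<beta> * r * t)"
          by (simp add: cis_mult algebra_simps)
        finally show ?case by (simp add: X_def right_diff_distrib mult.assoc)
      qed
    qed
    have lnv: "((\<lambda>t. cis (\<beta> * ln (v t))) \<longlongrightarrow> cis (\<beta> * ln 1)) at_top"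
      by (intro isCont_tendsto_compose[OF isCont_cis] tendsto_intros v1) simp
    have gdiff: "((\<lambda>t. gauss_phase \<beta> (\<epsilon> * w t) - gauss_phase \<beta> (y t)) \<longlongrightarrow> 0) at_top"
    proof (rule tendstoI)
      fix e :: real assume e: "e > 0"
      define B where "B = \<bar>\<epsilon>\<bar> * card F"
      have "uniformly_continuous_on {-B-1..B+1} (gauss_phase \<beta>)"
        by (intro compact_uniformly_continuous continuous_gauss_phase) auto
      then obtain d where d: "d > 0" "\<And>x y. x \<in> {-B-1..B+1} \<Longrightarrow> y \<in> {-B-1..B+1} \<Longrightarrow> \<bar>x - y\<bar> < d \<Longrightarrow> cmod (gauss_phase \<beta> x - gauss_phase \<beta> y) < e"
        using e unfolding uniformly_continuous_on_def dist_norm real_norm_def by metis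
      have "\<forall>\<^sub>F t in at_top. dist (y t - \<epsilon> * w t) 0 < min d 1" using d by (intro tendstoD[OF ylim]) auto
      then show "\<forall>\<^sub>F t in at_top. dist (gauss_phase \<beta> (\<epsilon> * w t) - gauss_phase \<beta> (y t)) 0 < e"
      proof eventually_elim
        case (elim t)
        have "\<bar>\<epsilon> * w t\<bar> \<le> B" using wK[of t] by (simp add: B_def abs_mult mult_left_mono)
        then have "cmod (gauss_phase \<beta> (\<epsilon> * w t) - gauss_phase \<beta> (y t)) < e"
          using elim by (intro d(2)) (auto simp: dist_real_def abs_less_iff abs_le_iff)
        then show ?case by simp
      qed
    qed
    have "((\<lambda>t. cmod (gauss_phase \<beta> (\<epsilon> * w t) - gauss_phase \<beta> (y t)) + cmod (1 - cis (\<beta> * ln (v t))))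
        \<longlongrightarrow> cmod 0 + cmod (1 - cis (\<beta> * ln 1))) at_top"
      by (intro tendsto_intros gdiff lnv)
    then have lim: "((\<lambda>t. cmod (gauss_phase \<beta> (\<epsilon> * w t) - gauss_phase \<beta> (y t)) + cmod (1 - cis (\<beta> * ln (v t)))) \<longlongrightarrow> 0) at_top"
      by simp
    show ?thesis
    proof (rule Lim_null_comparison[OF _ lim])
      show "\<forall>\<^sub>F t in at_top. norm (X t - E t) \<le> cmod (gauss_phase \<beta> (\<epsilon> * w t) - gauss_phase \<beta> (y t)) + cmod (1 - cis (\<beta> * ln (v t)))"
        using E
      proof eventually_elim
        case (elim t)
        have "gauss_phase \<beta> (\<epsilon> * w t) - cis (\<beta> * ln (v t)) * gauss_phase \<beta> (y t)
          = (gauss_phase \<beta> (\<epsilon> * w t) - gauss_phase \<beta> (y t)) + (1 - cis (\<beta> * ln (v t))) * gauss_phase \<beta> (y t)"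
          by (simp add: algebra_simps)
        also have "cmod \<dots> \<le> cmod (gauss_phase \<beta> (\<epsilon> * w t) - gauss_phase \<beta> (y t)) + cmod (1 - cis (\<beta> * ln (v t))) * 1"
          by (intro norm_triangle_le add_left_mono, unfold norm_mult, intro mult_left_mono norm_gauss_phase) simp
        finally show ?case unfolding elim by (simp add: norm_mult)
      qed
    qed
  qed
  then have "((\<lambda>T. avg X T - avg E T) \<longlongrightarrow> 0) at_top" by (rule avg_diff_tendsto_0[OF Xb Eb])
  then have "(avg X \<longlongrightarrow> 0) at_top" using tendsto_add[OF _ avgE0] by fastforce
  then show False using \<epsilon> unfolding X_def by simp
qed

section \<open>Polynomials in a matrix and primary decomposition\<close>

text \<open>Horner evaluation with scalars embedded as multiples of the identity matrix. The generic \<open>poly\<close> does not apply, as the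
  type class product of matrices is not the matrix product.\<close>
definition mat_poly :: "complex^'n^'n \<Rightarrow> complex poly \<Rightarrow> complex^'n^'n" where
  "mat_poly A p = fold_coeffs (\<lambda>a M. mat a + A ** M) p 0"

lemma mat_mult_left: "mat a ** M = (\<chi> i j. a * M $ i $ j)" for M :: "'a::comm_semiring_1^'n^'n"
  by (simp add: vec_eq_iff matrix_matrix_mult_def mat_def if_distrib[of "\<lambda>x. x * _"] sum.delta cong: if_cong)

lemma mat_mult_right: "M ** mat a = (\<chi> i j. a * M $ i $ j)" for M :: "'a::comm_semiring_1^'n^'n"
  by (simp add: vec_eq_iff matrix_matrix_mult_def mat_def if_distrib[of "\<lambda>x. _ * x"] sum.delta mult.commute cong: if_cong)

lemma mat_commute: "M ** mat a = mat a ** M" for M :: "'a::comm_semiring_1^'n^'n"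
  by (simp add: mat_mult_left mat_mult_right)

lemma mat_left_commute: "A ** (mat c ** M) = mat c ** (A ** M)" for A M :: "'a::comm_semiring_1^'n^'n"
  unfolding matrix_mul_assoc mat_commute[of A c] ..

lemma mat_add: "mat (a + b) = mat a + (mat b :: 'a::comm_ring_1^'n^'n)"
  by (simp add: vec_eq_iff mat_def)

lemma mat_mult: "mat (a * b) = mat a ** (mat b :: 'a::comm_ring_1^'n^'n)"
  by (simp add: mat_mult_left vec_eq_iff) (simp add: mat_def)

lemma matrix_mult_zero [simp]: "(0 :: 'a::semiring_1^'n^'n) ** B = 0" "A ** (0 :: 'a::semiring_1^'n^'n) = 0"
  by (simp_all add: matrix_matrix_mult_def vec_eq_iff)

lemma matrix_add_rdistrib: "(A + B) ** C = A ** C + B ** (C :: 'a::semiring_1^'n^'n)"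
  by (simp add: matrix_matrix_mult_def vec_eq_iff distrib_right sum.distrib)

lemma matrix_minus: "(- A) ** C = - (A ** (C :: 'a::ring_1^'n^'n))" "A ** (- C) = - (A ** C)"
  by (simp_all add: matrix_matrix_mult_def vec_eq_iff sum_negf)

lemma matrix_sum_ldistrib: "A ** (\<Sum>i\<in>I. f i) = (\<Sum>i\<in>I. A ** f i)" for A :: "'a::semiring_1^'n^'n"
  by (induction I rule: infinite_finite_induct) (auto simp: matrix_add_ldistrib)

lemma matrix_sum_rdistrib: "(\<Sum>i\<in>I. f i) ** A = (\<Sum>i\<in>I. f i ** A)" for A :: "'a::semiring_1^'n^'n"
  by (induction I rule: infinite_finite_induct) (auto simp: matrix_add_rdistrib)

lemma matrix_eq_zero_iff: "M = 0 \<longleftrightarrow> (\<forall>w. M *v w = 0)" for M :: "'a::semiring_1^'n^'n"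
  by (metis matrix_eq matrix_vector_mult_0)

lemma mat_poly_0 [simp]: "mat_poly A 0 = 0"
  by (simp add: mat_poly_def)

lemma mat_poly_pCons: "mat_poly A (pCons a p) = mat a + A ** mat_poly A p"
  by (cases "a = 0 \<and> p = 0") (auto simp: mat_poly_def)

lemma mat_poly_add: "mat_poly A (p + q) = mat_poly A p + mat_poly A q"
  by (induction p q rule: poly_induct2) (simp_all add: mat_poly_pCons mat_add matrix_add_ldistrib add_ac)

lemma mat_poly_smult: "mat_poly A (smult c p) = mat c ** mat_poly A p"
proof (induction p)
  case (pCons a p)
  have "A ** (mat c ** mat_poly A p) = mat c ** (A ** mat_poly A p)"
    by (rule mat_left_commute)
  then show ?case by (simp add: mat_poly_pCons mat_mult matrix_add_ldistrib pCons)
qed simp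

lemma mat_poly_mult: "mat_poly A (p * q) = mat_poly A p ** mat_poly A q"
  by (induction p) (simp_all add: mat_poly_pCons mat_poly_add mat_poly_smult matrix_add_rdistrib matrix_mul_assoc)

lemma mat_poly_1 [simp]: "mat_poly A 1 = mat 1"
  by (simp add: one_pCons mat_poly_pCons)

lemma mat_poly_commute: "mat_poly A p ** mat_poly A q = mat_poly A q ** mat_poly A p"
  by (metis mat_poly_mult mult.commute)

lemma mat_poly_sum: "mat_poly A (\<Sum>i\<in>I. f i) = (\<Sum>i\<in>I. mat_poly A (f i))"
  by (induction I rule: infinite_finite_induct) (auto simp: mat_poly_add)

lemma mat_poly_power: "mat_poly A (p ^ k) = mat_power (mat_poly A p) k"
  by (induction k) (simp_all add: mat_poly_mult)

lemma mat_poly_monom: "mat_poly A (monom c k) = mat c ** mat_power A k"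
  by (induction k) (simp_all add: monom_0 monom_Suc mat_poly_pCons mat_left_commute)

abbreviation lin_pow :: "complex^'n^'n \<Rightarrow> complex \<Rightarrow> nat \<Rightarrow> complex^'n^'n" where
  "lin_pow A z k \<equiv> mat_power (A - mat z) k"

lemma lin_pow_poly: "lin_pow A z k = mat_poly A ([:- z, 1:] ^ k)" for A :: "complex^'n^'n"
proof -
  have "mat_poly A [:- z, 1:] = A - mat z"
  proof -
    have "mat (- z) = - (mat z :: complex^'n^'n)" by (simp add: vec_eq_iff mat_def)
    then show ?thesis by (simp add: mat_poly_pCons)
  qed
  then show ?thesis by (simp add: mat_poly_power)
qed

lemma mat_power_add: "mat_power A (j + k) = mat_power A j ** mat_power A k"
  by (induction j) (simp_all add: matrix_mul_assoc)

text \<open>Division with remainder gives the exponent one; multiplying the identities for \<open>k\<close> and one gives \<open>Suc k\<close>.\<close>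
lemma bezout_linear_power:
  fixes q :: "complex poly"
  assumes "poly q z \<noteq> 0" shows "\<exists>s t. s * [:- z, 1:] ^ k + t * q = 1"
proof (induction k)
  case 0
  show ?case by (intro exI[of _ 1] exI[of _ 0]) simp
next
  case (Suc k)
  then obtain s t where st: "s * [:- z, 1:] ^ k + t * q = 1" by blast
  define c where "c = inverse (poly q z)"
  have "[:- z, 1:] * synthetic_div q z + [:poly q z:] = q" by (rule synthetic_div_correct')
  then have "smult c q - smult c (synthetic_div q z) * [:- z, 1:] = [:c * poly q z:]"
    by (metis add_diff_cancel_left' mult.commute mult_smult_right smult_diff_right smult_pCons smult_0_right)
  then have one: "[:c:] * q - smult c (synthetic_div q z) * [:- z, 1:] = 1" using assms by (simp add: c_def one_pCons)
  define u where "u = - smult c (synthetic_div q z)"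
  have "(u * [:- z, 1:] + [:c:] * q) * (s * [:- z, 1:] ^ k + t * q) = 1"
    using one unfolding st u_def by (simp only: mult_minus_left mult_1_right add.commute diff_conv_add_uminus)
  then have "(u * s) * [:- z, 1:] ^ Suc k + (u * [:- z, 1:] * t + [:c:] * (s * [:- z, 1:] ^ k + t * q)) * q = 1"
    by (simp add: algebra_simps)
  then show ?case by blast
qed

lemma bezout_linear_powers:
  fixes z w :: complex
  assumes "z \<noteq> w" shows "\<exists>s t. s * [:- z, 1:] ^ k + t * [:- w, 1:] ^ m = 1"
  by (rule bezout_linear_power) (use assms in \<open>simp add: poly_power\<close>)

text \<open>A vector that is killed by two coprime polynomials in \<open>A\<close> is zero.\<close>
lemma bezout_annihilators:
  assumes st: "s * p + t * q = 1" and zero: "mat_poly A p *v w = 0" "mat_poly A q *v w = 0"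
  shows "w = 0"
proof -
  have "w = mat_poly A (s * p + t * q) *v w" unfolding st by simp
  also have "\<dots> = mat_poly A s *v (mat_poly A p *v w) + mat_poly A t *v (mat_poly A q *v w)"
    by (simp add: mat_poly_add mat_poly_mult matrix_vector_mult_add_rdistrib matrix_vector_mul_assoc)
  finally show ?thesis using zero by simp
qed

lemma lin_pow_annihilators:
  assumes "z \<noteq> w" "lin_pow A z k *v v = 0" "lin_pow A w m *v v = 0"
  shows "v = 0"
  using bezout_linear_powers[OF assms(1), of k m] bezout_annihilators[of _ "[:- z, 1:] ^ k" _ "[:- w, 1:] ^ m" A v]
    assms(2,3) by (auto simp: lin_pow_poly)

lemma lin_pow_annihilators_mat:
  fixes M :: "complex^'n^'n"
  assumes "z \<noteq> w" "lin_pow A z k ** M = 0" "lin_pow A w m ** M = 0"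
  shows "M = 0"
proof -
  have "M *v v = 0" for v
    by (rule lin_pow_annihilators[OF assms(1), of A k _ m]) (simp_all add: matrix_vector_mul_assoc assms)
  then show ?thesis unfolding matrix_eq_zero_iff by blast
qed

text \<open>Split off one root after the other: if \<open>p = (x - z)\<^sup>k q\<close> with \<open>q\<close> prime to \<open>x - z\<close>, then Bezout's identity writes \<open>M\<close> as the sum of a
  part that \<open>(A - z)\<^sup>k\<close> kills and a part that \<open>q\<close> kills, and induction applies to the latter. Stating it for an
  arbitrary \<open>M\<close> instead of the identity matrix is what makes the induction possible.\<close>
lemma primary_decomposition:
  fixes A M :: "complex^'n^'n"
  assumes "p \<noteq> 0" "mat_poly A p ** M = 0"
  shows "\<exists>q Z. finite Z \<and> M = (\<Sum>z\<in>Z. mat_poly A (q z) ** M) \<and>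
      (\<forall>z. \<exists>N. lin_pow A z N ** (mat_poly A (q z) ** M) = 0) \<and> (\<forall>z. z \<notin> Z \<longrightarrow> q z = 0)"
  using assms
proof (induction "degree p" arbitrary: p M rule: less_induct)
  case less
  show ?case
  proof (cases "degree p = 0")
    case True
    then obtain c where c: "p = [:c:]" "c \<noteq> 0" using less.prems(1) by (metis degree_eq_zeroE pCons_0_0)
    have "M = mat (inverse c * c) ** M" using c by simp
    also have "\<dots> = mat (inverse c) ** (mat_poly A p ** M)"
      by (simp only: mat_mult c(1) mat_poly_pCons) (simp add: matrix_mul_assoc)
    finally have "M = 0" using less.prems(2) by simp
    then show ?thesis by (intro exI[of _ "\<lambda>_. 0"] exI[of _ "{}"]) simp
  next
    case False
    then obtain z where z: "poly p z = 0" using alg_closed_imp_poly_has_root[of p] by auto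
    define k where "k = order z p"
    obtain q where q: "p = [:- z, 1:] ^ k * q" "\<not> [:- z, 1:] dvd q"
      using order_decomp[OF less.prems(1), of z] by (auto simp: k_def)
    have "k > 0" using z less.prems(1) order_root[of p z] by (auto simp: k_def)
    have "q \<noteq> 0" using q less.prems(1) by auto
    then have deg: "degree q < degree p" using q(1) \<open>k > 0\<close>
      by (simp add: degree_mult_eq degree_power_eq)
    obtain s t where st: "s * [:- z, 1:] ^ k + t * q = 1"
      using bezout_linear_power[of q z k] q(2) by (auto simp: poly_eq_0_iff_dvd)
    define M2 where "M2 = mat_poly A (s * [:- z, 1:] ^ k) ** M"
    have "mat_poly A q ** M2 = mat_poly A (q * (s * [:- z, 1:] ^ k)) ** M"
      by (simp add: M2_def mat_poly_mult matrix_mul_assoc)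
    also have "q * (s * [:- z, 1:] ^ k) = s * p" using q(1) by simp
    also have "mat_poly A (s * p) ** M = mat_poly A s ** (mat_poly A p ** M)" by (simp add: mat_poly_mult matrix_mul_assoc)
    finally have "mat_poly A q ** M2 = 0" using less.prems(2) by simp
    from less.hyps[OF deg \<open>q \<noteq> 0\<close> this] obtain q2 Z2 where IH: "finite Z2" "M2 = (\<Sum>z\<in>Z2. mat_poly A (q2 z) ** M2)"
      "\<And>z. \<exists>N. lin_pow A z N ** (mat_poly A (q2 z) ** M2) = 0" "\<And>z. z \<notin> Z2 \<Longrightarrow> q2 z = 0" by blast
    define Q where "Q = (\<lambda>w. q2 w * (s * [:- z, 1:] ^ k) + (if w = z then t * q else 0))"
    have QM: "mat_poly A (Q w) ** M = mat_poly A (q2 w) ** M2 + (if w = z then mat_poly A (t * q) ** M else 0)" for w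
      by (cases "w = z") (simp_all add: Q_def M2_def mat_poly_add mat_poly_mult matrix_add_rdistrib matrix_mul_assoc)
    have "(\<Sum>w\<in>insert z Z2. mat_poly A (Q w) ** M) = (\<Sum>w\<in>insert z Z2. mat_poly A (q2 w) ** M2) + mat_poly A (t * q) ** M"
      using IH(1) by (simp add: QM sum.distrib)
    also have "(\<Sum>w\<in>insert z Z2. mat_poly A (q2 w) ** M2) = M2"
      using IH by (cases "z \<in> Z2") (auto simp: insert_absorb)
    also have "M2 + mat_poly A (t * q) ** M = mat_poly A (s * [:- z, 1:] ^ k + t * q) ** M"
      by (simp add: M2_def mat_poly_add matrix_add_rdistrib)
    finally have sum: "M = (\<Sum>w\<in>insert z Z2. mat_poly A (Q w) ** M)" unfolding st by simp
    have kill: "\<exists>N. lin_pow A w N ** (mat_poly A (Q w) ** M) = 0" for w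
    proof -
      obtain N where N: "lin_pow A w N ** (mat_poly A (q2 w) ** M2) = 0" using IH(3) by blast
      have "lin_pow A w (k + N) ** (mat_poly A (q2 w) ** M2) = 0"
        using N by (simp add: mat_power_add flip: matrix_mul_assoc)
      moreover have "lin_pow A z (k + N) ** (mat_poly A (t * q) ** M) = 0"
      proof -
        have "lin_pow A z (k + N) ** (mat_poly A (t * q) ** M) = mat_poly A ([:- z, 1:] ^ (k + N) * (t * q)) ** M"
          by (simp add: lin_pow_poly mat_poly_mult matrix_mul_assoc)
        also have "[:- z, 1:] ^ (k + N) * (t * q) = ([:- z, 1:] ^ N * t) * p" by (simp add: q(1) power_add)
        also have "mat_poly A (([:- z, 1:] ^ N * t) * p) ** M = mat_poly A ([:- z, 1:] ^ N * t) ** (mat_poly A p ** M)"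
          by (simp only: mat_poly_mult matrix_mul_assoc)
        finally show ?thesis using less.prems(2) by simp
      qed
      ultimately have "lin_pow A w (k + N) ** (mat_poly A (Q w) ** M) = 0"
        by (simp add: QM matrix_add_ldistrib)
      then show ?thesis by blast
    qed
    show ?thesis
    proof (intro exI[of _ Q] exI[of _ "insert z Z2"] conjI allI impI)
      show "finite (insert z Z2)" using IH(1) by simp
      show "M = (\<Sum>z\<in>insert z Z2. mat_poly A (Q z) ** M)" by (rule sum)
      show "\<exists>N. lin_pow A w N ** (mat_poly A (Q w) ** M) = 0" for w by (rule kill)
      show "Q w = 0" if "w \<notin> insert z Z2" for w using that IH(4) by (auto simp: Q_def)
    qed
  qed
qed

lemma map_matrix_mult_hom:
  assumes "f 0 = 0" "\<And>x y. f (x + y) = f x + f y" "\<And>x y. f (x * y) = f x * f y"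
  shows "map_matrix f (A ** B) = map_matrix f A ** map_matrix f (B :: 'a::semiring_1^'n^'n)"
proof -
  have s: "f (sum g I) = (\<Sum>i\<in>I. f (g i))" for g :: "'n \<Rightarrow> 'a" and I
    by (induction I rule: infinite_finite_induct) (auto simp: assms)
  show ?thesis by (simp add: vec_eq_iff matrix_matrix_mult_def s assms(3))
qed

abbreviation cplx :: "real^'n^'n \<Rightarrow> complex^'n^'n" where
  "cplx A \<equiv> map_matrix complex_of_real A"

abbreviation cnj_mat :: "complex^'n^'n \<Rightarrow> complex^'n^'n" where
  "cnj_mat A \<equiv> map_matrix cnj A"

lemma cplx_mult: "cplx (A ** B) = cplx A ** cplx B"
  by (rule map_matrix_mult_hom) auto

lemma cnj_mat_mult: "cnj_mat (A ** B) = cnj_mat A ** cnj_mat B"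
  by (rule map_matrix_mult_hom) auto

lemma map_matrix_mat: "f 0 = 0 \<Longrightarrow> map_matrix f (mat a) = mat (f a)"
  by (simp add: vec_eq_iff mat_def)

lemma map_matrix_add: "(\<And>x y. f (x + y) = f x + f y) \<Longrightarrow> map_matrix f (A + B) = map_matrix f A + map_matrix f B"
  by (simp add: vec_eq_iff)

lemma map_matrix_diff: "(\<And>x y. f (x - y) = f x - f y) \<Longrightarrow> map_matrix f (A - B) = map_matrix f A - map_matrix f B"
  by (simp add: vec_eq_iff)

lemma cplx_mat_power: "cplx (mat_power A k) = mat_power (cplx A) k"
  by (induction k) (simp_all add: cplx_mult map_matrix_mat)

lemma cnj_mat_power: "cnj_mat (mat_power A k) = mat_power (cnj_mat A) k"
  by (induction k) (simp_all add: cnj_mat_mult map_matrix_mat)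

lemma cnj_mat_cplx: "cnj_mat (cplx A) = cplx A"
  by (simp add: vec_eq_iff)

lemma cnj_mat_cnj_mat: "cnj_mat (cnj_mat A) = A"
  by (simp add: vec_eq_iff)

lemma cnj_lin_pow: "cnj_mat (lin_pow (cplx A) z k) = lin_pow (cplx A) (cnj z) k"
  by (simp add: cnj_mat_power map_matrix_diff cnj_mat_cplx map_matrix_mat)

lemma cnj_mat_sum: "cnj_mat (\<Sum>i\<in>I. f i) = (\<Sum>i\<in>I. cnj_mat (f i))"
  by (simp add: vec_eq_iff)

text \<open>The powers of \<open>A\<close> are linearly dependent for reasons of dimension.\<close>
lemma annihilating_polynomial:
  fixes A :: "real^'n^'n"
  shows "\<exists>p. p \<noteq> 0 \<and> mat_poly (cplx A) p = 0"
proof -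
  define N where "N = DIM(real^'n^'n)"
  show ?thesis
  proof (cases "inj_on (mat_power A) {..N}")
    case False
    then obtain i j where ij: "i \<noteq> j" "mat_power A i = mat_power A j" by (auto simp: inj_on_def)
    define p :: "complex poly" where "p = monom 1 i + monom (-1) j"
    have "coeff p i = 1" using ij by (simp add: p_def)
    then have "p \<noteq> 0" by auto
    moreover have "mat_power (cplx A) i = mat_power (cplx A) j" using ij(2) by (simp flip: cplx_mat_power)
    then have "mat_poly (cplx A) p = mat (1 + -1) ** mat_power (cplx A) j"
      unfolding p_def mat_poly_add mat_poly_monom mat_add matrix_add_rdistrib by simp
    then have "mat_poly (cplx A) p = 0" by simp
    ultimately show ?thesis by blast
  next
    case True
    let ?S = "mat_power A ` {..N}"
    have "card ?S = N + 1" using card_image[OF True] by simp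
    then have "dependent ?S" by (intro dependent_biggerset) (auto simp: N_def)
    then obtain u v where u: "v \<in> ?S" "u v \<noteq> 0" "(\<Sum>v\<in>?S. u v *\<^sub>R v) = 0"
      by (subst (asm) dependent_finite) auto
    have sum0: "(\<Sum>i\<le>N. u (mat_power A i) *\<^sub>R mat_power A i) = 0"
      using u(3) by (subst (asm) sum.reindex[OF True]) simp
    define p where "p = (\<Sum>i\<le>N. monom (complex_of_real (u (mat_power A i))) i)"
    obtain i where i: "i \<le> N" "v = mat_power A i" using u(1) by auto
    have "coeff p i = of_real (u v)" using i by (simp add: p_def coeff_sum sum.delta)
    then have "p \<noteq> 0" using u(2) by auto
    moreover have "mat_poly (cplx A) p = cplx (\<Sum>i\<le>N. u (mat_power A i) *\<^sub>R mat_power A i)"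
      unfolding p_def mat_poly_sum mat_poly_monom
      by (simp add: vec_eq_iff mat_mult_left flip: cplx_mat_power)
    then have "mat_poly (cplx A) p = 0" unfolding sum0 by (simp add: vec_eq_iff)
    ultimately show ?thesis by blast
  qed
qed

text \<open>The spectral projections \<open>E z\<close> of a real matrix. The exponent \<open>N\<close> and the finite set \<open>Z\<close> are mere bounds: elements of \<open>Z\<close>
  outside the spectrum have \<open>E z = 0\<close>.\<close>
locale spectral_resolution =
  fixes A :: "real^'n^'n" and E :: "complex \<Rightarrow> complex^'n^'n" and Z :: "complex set" and N :: nat
  assumes finite_Z: "finite Z"
    and sum_E: "(\<Sum>z\<in>Z. E z) = mat 1"
    and nilpotent_E: "lin_pow (cplx A) z N ** E z = 0"
    and commute_E: "cplx A ** E z = E z ** cplx A"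
    and cnj_E: "cnj_mat (E z) = E (cnj z)"
    and outside_E: "z \<notin> Z \<Longrightarrow> E z = 0"

section \<open>Spectral resolutions and ranks of powers\<close>

text \<open>Take the primary decomposition of the identity. Averaging it with its complex conjugate makes it compatible with
  conjugation without affecting the other properties.\<close>
lemma spectral_resolution_exists:
  fixes A :: "real^'n^'n"
  shows "\<exists>E Z N. spectral_resolution A E Z N"
proof -
  obtain p where p: "p \<noteq> 0" "mat_poly (cplx A) p = 0" using annihilating_polynomial by blast
  then have "mat_poly (cplx A) p ** mat 1 = 0" by simp
  from primary_decomposition[OF p(1) this]
  obtain q Z where q: "finite Z \<and> mat 1 = (\<Sum>z\<in>Z. mat_poly (cplx A) (q z)) \<and>
      (\<forall>z. \<exists>N. lin_pow (cplx A) z N ** mat_poly (cplx A) (q z) = 0) \<and> (\<forall>z. z \<notin> Z \<longrightarrow> q z = 0)"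
    unfolding matrix_mul_rid by (elim exE)
  define E0 where "E0 = (\<lambda>z. mat_poly (cplx A) (q z))"
  have "\<forall>z. \<exists>N. lin_pow (cplx A) z N ** E0 z = 0" using q unfolding E0_def by (elim conjE)
  then obtain n where "\<forall>z. lin_pow (cplx A) z (n z) ** E0 z = 0" using choice[of "\<lambda>z N. lin_pow (cplx A) z N ** E0 z = 0"] by (elim exE meta_impE)
  then have n: "lin_pow (cplx A) z (n z) ** E0 z = 0" for z by (rule spec)
  have Z: "finite Z" "mat 1 = (\<Sum>z\<in>Z. E0 z)"
    using q[THEN conjunct1] q[THEN conjunct2, THEN conjunct1] unfolding E0_def .
  define Z' where "Z' = Z \<union> cnj ` Z"
  define N where "N = (\<Sum>z\<in>Z'. n z)"
  have fin: "finite Z'" using Z(1) by (simp add: Z'_def)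
  have out: "E0 z = 0" if "z \<notin> Z" for z using q that unfolding E0_def by simp
  have nil0: "lin_pow (cplx A) z N ** E0 z = 0" for z
  proof (cases "z \<in> Z'")
    case True
    then have "N = (N - n z) + n z" using member_le_sum[of z Z' n] fin by (simp add: N_def)
    then have "lin_pow (cplx A) z N = lin_pow (cplx A) z (N - n z) ** lin_pow (cplx A) z (n z)"
      using mat_power_add by metis
    then show ?thesis using n[of z] by (simp flip: matrix_mul_assoc)
  qed (use out in \<open>simp add: Z'_def\<close>)
  have comm0: "cplx A ** E0 z = E0 z ** cplx A" for z
    using mat_poly_commute[of "cplx A" "[:0, 1:]" "q z"] by (simp add: E0_def mat_poly_pCons)
  have sum0: "(\<Sum>z\<in>Z'. E0 z) = mat 1"
  proof -
    have "(\<Sum>z\<in>Z'. E0 z) = (\<Sum>z\<in>Z. E0 z)"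
      by (rule sum.mono_neutral_right[OF fin]) (use out in \<open>auto simp: Z'_def\<close>)
    then show ?thesis unfolding Z(2) .
  qed
  define E where "E = (\<lambda>z. mat (1/2) ** (E0 z + cnj_mat (E0 (cnj z))))"
  have cnj_out: "cnj z \<notin> Z'" if "z \<notin> Z'" for z using that by (force simp: Z'_def image_iff)
  have "spectral_resolution A E Z' N"
  proof
    show "finite Z'" by (rule fin)
    have "bij_betw cnj Z' Z'"
      by (rule bij_betw_byWitness[where f' = cnj]) (auto simp: Z'_def)
    then have "(\<Sum>z\<in>Z'. cnj_mat (E0 (cnj z))) = (\<Sum>z\<in>Z'. cnj_mat (E0 z))" by (rule sum.reindex_bij_betw)
    also have "\<dots> = mat 1" by (simp add: sum0 map_matrix_mat flip: cnj_mat_sum)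
    finally have "(\<Sum>z\<in>Z'. E z) = mat (1/2) ** (mat 1 + mat 1)"
      by (simp add: E_def sum0 sum.distrib flip: matrix_sum_ldistrib)
    also have "\<dots> = mat (1/2 * (1 + 1))" unfolding mat_mult[of "1/2" "1 + 1"] mat_add ..
    finally show "(\<Sum>z\<in>Z'. E z) = mat 1" by simp
    fix z
    have "lin_pow (cplx A) z N ** cnj_mat (E0 (cnj z)) = cnj_mat (lin_pow (cplx A) (cnj z) N ** E0 (cnj z))"
      by (simp add: cnj_mat_mult cnj_lin_pow)
    also have "\<dots> = 0" by (simp add: nil0 vec_eq_iff)
    finally have "lin_pow (cplx A) z N ** (E0 z + cnj_mat (E0 (cnj z))) = 0" by (simp add: nil0 matrix_add_ldistrib)
    then show "lin_pow (cplx A) z N ** E z = 0"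
      unfolding E_def mat_left_commute by simp
    have "cplx A ** cnj_mat (E0 (cnj z)) = cnj_mat (cplx A ** E0 (cnj z))" by (simp add: cnj_mat_mult cnj_mat_cplx)
    also have "\<dots> = cnj_mat (E0 (cnj z)) ** cplx A" by (simp add: comm0 cnj_mat_mult cnj_mat_cplx)
    finally have "cplx A ** (E0 z + cnj_mat (E0 (cnj z))) = (E0 z + cnj_mat (E0 (cnj z))) ** cplx A"
      by (simp add: comm0 matrix_add_ldistrib matrix_add_rdistrib)
    then show "cplx A ** E z = E z ** cplx A"
      unfolding E_def mat_left_commute by (simp add: matrix_mul_assoc)
    show "cnj_mat (E z) = E (cnj z)"
      by (simp add: E_def cnj_mat_mult map_matrix_mat map_matrix_add cnj_mat_cnj_mat add.commute)
    show "E z = 0" if "z \<notin> Z'"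
    proof -
      have "z \<notin> Z" "cnj z \<notin> Z" using that cnj_out[OF that] by (auto simp: Z'_def)
      then show ?thesis using out by (simp add: E_def vec_eq_iff mat_mult_left)
    qed
  qed
  then show ?thesis by blast
qed

lemma matrix_diff_ldistrib: "A ** (B - C) = A ** B - A ** (C :: 'a::ring_1^'n^'n)"
  by (simp add: matrix_matrix_mult_def vec_eq_iff right_diff_distrib sum_subtractf)

lemma matrix_diff_rdistrib: "(A - B) ** C = A ** C - B ** (C :: 'a::ring_1^'n^'n)"
  by (simp add: matrix_matrix_mult_def vec_eq_iff left_diff_distrib sum_subtractf)

text \<open>The kernel is the orthogonal complement of the row space.\<close>
lemma rank_nullity: "dim {x. B *v x = 0} + rank B = CARD('n)" for B :: "real^'n^'n"
proof -
  have "{x. B *v x = 0} = {y \<in> UNIV. \<forall>x \<in> span (rows B). orthogonal x y}"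
  proof (intro set_eqI iffI)
    fix y assume y: "y \<in> {x. B *v x = 0}"
    have "orthogonal x y" if "x \<in> span (rows B)" for x
    proof -
      have "orthogonal y x"
        using that
      proof (rule orthogonal_to_span)
        fix x assume "x \<in> rows B"
        then obtain i where "x = row i B" by (auto simp: rows_def)
        moreover have "(B *v y) $ i = 0" using y by simp
        ultimately show "orthogonal y x" by (simp add: matrix_mult_dot orthogonal_def row_def inner_commute)
      qed
      then show ?thesis by (simp add: orthogonal_commute)
    qed
    then show "y \<in> {y \<in> UNIV. \<forall>x \<in> span (rows B). orthogonal x y}" by simp
  next
    fix y assume y: "y \<in> {y \<in> UNIV. \<forall>x \<in> span (rows B). orthogonal x y}"
    have "(B *v y) $ i = 0" for i
    proof -
      have "row i B \<in> span (rows B)" by (intro span_base) (auto simp: rows_def)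
      then show ?thesis using y by (auto simp: matrix_mult_dot orthogonal_def row_def)
    qed
    then show "y \<in> {x. B *v x = 0}" by (simp add: vec_eq_iff)
  qed
  then have "dim {x. B *v x = 0} + dim (span (rows B)) = dim (UNIV :: (real^'n) set)"
    using dim_subspace_orthogonal_to_vectors[of "span (rows B)" UNIV] by simp
  then show ?thesis by (simp add: row_rank_def)
qed

text \<open>Kernels of successive powers are nested, so the rank drops exactly if the kernel grows.\<close>
lemma rank_power_less_iff:
  fixes B :: "real^'n^'n"
  shows "rank (mat_power B (Suc k)) < rank (mat_power B k) \<longleftrightarrow>
    (\<exists>v. mat_power B (Suc k) *v v = 0 \<and> mat_power B k *v v \<noteq> 0)"
proof -
  let ?K = "\<lambda>k. {x. mat_power B k *v x = 0}"
  have sub: "?K k \<subseteq> ?K (Suc k)" by (auto simp flip: matrix_vector_mul_assoc)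
  have sp: "subspace (?K k)" for k
    by (auto simp: subspace_def matrix_vector_right_distrib matrix_vector_mult_scaleR)
  have "rank (mat_power B (Suc k)) < rank (mat_power B k) \<longleftrightarrow> dim (?K k) < dim (?K (Suc k))"
    using rank_nullity[of "mat_power B k"] rank_nullity[of "mat_power B (Suc k)"] by linarith
  also have "\<dots> \<longleftrightarrow> \<not> (?K (Suc k) \<subseteq> ?K k)"
  proof
    assume "dim (?K k) < dim (?K (Suc k))"
    then show "\<not> (?K (Suc k) \<subseteq> ?K k)" using dim_subset[of "?K (Suc k)" "?K k"] by linarith
  next
    assume n: "\<not> (?K (Suc k) \<subseteq> ?K k)"
    show "dim (?K k) < dim (?K (Suc k))"
    proof (rule ccontr)
      assume "\<not> dim (?K k) < dim (?K (Suc k))"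
      then have "?K k = ?K (Suc k)" using sub by (intro subspace_dim_equal sp) auto
      then show False using n by blast
    qed
  qed
  finally show ?thesis by blast
qed

definition Re_vec :: "complex^'n \<Rightarrow> real^'n" where "Re_vec w = (\<chi> i. Re (w $ i))"
definition Im_vec :: "complex^'n \<Rightarrow> real^'n" where "Im_vec w = (\<chi> i. Im (w $ i))"

lemma cplx_mult_vec_eq_0_iff: "cplx B *v w = 0 \<longleftrightarrow> B *v Re_vec w = 0 \<and> B *v Im_vec w = 0"
  by (auto simp: vec_eq_iff matrix_vector_mult_def Re_vec_def Im_vec_def complex_eq_iff)

text \<open>Real and imaginary parts transfer kernel vectors between the real and the complex space.\<close>
lemma complex_kernel_iff:
  "(\<exists>v. C *v v = 0 \<and> B *v v \<noteq> 0) \<longleftrightarrow> (\<exists>w. cplx C *v w = 0 \<and> cplx B *v w \<noteq> 0)" (is "?L \<longleftrightarrow> ?R")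
proof
  assume ?L
  then obtain v where v: "C *v v = 0" "B *v v \<noteq> 0" by blast
  define w where "w = (\<chi> i. complex_of_real (v $ i))"
  have "Re_vec w = v" "Im_vec w = 0" by (simp_all add: w_def Re_vec_def Im_vec_def vec_eq_iff)
  then show ?R using v by (intro exI[of _ w]) (simp add: cplx_mult_vec_eq_0_iff)
next
  assume ?R then show ?L unfolding cplx_mult_vec_eq_0_iff by blast
qed

context spectral_resolution
begin

abbreviation "lp \<equiv> lin_pow (cplx A)"

lemma lp_commute: "lp z k ** lp w m = lp w m ** lp z k"
  unfolding lin_pow_poly by (rule mat_poly_commute)

lemma lp_E_commute: "lp z k ** E w = E w ** lp z k"
proof (induction k)
  case (Suc k)
  have "(cplx A - mat z) ** E w = E w ** (cplx A - mat z)"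
    using commute_E[of w] mat_commute[of "E w" z]
    by (simp only: matrix_diff_ldistrib matrix_diff_rdistrib)
  then have "(cplx A - mat z) ** (lp z k ** E w) = E w ** ((cplx A - mat z) ** lp z k)"
    by (simp add: Suc matrix_mul_assoc)
  then show ?case by (simp add: matrix_mul_assoc)
qed simp

lemma lp_zero_mono: "lp z k ** M = 0 \<Longrightarrow> k \<le> m \<Longrightarrow> lp z m ** M = 0"
  using mat_power_add[of "cplx A - mat z" "m - k" k] by (simp flip: matrix_mul_assoc)

lemma E_orthogonal: assumes "z \<noteq> w" shows "E z ** E w = 0"
proof (rule lin_pow_annihilators_mat[OF assms])
  show "lp z N ** (E z ** E w) = 0" by (simp add: matrix_mul_assoc nilpotent_E)
  show "lp w N ** (E z ** E w) = 0"
    by (metis lp_E_commute matrix_mul_assoc matrix_mult_zero(2) nilpotent_E)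
qed

lemma E_idempotent: "E z ** E z = E z"
proof (cases "z \<in> Z")
  case True
  have "E z = E z ** (\<Sum>w\<in>Z. E w)" by (simp add: sum_E)
  also have "\<dots> = (\<Sum>w\<in>Z. E z ** E w)" by (rule matrix_sum_ldistrib)
  also have "\<dots> = (\<Sum>w\<in>{z}. E z ** E w)"
    using True finite_Z by (intro sum.mono_neutral_right ballI E_orthogonal) auto
  finally show ?thesis by simp
qed (simp add: outside_E)

text \<open>The term with \<open>t\<^sup>k exp (t * z)\<close> occurs in the exponential of \<open>t * A\<close> exactly for active pairs.\<close>
definition active :: "complex \<Rightarrow> nat \<Rightarrow> bool" where
  "active z k \<longleftrightarrow> lp z k ** E z \<noteq> 0"

lemma active_less: "active z k \<Longrightarrow> k < N"
  unfolding active_def using lp_zero_mono[OF nilpotent_E] not_le by blast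

lemma active_mono: "active z m \<Longrightarrow> k \<le> m \<Longrightarrow> active z k"
  unfolding active_def using lp_zero_mono by blast

lemma active_cnj: "active (cnj z) k \<longleftrightarrow> active z k"
proof -
  have "lp (cnj z) k ** E (cnj z) = cnj_mat (lp z k ** E z)"
    by (simp add: cnj_mat_mult cnj_lin_pow cnj_E)
  moreover have "cnj_mat M = 0 \<longleftrightarrow> M = 0" for M by (simp add: vec_eq_iff)
  ultimately show ?thesis by (simp add: active_def)
qed

lemma active_imp_vector: assumes "active z k" shows "\<exists>w. lp z (Suc k) *v w = 0 \<and> lp z k *v w \<noteq> 0"
proof -
  define m where "m = (LEAST m. lp z m ** E z = 0)"
  have m: "lp z m ** E z = 0" unfolding m_def by (rule LeastI[of "\<lambda>m. lp z m ** E z = 0", OF nilpotent_E])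
  have "k < m" using assms lp_zero_mono[OF m, of k] unfolding active_def by (meson not_le)
  then have "lp z (m - 1) ** E z \<noteq> 0" using not_less_Least[of "m - 1" "\<lambda>m. lp z m ** E z = 0"] by (auto simp: m_def)
  then obtain x where x: "lp z (m - 1) *v (E z *v x) \<noteq> 0"
    by (auto simp: matrix_eq_zero_iff matrix_vector_mul_assoc)
  define w where "w = lp z (m - 1 - k) *v (E z *v x)"
  have "lp z (Suc k) *v w = (lp z m ** E z) *v x"
    using \<open>k < m\<close> mat_power_add[of "cplx A - mat z" "Suc k" "m - 1 - k"]
    by (simp add: w_def matrix_vector_mul_assoc matrix_mul_assoc)
  moreover have "lp z k *v w = lp z (m - 1) *v (E z *v x)"
    using \<open>k < m\<close> mat_power_add[of "cplx A - mat z" k "m - 1 - k"]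
    by (simp add: w_def matrix_vector_mul_assoc matrix_mul_assoc)
  ultimately show ?thesis using m x by (intro exI[of _ w]) simp
qed

lemma resolve_vector: "w = (\<Sum>z\<in>Z. E z *v w)"
proof -
  have "w = (\<Sum>z\<in>Z. E z) *v w" by (simp add: sum_E)
  also have "\<dots> = (\<Sum>z\<in>Z. E z *v w)"
    by (induction Z rule: infinite_finite_induct) (auto simp: matrix_vector_mult_add_rdistrib)
  finally show ?thesis .
qed

lemma vector_imp_active: assumes "lp z (Suc k) *v w = 0" "lp z k *v w \<noteq> 0" shows "active z k"
proof -
  have "E z' *v w = 0" if "z' \<noteq> z" for z'
  proof (rule lin_pow_annihilators[OF that])
    show "lp z' N *v (E z' *v w) = 0" by (simp add: matrix_vector_mul_assoc nilpotent_E)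
    show "lp z (Suc k) *v (E z' *v w) = 0"
      by (metis assms(1) lp_E_commute matrix_vector_mul_assoc matrix_vector_mult_0_right)
  qed
  then have "w = (\<Sum>z'\<in>Z \<inter> {z}. E z' *v w)"
    using finite_Z by (subst resolve_vector, intro sum.mono_neutral_right) auto
  moreover have "w \<noteq> 0" using assms(2) by auto
  ultimately have "w = E z *v w" by (cases "z \<in> Z") auto
  then have "(lp z k ** E z) *v w \<noteq> 0" using assms(2) by (metis matrix_vector_mul_assoc)
  then show ?thesis unfolding active_def by auto
qed

lemma active_iff: "active z k \<longleftrightarrow> (\<exists>w. lp z (Suc k) *v w = 0 \<and> lp z k *v w \<noteq> 0)"
  using active_imp_vector vector_imp_active by blast

lemma spectrum_iff: "z \<in> spectrum A \<longleftrightarrow> active z 0"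
proof -
  have "(cplx A - mat z) *v v = 0 \<longleftrightarrow> cplx A *v v = z *s v" for v
  proof -
    have "mat z *v v = z *s v" by (simp add: vec_eq_iff matrix_vector_mult_def mat_def if_distrib[of "\<lambda>x. x * _"] sum.delta cong: if_cong)
    then show ?thesis by (simp add: matrix_vector_mult_diff_rdistrib)
  qed
  then show ?thesis by (auto simp: spectrum_def active_iff)
qed

lemma spec_matrix_power:
  assumes "z \<notin> \<real>" shows "cplx (mat_power (spec_matrix A z) k) = lp z k ** lp (cnj z) k"
proof -
  have eq: "cplx (spec_matrix A z) = (cplx A - mat z) ** (cplx A - mat (cnj z))"
  proof -
    have "(cplx A - mat z) ** (cplx A - mat (cnj z)) = cplx A ** cplx A - mat (z + cnj z) ** cplx A + mat (z * cnj z)"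
      by (simp add: matrix_diff_ldistrib matrix_diff_rdistrib mat_commute[of "cplx A"] mat_add mat_mult matrix_add_rdistrib algebra_simps)
    also have "z + cnj z = of_real (2 * Re z)" by (rule complex_add_cnj)
    also have "z * cnj z = of_real ((cmod z)\<^sup>2)" by (simp only: complex_norm_square)
    also have "cplx A ** cplx A - mat (of_real (2 * Re z)) ** cplx A + mat (of_real ((cmod z)\<^sup>2)) = cplx (spec_matrix A z)"
    proof -
      have "spec_matrix A z = A ** A - (2 * Re z) *\<^sub>R A + (cmod z)\<^sup>2 *\<^sub>R mat 1"
        using assms by (simp add: spec_matrix_def)
      then show ?thesis by (simp only: vec_eq_iff mat_mult_left cplx_mult[symmetric] nth_map_matrix
          vector_add_component vector_minus_component vector_scaleR_component) (simp add: mat_def)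
    qed
    finally show ?thesis by (rule sym)
  qed
  have c: "(cplx A - mat z) ** (cplx A - mat (cnj z)) = (cplx A - mat (cnj z)) ** (cplx A - mat z)"
    using lp_commute[of z 1 "cnj z" 1] by simp
  show ?thesis
  proof (induction k)
    case (Suc k)
    have "lp (cnj z) (Suc 0) ** lp z k = lp z k ** lp (cnj z) (Suc 0)" by (rule lp_commute)
    then have s: "(cplx A - mat (cnj z)) ** lp z k = lp z k ** (cplx A - mat (cnj z))" by simp
    have "cplx (mat_power (spec_matrix A z) (Suc k)) = (cplx A - mat z) ** ((cplx A - mat (cnj z)) ** lp z k) ** lp (cnj z) k"
      by (simp add: cplx_mult eq Suc matrix_mul_assoc)
    also have "\<dots> = lp z (Suc k) ** lp (cnj z) (Suc k)" unfolding s by (simp add: matrix_mul_assoc)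
    finally show ?case .
  qed (simp add: map_matrix_mat)
qed

lemma spec_matrix_real:
  assumes "z \<in> \<real>" shows "cplx (mat_power (spec_matrix A z) k) = lp z k"
proof -
  have "cplx (A - Re z *\<^sub>R mat 1) = cplx A - mat z"
    using assms by (auto simp: vec_eq_iff mat_def complex_is_Real_iff complex_eq_iff)
  then show ?thesis using assms by (simp add: cplx_mat_power spec_matrix_def)
qed

text \<open>Identifies the index that is defined through ranks. For nonreal \<open>z\<close> the quadratic polynomial is the product of
  \<open>A - z\<close> and \<open>A - cnj z\<close>. One direction uses that the two factors have no common kernel vector; for the other, the
  kernels at \<open>z\<close> and at \<open>cnj z\<close> stop growing together.\<close>
lemma rank_drop_iff_active:
  "rank (mat_power (spec_matrix A z) (Suc k)) < rank (mat_power (spec_matrix A z) k) \<longleftrightarrow> active z k"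
proof (cases "z \<in> \<real>")
  case True
  show ?thesis unfolding rank_power_less_iff complex_kernel_iff spec_matrix_real[OF True] active_iff by (rule refl)
next
  case False
  then have ne: "z \<noteq> cnj z" by (auto simp: complex_eq_iff complex_is_Real_iff)
  show ?thesis
    unfolding rank_power_less_iff complex_kernel_iff spec_matrix_power[OF False]
  proof
    assume "active z k"
    then obtain w where w: "lp z (Suc k) *v w = 0" "lp z k *v w \<noteq> 0" unfolding active_iff by blast
    have "(lp z (Suc k) ** lp (cnj z) (Suc k)) *v w = 0"
      unfolding lp_commute[of z "Suc k"] using w(1) by (simp flip: matrix_vector_mul_assoc del: mat_power.simps)
    moreover have "(lp z k ** lp (cnj z) k) *v w \<noteq> 0"
    proof
      assume "(lp z k ** lp (cnj z) k) *v w = 0"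
      then have "lp (cnj z) k *v (lp z k *v w) = 0" unfolding lp_commute[of z k] by (simp flip: matrix_vector_mul_assoc)
      moreover have "lp z 1 *v (lp z k *v w) = 0" using w(1) by (simp add: matrix_vector_mul_assoc)
      ultimately have "lp z k *v w = 0" using lin_pow_annihilators[OF ne, of "cplx A" 1 "lp z k *v w" k] by blast
      then show False using w(2) by simp
    qed
    ultimately show "\<exists>w. (lp z (Suc k) ** lp (cnj z) (Suc k)) *v w = 0 \<and> (lp z k ** lp (cnj z) k) *v w \<noteq> 0" by blast
  next
    assume "\<exists>w. (lp z (Suc k) ** lp (cnj z) (Suc k)) *v w = 0 \<and> (lp z k ** lp (cnj z) k) *v w \<noteq> 0"
    then obtain w where w: "(lp z (Suc k) ** lp (cnj z) (Suc k)) *v w = 0" "(lp z k ** lp (cnj z) k) *v w \<noteq> 0" by blast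
    show "active z k"
    proof (rule ccontr)
      assume na: "\<not> active z k"
      define u where "u = lp (cnj z) (Suc k) *v w"
      have "lp z (Suc k) *v u = 0" using w(1) by (simp add: u_def matrix_vector_mul_assoc del: mat_power.simps)
      then have "lp z k *v u = 0" using na unfolding active_iff by blast
      then have "lp (cnj z) (Suc k) *v (lp z k *v w) = 0"
        unfolding u_def matrix_vector_mul_assoc lp_commute[of z k] .
      moreover have "\<not> active (cnj z) k" using na active_cnj by simp
      ultimately have "lp (cnj z) k *v (lp z k *v w) = 0" unfolding active_iff by blast
      then show False using w(2) by (simp only: matrix_vector_mul_assoc lp_commute[of z k])
    qed
  qed
qed

lemma finite_spectrum: "finite (spectrum A)"
proof (rule finite_subset[OF _ finite_Z])
  show "spectrum A \<subseteq> Z"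
  proof
    fix z assume "z \<in> spectrum A"
    then have "E z \<noteq> 0" by (simp add: spectrum_iff active_def)
    then show "z \<in> Z" using outside_E[of z] by blast
  qed
qed

lemma spectrum_nonempty: "spectrum A \<noteq> {}"
proof
  assume "spectrum A = {}"
  then have "E z = 0" for z using spectrum_iff[of z] by (simp add: active_def)
  then have "(mat 1 :: complex^'n^'n) = 0" using sum_E by simp
  then have "(mat 1 :: complex^'n^'n) $ i $ i = 0" for i by simp
  then show False by (simp add: mat_def)
qed

lemma active_spec_index: assumes "z \<in> spectrum A" shows "active z (spec_index A z)"
  and active_le_spec_index: "active z k \<Longrightarrow> k \<le> spec_index A z"
proof -
  have eq: "{k. rank (mat_power (spec_matrix A z) (Suc k)) < rank (mat_power (spec_matrix A z) k)} = {k. active z k}"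
    unfolding rank_drop_iff_active ..
  have fin: "finite {k. active z k}" by (rule finite_subset[of _ "{..<N}"]) (auto dest: active_less)
  have "{k. active z k} \<noteq> {}" using assms spectrum_iff by blast
  then show "active z (spec_index A z)" using Max_in[OF fin] unfolding spec_index_def eq by blast
  show "k \<le> spec_index A z" if "active z k" using Max_ge[OF fin] that unfolding spec_index_def eq by blast
qed

lemma spectrum_cnj: "z \<in> spectrum A \<Longrightarrow> cnj z \<in> spectrum A"
  by (simp only: spectrum_iff active_cnj)

lemma spec_index_cnj: assumes "z \<in> spectrum A" shows "spec_index A (cnj z) = spec_index A z"
proof (rule antisym)
  have "active (cnj z) (spec_index A (cnj z))" by (rule active_spec_index[OF spectrum_cnj[OF assms]])
  then show "spec_index A (cnj z) \<le> spec_index A z"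
    unfolding active_cnj by (rule active_le_spec_index[OF assms])
  have "active (cnj z) (spec_index A z)" unfolding active_cnj by (rule active_spec_index[OF assms])
  then show "spec_index A z \<le> spec_index A (cnj z)" by (rule active_le_spec_index[OF spectrum_cnj[OF assms]])
qed

end

lemma lex_max_exists: "finite S \<Longrightarrow> S \<noteq> {} \<Longrightarrow> \<exists>p\<in>S. \<forall>q\<in>S. lex_le q p"
proof (induction rule: finite_ne_induct)
  case (insert x S)
  then obtain p where p: "p \<in> S" "\<forall>q\<in>S. lex_le q p" by blast
  show ?case
  proof (cases "lex_le x p")
    case False
    then have "\<forall>q\<in>insert x S. lex_le q x" using p(2) by (force simp: lex_le_def)
    then show ?thesis by blast
  qed (use p in blast)
qed (simp add: lex_le_def)

lemma dom_pair_max: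
  assumes "finite (spectrum A)" "spectrum A \<noteq> {}"
  shows "dom_pair A \<in> (\<lambda>z. (Re z, spec_index A z)) ` spectrum A"
    and "z \<in> spectrum A \<Longrightarrow> lex_le (Re z, spec_index A z) (dom_pair A)"
proof -
  let ?S = "(\<lambda>z. (Re z, spec_index A z)) ` spectrum A"
  have "\<exists>!p. p \<in> ?S \<and> (\<forall>q\<in>?S. lex_le q p)"
  proof (rule ex_ex1I)
    show "\<exists>p. p \<in> ?S \<and> (\<forall>q\<in>?S. lex_le q p)" using lex_max_exists[of ?S] assms by blast
    show "p = q" if "p \<in> ?S \<and> (\<forall>q\<in>?S. lex_le q p)" "q \<in> ?S \<and> (\<forall>p\<in>?S. lex_le p q)" for p q
    proof -
      have "lex_le p q" "lex_le q p" using that by blast+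
      then show ?thesis by (auto simp: lex_le_def prod_eq_iff)
    qed
  qed
  from theI'[OF this] show "dom_pair A \<in> ?S" "z \<in> spectrum A \<Longrightarrow> lex_le (Re z, spec_index A z) (dom_pair A)"
    unfolding dom_pair_def by blast+
qed

section \<open>Linear flows and their generators\<close>

lemma bounded_bilinear_matrix_mult_real: "bounded_bilinear ((**) :: real^'n^'n \<Rightarrow> real^'n^'n \<Rightarrow> real^'n^'n)"
  unfolding bilinear_conv_bounded_bilinear[symmetric]
  by (auto simp: bilinear_def matrix_add_ldistrib matrix_add_rdistrib vec_eq_iff matrix_matrix_mult_def
      sum_distrib_left mult_ac sum.distrib distrib_left distrib_right intro!: linearI)

lemma bounded_bilinear_matrix_mult_complex: "bounded_bilinear ((**) :: complex^'n^'n \<Rightarrow> complex^'n^'n \<Rightarrow> complex^'n^'n)"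
  unfolding bilinear_conv_bounded_bilinear[symmetric]
  by (auto simp: bilinear_def matrix_add_ldistrib matrix_add_rdistrib vec_eq_iff matrix_matrix_mult_def
      scaleR_sum_right sum.distrib distrib_left distrib_right intro!: linearI)

lemma bounded_linear_mat_mult: "bounded_linear (\<lambda>c. mat c ** B)" for B :: "complex^'n^'n"
  unfolding linear_conv_bounded_linear[symmetric]
  by (auto intro!: linearI simp: vec_eq_iff mat_mult_left distrib_right)

lemma bounded_linear_cplx: "bounded_linear (\<lambda>M :: real^'n^'n. cplx M)"
  unfolding linear_conv_bounded_linear[symmetric]
  by (auto intro!: linearI simp: vec_eq_iff complex_eq_iff)

lemma cplx_inject: "cplx M = cplx M' \<longleftrightarrow> M = M'"
  by (auto simp: vec_eq_iff)

lemma has_vector_derivative_exp_monomial: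
  fixes z :: complex
  shows "((\<lambda>t. exp (of_real t * z) * of_real t ^ l / fact l) has_vector_derivative
     (z * (exp (of_real t * z) * of_real t ^ l / fact l)
      + (case l of 0 \<Rightarrow> 0 | Suc m \<Rightarrow> exp (of_real t * z) * of_real t ^ m / fact m))) (at t)"
proof -
  have e: "((\<lambda>w. exp (w * z)) has_field_derivative z * exp (w * z)) (at w)" for w
    by (auto intro!: derivative_eq_intros)
  have p: "((\<lambda>w. w ^ l / fact l) has_field_derivative (case l of 0 \<Rightarrow> 0 | Suc m \<Rightarrow> w ^ m / fact m)) (at w)" for w :: complex
  proof (cases l)
    case (Suc m)
    have "((\<lambda>w. w ^ Suc m / fact (Suc m)) has_field_derivative (of_nat (Suc m) * w ^ m) / fact (Suc m)) (at w)"
      using DERIV_power_Suc[OF DERIV_ident[of "at w"], of m] by (intro DERIV_cdivide) (simp add: mult.commute)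
    moreover have "(of_nat (Suc m) * w ^ m) / fact (Suc m) = w ^ m / fact m" by (simp add: fact_Suc del: of_nat_Suc)
    ultimately show ?thesis using Suc by simp
  qed simp
  have "((\<lambda>w. exp (w * z) * (w ^ l / fact l)) has_field_derivative
     exp (of_real t * z) * (case l of 0 \<Rightarrow> 0 | Suc m \<Rightarrow> of_real t ^ m / fact m)
      + z * exp (of_real t * z) * (of_real t ^ l / fact l)) (at (of_real t))"
    by (rule DERIV_mult'[OF e p])
  moreover have "exp (of_real t * z) * (case l of 0 \<Rightarrow> 0 | Suc m \<Rightarrow> of_real t ^ m / fact m)
      + z * exp (of_real t * z) * (of_real t ^ l / fact l) = z * (exp (of_real t * z) * of_real t ^ l / fact l)
      + (case l of 0 \<Rightarrow> 0 | Suc m \<Rightarrow> exp (of_real t * z) * of_real t ^ m / fact m)"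
    by (cases l) simp_all
  ultimately have "((\<lambda>w. exp (w * z) * w ^ l / fact l) has_field_derivative
     (z * (exp (of_real t * z) * of_real t ^ l / fact l)
      + (case l of 0 \<Rightarrow> 0 | Suc m \<Rightarrow> exp (of_real t * z) * of_real t ^ m / fact m))) (at (of_real t))"
    by simp
  moreover have "(complex_of_real has_vector_derivative 1) (at t)"
    using has_vector_derivative_of_real[OF DERIV_ident[of "at t"]] by simp
  ultimately show ?thesis
    using field_vector_diff_chain_at[of of_real 1 t] by (fastforce simp: o_def)
qed

context spectral_resolution
begin

text \<open>The exponential of \<open>t * A\<close> in terms of the spectral resolution, as \<open>A - z\<close> is nilpotent on the range of \<open>E z\<close>.\<close>
definition res_exp :: "real \<Rightarrow> complex^'n^'n" where
  "res_exp t = (\<Sum>z\<in>Z. \<Sum>l<N. mat (exp (of_real t * z) * of_real t ^ l / fact l) ** (lp z l ** E z))"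

lemma res_exp_0: "res_exp 0 = mat 1"
proof -
  have "N > 0" using spectrum_nonempty spectrum_iff active_less by blast
  have "(\<Sum>l<N. mat (exp (of_real 0 * z) * of_real 0 ^ l / fact l) ** (lp z l ** E z)) = E z" for z
  proof -
    have "(\<Sum>l<N. mat (exp (of_real 0 * z) * of_real 0 ^ l / fact l) ** (lp z l ** E z))
       = (\<Sum>l\<in>{0}. mat (exp (of_real 0 * z) * of_real 0 ^ l / fact l) ** (lp z l ** E z))"
      using \<open>N > 0\<close> by (intro sum.mono_neutral_right) (auto simp: power_0_left)
    then show ?thesis by simp
  qed
  then show ?thesis by (simp add: res_exp_def sum_E)
qed

text \<open>The derivative of \<open>t\<^sup>l / l!\<close> moves the index by one, which is compensated by the factor \<open>A - z\<close>; the shifted sum closes up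
  because of \<open>(A - z)\<^sup>N E z = 0\<close>.\<close>
lemma res_exp_deriv: "(res_exp has_vector_derivative cplx A ** res_exp t) (at t)"
proof -
  define g where "g = (\<lambda>z l t. exp (of_real t * z) * of_real t ^ l / fact l :: complex)"
  define g' where "g' = (\<lambda>z l. z * g z l t + (case l of 0 \<Rightarrow> 0 | Suc m \<Rightarrow> g z m t))"
  have g: "(g z l has_vector_derivative g' z l) (at t)" for z l
    unfolding g_def g'_def by (rule has_vector_derivative_exp_monomial)
  have "(res_exp has_vector_derivative (\<Sum>z\<in>Z. \<Sum>l<N. mat (g' z l) ** (lp z l ** E z))) (at t)"
    unfolding res_exp_def[abs_def]
    using g unfolding g_def by (intro has_vector_derivative_sum bounded_linear.has_vector_derivative[OF bounded_linear_mat_mult])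
  also have "(\<Sum>z\<in>Z. \<Sum>l<N. mat (g' z l) ** (lp z l ** E z)) = (\<Sum>z\<in>Z. cplx A ** (\<Sum>l<N. mat (g z l t) ** (lp z l ** E z)))"
  proof (rule sum.cong[OF refl])
    fix z
    have "(\<Sum>l<N. mat (g' z l) ** (lp z l ** E z))
      = (\<Sum>l<N. mat (g z l t) ** (mat z ** (lp z l ** E z))) + (\<Sum>l<N. mat (case l of 0 \<Rightarrow> 0 | Suc m \<Rightarrow> g z m t) ** (lp z l ** E z))"
      unfolding sum.distrib[symmetric] g'_def
      by (intro sum.cong refl) (simp only: mat_add matrix_add_rdistrib mat_mult matrix_mul_assoc mat_commute[of "mat z" "g z _ t"])
    also have "(\<Sum>l<N. mat (case l of 0 \<Rightarrow> 0 | Suc m \<Rightarrow> g z m t) ** (lp z l ** E z))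
       = (\<Sum>l<N. mat (g z l t) ** (lp z (Suc l) ** E z))"
    proof -
      have "(\<Sum>l<N. mat (case l of 0 \<Rightarrow> 0 | Suc m \<Rightarrow> g z m t) ** (lp z l ** E z))
         = (\<Sum>l<Suc N. mat (case l of 0 \<Rightarrow> 0 | Suc m \<Rightarrow> g z m t) ** (lp z l ** E z))"
        by (simp add: nilpotent_E)
      also have "\<dots> = (\<Sum>l<N. mat (g z l t) ** (lp z (Suc l) ** E z))"
        by (subst sum.lessThan_Suc_shift) simp
      finally show ?thesis .
    qed
    also have "(\<Sum>l<N. mat (g z l t) ** (mat z ** (lp z l ** E z))) + (\<Sum>l<N. mat (g z l t) ** (lp z (Suc l) ** E z))
      = (\<Sum>l<N. cplx A ** (mat (g z l t) ** (lp z l ** E z)))"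
      unfolding sum.distrib[symmetric]
    proof (intro sum.cong refl)
      fix l
      have "mat z ** (lp z l ** E z) + lp z (Suc l) ** E z = (mat z + (cplx A - mat z)) ** (lp z l ** E z)"
        by (simp only: matrix_add_rdistrib mat_power.simps matrix_mul_assoc)
      also have "\<dots> = cplx A ** (lp z l ** E z)" by simp
      finally have "mat (g z l t) ** (mat z ** (lp z l ** E z) + lp z (Suc l) ** E z) = mat (g z l t) ** (cplx A ** (lp z l ** E z))"
        by (rule arg_cong)
      then show "mat (g z l t) ** (mat z ** (lp z l ** E z)) + mat (g z l t) ** (lp z (Suc l) ** E z)
         = cplx A ** (mat (g z l t) ** (lp z l ** E z))"
        by (simp only: matrix_add_ldistrib mat_left_commute[of "cplx A"])
    qed
    also have "\<dots> = cplx A ** (\<Sum>l<N. mat (g z l t) ** (lp z l ** E z))" by (rule matrix_sum_ldistrib[symmetric])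
    finally show "(\<Sum>l<N. mat (g' z l) ** (lp z l ** E z)) = cplx A ** (\<Sum>l<N. mat (g z l t) ** (lp z l ** E z))" .
  qed
  also have "\<dots> = cplx A ** res_exp t"
    unfolding res_exp_def g_def by (rule matrix_sum_ldistrib[symmetric])
  finally show ?thesis .
qed

lemma res_exp_commute: "cplx A ** res_exp t = res_exp t ** cplx A"
proof -
  have "cplx A ** lp z l = lp z l ** cplx A" for z l
    using mat_poly_commute[of "cplx A" "[:0, 1:]" "[:- z, 1:] ^ l"] by (simp add: lin_pow_poly mat_poly_pCons)
  then have "cplx A ** (lp z l ** E z) = (lp z l ** E z) ** cplx A" for z l
    by (metis commute_E matrix_mul_assoc)
  then have "cplx A ** (mat c ** (lp z l ** E z)) = (mat c ** (lp z l ** E z)) ** cplx A" for c z l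
    unfolding mat_left_commute by (simp only: matrix_mul_assoc)
  then show ?thesis by (simp only: res_exp_def matrix_sum_ldistrib matrix_sum_rdistrib)
qed

text \<open>For every solution \<open>V\<close>, the product \<open>res_exp (- t) ** V t\<close> has derivative zero. Taking \<open>V\<close> to be \<open>res_exp\<close> itself shows that
  \<open>res_exp (- t)\<close> is the inverse of \<open>res_exp t\<close>.\<close>
lemma ode_solution_unique:
  assumes Y: "\<And>t. (Y has_vector_derivative cplx A ** Y t) (at t)" "Y 0 = mat 1"
  shows "Y t = res_exp t"
proof -
  have inv: "res_exp (- t) ** V t = mat 1"
    if V: "\<And>t. (V has_vector_derivative cplx A ** V t) (at t)" "V 0 = mat 1" for V t
  proof -
    have d: "((\<lambda>t. res_exp (- t)) has_vector_derivative - (cplx A ** res_exp (- t))) (at t)" for t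
    proof -
      have "(uminus has_vector_derivative (-1 :: real)) (at t)"
        unfolding has_real_derivative_iff_has_vector_derivative[symmetric] by (auto intro!: derivative_eq_intros)
      from vector_diff_chain_at[OF this res_exp_deriv] show ?thesis by (simp add: o_def)
    qed
    have "((\<lambda>t. res_exp (- t) ** V t) has_vector_derivative
        res_exp (- t) ** (cplx A ** V t) + - (cplx A ** res_exp (- t)) ** V t) (at t)" for t
      by (rule bounded_bilinear.has_vector_derivative[OF bounded_bilinear_matrix_mult_complex d V(1)])
    moreover have "res_exp (- t) ** (cplx A ** V t) + - (cplx A ** res_exp (- t)) ** V t = 0" for t
      by (simp add: matrix_minus res_exp_commute matrix_mul_assoc)
    ultimately have "((\<lambda>t. res_exp (- t) ** V t) has_vector_derivative 0) (at t within UNIV)" for t by simp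
    then obtain c where "\<And>t. res_exp (- t) ** V t = c"
      using has_vector_derivative_zero_constant[of UNIV "\<lambda>t. res_exp (- t) ** V t"] by auto
    from this[of t] this[of 0] show ?thesis using V(2) by (simp add: res_exp_0)
  qed
  have "res_exp (- t) ** res_exp t = mat 1" by (rule inv[OF res_exp_deriv res_exp_0])
  then have "res_exp t ** res_exp (- t) = mat 1" by (simp only: matrix_left_right_inverse[of "res_exp t"])
  moreover have "res_exp (- t) ** Y t = mat 1" by (rule inv[OF Y])
  ultimately show ?thesis by (metis matrix_mul_assoc matrix_mul_lid matrix_mul_rid)
qed

lemma cplx_solution:
  assumes M: "\<And>t. (M has_vector_derivative A ** M t) (at t)" "M 0 = mat 1"
  shows "cplx (M t) = res_exp t"
proof (rule ode_solution_unique)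
  show "((\<lambda>t. cplx (M t)) has_vector_derivative cplx A ** cplx (M t)) (at t)" for t
    using bounded_linear.has_vector_derivative[OF bounded_linear_cplx M(1)] by (simp add: cplx_mult)
qed (simp add: M map_matrix_mat)

end

lemma mat_power_entry_bound:
  fixes A :: "real^'n^'n"
  shows "\<bar>mat_power A k $ i $ j\<bar> \<le> (\<Sum>i\<in>UNIV. \<Sum>l\<in>UNIV. \<bar>A $ i $ l\<bar>) ^ k"
proof (induction k arbitrary: i j)
  case 0 show ?case by (simp add: mat_def)
next
  case (Suc k)
  define C where "C = (\<Sum>i\<in>UNIV. \<Sum>l\<in>UNIV. \<bar>A $ i $ l\<bar>)"
  have C: "C \<ge> 0" unfolding C_def by (intro sum_nonneg) auto
  have "\<bar>mat_power A (Suc k) $ i $ j\<bar> \<le> (\<Sum>l\<in>UNIV. \<bar>A $ i $ l\<bar> * \<bar>mat_power A k $ l $ j\<bar>)"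
    unfolding mat_power.simps matrix_matrix_mult_def by (simp add: abs_mult[symmetric])
  also have "\<dots> \<le> (\<Sum>l\<in>UNIV. \<bar>A $ i $ l\<bar> * C ^ k)"
    using Suc unfolding C_def by (intro sum_mono mult_left_mono) auto
  also have "\<dots> = (\<Sum>l\<in>UNIV. \<bar>A $ i $ l\<bar>) * C ^ k" by (simp add: sum_distrib_right)
  also have "\<dots> \<le> C * C ^ k"
    unfolding C_def using C
    by (intro mult_right_mono) (auto simp: C_def intro!: member_le_sum[of i UNIV "\<lambda>i. \<Sum>l\<in>UNIV. \<bar>A $ i $ l\<bar>"] sum_nonneg)
  finally show ?case by (simp add: C_def)
qed

lemma matrix_eq_sum_axis: "M = (\<Sum>i\<in>UNIV. \<Sum>j\<in>UNIV. (M $ i $ j) *\<^sub>R axis i (axis j 1))" for M :: "real^'n^'n"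
proof -
  have "((M $ i $ j) *\<^sub>R axis i (axis j 1)) $ k $ l = (if j = l then (if i = k then M $ i $ j else 0) else 0)" for i j k l
    by (auto simp: axis_def)
  then show ?thesis by (simp add: vec_eq_iff del: vector_scaleR_component)
qed

lemma has_vector_derivative_entries:
  fixes f :: "real \<Rightarrow> real^'n^'n"
  assumes "\<And>i j. ((\<lambda>t. f t $ i $ j) has_real_derivative f' $ i $ j) (at t)"
  shows "(f has_vector_derivative f') (at t)"
proof -
  have "((\<lambda>t. \<Sum>i\<in>UNIV. \<Sum>j\<in>UNIV. (f t $ i $ j) *\<^sub>R axis i (axis j 1)) has_vector_derivative
     (\<Sum>i\<in>UNIV. \<Sum>j\<in>UNIV. (f' $ i $ j) *\<^sub>R axis i (axis j (1::real)) :: real^'n^'n)) (at t)"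
    by (intro has_vector_derivative_sum has_vector_derivative_scaleR[where g' = 0, simplified] assms has_vector_derivative_const)
  then show ?thesis unfolding matrix_eq_sum_axis[symmetric] .
qed

lemma mat_power_scaleR: "mat_power (t *\<^sub>R A) k = t ^ k *\<^sub>R mat_power A k" for A :: "real^'n^'n"
  by (induction k) (simp_all add: vec_eq_iff matrix_matrix_mult_def sum_distrib_left mult_ac)

lemma mat_exp_entry_summable: "summable (\<lambda>k. mat_power A k $ i $ j / fact k * t ^ k)" for A :: "real^'n^'n"
proof (rule summable_comparison_test'[of _ 0])
  let ?C = "\<Sum>i\<in>UNIV. \<Sum>l\<in>UNIV. \<bar>A $ i $ l\<bar>"
  show "summable (\<lambda>k. inverse (fact k) * (?C * \<bar>t\<bar>) ^ k)" by (rule summable_exp)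
  fix k :: nat
  have "\<bar>mat_power A k $ i $ j\<bar> * \<bar>t\<bar> ^ k \<le> ?C ^ k * \<bar>t\<bar> ^ k"
    by (intro mult_right_mono mat_power_entry_bound) auto
  then show "norm (mat_power A k $ i $ j / fact k * t ^ k) \<le> inverse (fact k) * (?C * \<bar>t\<bar>) ^ k"
    by (simp add: abs_mult power_abs power_mult_distrib divide_simps)
qed

lemma mat_exp_entry: "mat_exp (t *\<^sub>R A) $ i $ j = (\<Sum>k. mat_power A k $ i $ j / fact k * t ^ k)"
proof -
  have "(\<lambda>k. (1 / fact k) *\<^sub>R mat_power (t *\<^sub>R A) k) sums (\<chi> i j. \<Sum>k. mat_power A k $ i $ j / fact k * t ^ k)"
    unfolding sums_def
  proof (intro vec_tendstoI)
    fix i j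
    have "(\<lambda>k. mat_power A k $ i $ j / fact k * t ^ k) sums (\<Sum>k. mat_power A k $ i $ j / fact k * t ^ k)"
      using mat_exp_entry_summable by (rule summable_sums)
    then show "(\<lambda>n. (\<Sum>k<n. (1 / fact k) *\<^sub>R mat_power (t *\<^sub>R A) k) $ i $ j) \<longlonglongrightarrow> (\<chi> i j. \<Sum>k. mat_power A k $ i $ j / fact k * t ^ k) $ i $ j"
      by (simp add: sums_def mat_power_scaleR mult_ac)
  qed
  then show ?thesis unfolding mat_exp_def by (simp add: sums_iff)
qed

text \<open>The series is differentiated entry by entry as a power series in \<open>t\<close>.\<close>
lemma mat_exp_deriv:
  fixes A :: "real^'n^'n"
  shows "((\<lambda>t. mat_exp (t *\<^sub>R A)) has_vector_derivative A ** mat_exp (t *\<^sub>R A)) (at t)"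
proof (rule has_vector_derivative_entries)
  fix i j
  define c where "c = (\<lambda>j' k. mat_power A k $ j' $ j / fact k)"
  have s: "summable (\<lambda>k. c l k * t ^ k)" for l t unfolding c_def by (rule mat_exp_entry_summable)
  have "((\<lambda>t. \<Sum>k. c i k * t ^ k) has_real_derivative (\<Sum>k. diffs (c i) k * t ^ k)) (at t)"
    by (rule termdiffs_strong_converges_everywhere[OF s])
  moreover have "(\<Sum>k. diffs (c i) k * t ^ k) = (A ** mat_exp (t *\<^sub>R A)) $ i $ j"
  proof -
    have "(\<lambda>k. \<Sum>l\<in>UNIV. A $ i $ l * (c l k * t ^ k)) sums (\<Sum>l\<in>UNIV. A $ i $ l * (\<Sum>k. c l k * t ^ k))"
      by (intro sums_sum sums_mult summable_sums s)
    moreover have "(\<Sum>l\<in>UNIV. A $ i $ l * (c l k * t ^ k)) = diffs (c i) k * t ^ k" for k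
    proof -
      have "diffs (c i) k = mat_power A (Suc k) $ i $ j / fact k"
        by (simp add: diffs_def c_def fact_Suc del: of_nat_Suc mat_power.simps)
      also have "\<dots> = (\<Sum>l\<in>UNIV. A $ i $ l * c l k)"
        by (simp add: c_def matrix_matrix_mult_def sum_divide_distrib)
      finally show ?thesis by (simp add: sum_distrib_right mult.assoc)
    qed
    ultimately have "(\<Sum>k. diffs (c i) k * t ^ k) = (\<Sum>l\<in>UNIV. A $ i $ l * (\<Sum>k. c l k * t ^ k))"
      by (simp add: sums_iff)
    then show ?thesis by (simp add: matrix_matrix_mult_def mat_exp_entry c_def)
  qed
  ultimately show "((\<lambda>t. mat_exp (t *\<^sub>R A) $ i $ j) has_real_derivative (A ** mat_exp (t *\<^sub>R A)) $ i $ j) (at t)"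
    by (simp add: mat_exp_entry c_def)
qed

lemma mat_exp_0: "mat_exp (0 *\<^sub>R A) = mat 1"
proof -
  have "(\<Sum>k. mat_power A k $ i $ j / fact k * 0 ^ k) = mat 1 $ i $ j" for i j
    using powser_zero[of "\<lambda>k. mat_power A k $ i $ j / fact k"] by simp
  then show ?thesis by (simp add: vec_eq_iff mat_exp_entry del: scaleR_zero_left)
qed

text \<open>For small \<open>h\<close> the integral \<open>J\<close> of \<open>M\<close> over \<open>[0,h]\<close> is close to \<open>h\<close> times the identity, hence invertible. As \<open>M t ** J\<close> is the integral
  of \<open>M\<close> over \<open>[t,t + h]\<close>, a differentiable function of \<open>t\<close>, so is \<open>M\<close>.\<close>
lemma flow_differentiable_at_0:
  fixes M :: "real \<Rightarrow> real^'n^'n"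
  assumes Mc: "continuous_on UNIV M" and M0: "M 0 = mat 1" and add: "\<And>s t. M (s + t) = M s ** M t"
  shows "\<exists>A. (M has_vector_derivative A) (at 0)"
proof -
  have bb: "bounded_bilinear ((*v) :: real^'n^'n \<Rightarrow> real^'n \<Rightarrow> real^'n)"
    unfolding bilinear_conv_bounded_bilinear[symmetric]
    by (auto simp: bilinear_def vec_eq_iff matrix_vector_mult_def sum_distrib_left mult_ac sum.distrib
      distrib_left distrib_right intro!: linearI)
  obtain K where K: "K > 0" "\<And>(B :: real^'n^'n) v. norm (B *v v) \<le> norm B * norm v * K"
    using bounded_bilinear.pos_bounded[OF bb] by blast
  have "isCont M 0" using Mc by (simp add: continuous_on_eq_continuous_at)
  then obtain d where d: "d > 0" "\<And>s. \<bar>s\<bar> < d \<Longrightarrow> norm (M s - mat 1) < 1 / (2 * K)"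
    using K(1) M0 by (auto simp: continuous_at_eps_delta dist_norm) (metis zero_less_divide_1_iff zero_less_mult_iff zero_less_numeral)
  define h where "h = d / 2"
  have h: "h > 0" "h < d" using d(1) by (auto simp: h_def)
  define J where "J = integral {0..h} M"
  have J: "(M has_integral J) {0..h}"
    unfolding J_def by (intro integrable_integral integrable_continuous_real continuous_on_subset[OF Mc]) auto
  have "norm (J - h *\<^sub>R mat 1) \<le> (1 / (2 * K)) * h"
  proof -
    have "((\<lambda>s. M s - mat 1) has_integral (J - h *\<^sub>R mat 1)) {0..h}"
      using has_integral_diff[OF J has_integral_const_real[of "mat 1" 0 h]] h by simp
    then show ?thesis
      using has_integral_bound[of "1 / (2 * K)" "\<lambda>s. M s - mat 1" _ 0 h] d(2) h K(1) by (simp add: less_imp_le)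
  qed
  note Jbound = this
  have "v = 0" if v: "J *v v = 0" for v
  proof (rule ccontr)
    assume "v \<noteq> 0"
    have "(J - h *\<^sub>R mat 1) *v v = - (h *\<^sub>R v)"
      by (simp add: matrix_vector_mult_diff_rdistrib v scaleR_matrix_vector_assoc[symmetric])
    then have "h * norm v \<le> norm (J - h *\<^sub>R mat 1) * norm v * K"
      using K(2)[of "J - h *\<^sub>R mat 1" v] h(1) by simp
    also have "\<dots> \<le> ((1 / (2 * K)) * h) * norm v * K"
      using Jbound K(1) by (intro mult_right_mono) auto
    also have "\<dots> = h * norm v / 2" using K(1) by simp
    finally show False using h(1) \<open>v \<noteq> 0\<close> by simp
  qed
  then have "\<exists>B. B ** J = mat 1" unfolding matrix_left_invertible_ker by blast
  then obtain B where "B ** J = mat 1" by blast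
  then have B: "J ** B = mat 1" by (simp only: matrix_left_right_inverse[of J])
  have "continuous_on {-1..h + 2} M" by (rule continuous_on_subset[OF Mc]) auto
  then obtain g where g: "\<And>x. x \<in> {-1..h + 2} \<Longrightarrow> (g has_vector_derivative M x) (at x within {-1..h + 2})"
    using antiderivative_continuous by blast
  have g': "(g has_vector_derivative M x) (at x)" if "-1 < x" "x < h + 2" for x
    using g[of x] that at_within_interior[of x "{-1..h + 2}"] by simp
  have MJ: "M t = (g (t + h) - g t) ** B" if t: "t \<in> {-1<..<1}" for t
  proof -
    have i1: "((\<lambda>s. M (t + s)) has_integral (g (t + h) - g (t + 0))) {0..h}"
    proof (rule fundamental_theorem_of_calculus)
      fix s assume s: "s \<in> {0..h}"
      have "((\<lambda>s. t + s) has_vector_derivative 1) (at s)"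
        unfolding has_real_derivative_iff_has_vector_derivative[symmetric] by (auto intro!: derivative_eq_intros)
      moreover have "(g has_vector_derivative M (t + s)) (at (t + s))" using s t by (intro g') auto
      ultimately have "((\<lambda>s. g (t + s)) has_vector_derivative M (t + s)) (at s)"
        using vector_diff_chain_at by (fastforce simp: o_def)
      then show "((\<lambda>s. g (t + s)) has_vector_derivative M (t + s)) (at s within {0..h})"
        by (rule has_vector_derivative_at_within)
    qed (use h in simp)
    have i2: "((\<lambda>s. M (t + s)) has_integral M t ** J) {0..h}"
      using has_integral_linear[OF J bounded_bilinear.bounded_linear_right[OF bounded_bilinear_matrix_mult_real, of "M t"]]
      by (simp add: o_def add)
    have "M t ** J = g (t + h) - g t" using has_integral_unique[OF i2 i1] by simp
    then have "(g (t + h) - g t) ** B = M t ** (J ** B)" by (simp add: matrix_mul_assoc)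
    then show ?thesis by (simp add: B)
  qed
  have "((\<lambda>t. t + h) has_vector_derivative 1) (at 0)"
    unfolding has_real_derivative_iff_has_vector_derivative[symmetric] by (auto intro!: derivative_eq_intros)
  moreover have "(g has_vector_derivative M h) (at (0 + h))" using h g'[of h] by simp
  ultimately have "((g \<circ> (\<lambda>t. t + h)) has_vector_derivative 1 *\<^sub>R M h) (at 0)" by (rule vector_diff_chain_at)
  then have "((\<lambda>t. g (t + h) - g t) has_vector_derivative M h - M 0) (at 0)"
    using g'[of 0] h by (intro has_vector_derivative_diff) (simp_all add: o_def)
  then have D: "((\<lambda>t. (g (t + h) - g t) ** B) has_vector_derivative (M h - M 0) ** B) (at 0)"
    by (rule bounded_linear.has_vector_derivative[OF bounded_bilinear.bounded_linear_left[OF bounded_bilinear_matrix_mult_real]])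
  have "(M has_vector_derivative (M h - M 0) ** B) (at 0)"
    by (rule has_vector_derivative_transform_within_open[OF D, of "{-1<..<1}"]) (use MJ in auto)
  then show ?thesis by blast
qed

lemma flow_ode:
  fixes M :: "real \<Rightarrow> real^'n^'n"
  assumes "continuous_on UNIV M" "M 0 = mat 1" and add: "\<And>s t. M (s + t) = M s ** M t"
  shows "\<exists>A. \<forall>t. (M has_vector_derivative A ** M t) (at t)"
proof -
  obtain A where A: "(M has_vector_derivative A) (at 0)" using flow_differentiable_at_0[OF assms] by blast
  have "(M has_vector_derivative A ** M t) (at t)" for t
  proof -
    have "((\<lambda>x. x - t) has_vector_derivative 1) (at t)"
      unfolding has_real_derivative_iff_has_vector_derivative[symmetric] by (auto intro!: derivative_eq_intros)
    moreover have "(M has_vector_derivative A) (at (t - t))" using A by simp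
    ultimately have "((M \<circ> (\<lambda>x. x - t)) has_vector_derivative 1 *\<^sub>R A) (at t)" by (rule vector_diff_chain_at)
    then have "((\<lambda>x. M (x - t) ** M t) has_vector_derivative A ** M t) (at t)"
      using bounded_linear.has_vector_derivative[OF bounded_bilinear.bounded_linear_left[OF bounded_bilinear_matrix_mult_real, of "M t"]]
      by (fastforce simp: o_def)
    moreover have "M (x - t) ** M t = M x" for x using add[of "x - t" t] by simp
    ultimately show ?thesis by simp
  qed
  then show ?thesis by blast
qed

lemma matrix_ode_unique:
  fixes M M' :: "real \<Rightarrow> real^'n^'n"
  assumes "\<And>t. (M has_vector_derivative A ** M t) (at t)" "M 0 = mat 1"
    and "\<And>t. (M' has_vector_derivative A ** M' t) (at t)" "M' 0 = mat 1"
  shows "M t = M' t"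
proof -
  obtain E Z N where "spectral_resolution A E Z N" using spectral_resolution_exists by blast
  then interpret spectral_resolution A E Z N .
  have "cplx (M t) = cplx (M' t)" by (simp only: cplx_solution[OF assms(1,2)] cplx_solution[OF assms(3,4)])
  then show ?thesis by (simp only: cplx_inject)
qed

text \<open>The generator is introduced by definite description through the matrix exponential. Solving the differential equation
  of the flow shows that the description is proper, and brings the derivative back.\<close>
lemma linear_flow_matrix:
  fixes \<phi> :: "real \<Rightarrow> real^'n \<Rightarrow> real^'n"
  assumes "linear_flow \<phi>"
  shows continuous_flow_matrix: "continuous_on UNIV (\<lambda>t. matrix (\<phi> t))"
    and flow_matrix_0: "matrix (\<phi> 0) = mat 1"
    and flow_matrix_deriv: "((\<lambda>t. matrix (\<phi> t)) has_vector_derivative generator \<phi> ** matrix (\<phi> t)) (at t)"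
proof -
  have f: "continuous_on UNIV (\<lambda>(t, x). \<phi> t x)" "\<And>x. \<phi> 0 x = x" "\<And>s t x. \<phi> s (\<phi> t x) = \<phi> (s + t) x" "\<And>t. linear (\<phi> t)"
    using assms by (auto simp: linear_flow_def)
  show c: "continuous_on UNIV (\<lambda>t. matrix (\<phi> t))"
    unfolding matrix_def
    by (intro continuous_on_vec_lambda continuous_on_component continuous_on_compose2[OF f(1), of _ "\<lambda>t. (t, _)", simplified] continuous_intros)
  show z: "matrix (\<phi> 0) = mat 1"
  proof -
    have "\<phi> 0 = id" using f(2) by (simp add: fun_eq_iff)
    then show ?thesis by (simp add: matrix_id_mat_1)
  qed
  have add: "matrix (\<phi> (s + t)) = matrix (\<phi> s) ** matrix (\<phi> t)" for s t
  proof -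
    have "\<phi> (s + t) = \<phi> s \<circ> \<phi> t" using f(3) by (simp add: fun_eq_iff)
    then show ?thesis using matrix_compose[OF f(4) f(4), of s t] by simp
  qed
  obtain A where A: "\<And>t. ((\<lambda>t. matrix (\<phi> t)) has_vector_derivative A ** matrix (\<phi> t)) (at t)"
    using flow_ode[OF c z add] by blast
  have "generator \<phi> = A"
    unfolding generator_def
  proof (rule the_equality)
    show "\<forall>t. matrix (\<phi> t) = mat_exp (t *\<^sub>R A)"
      using matrix_ode_unique[OF A z mat_exp_deriv mat_exp_0] by blast
    fix B assume "\<forall>t. matrix (\<phi> t) = mat_exp (t *\<^sub>R B)"
    then have "((\<lambda>t. matrix (\<phi> t)) has_vector_derivative B ** matrix (\<phi> 0)) (at 0)"
      using mat_exp_deriv[of B 0] by simp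
    then show "B = A" using vector_derivative_unique_at[OF _ A[of 0]] by (simp add: z)
  qed
  then show "((\<lambda>t. matrix (\<phi> t)) has_vector_derivative generator \<phi> ** matrix (\<phi> t)) (at t)" using A by simp
qed

section \<open>Asymptotics of the flow and the equivalence\<close>

definition Re_mat :: "complex^'n^'n \<Rightarrow> real^'n^'n" where "Re_mat M = (\<chi> i j. Re (M $ i $ j))"
definition Im_mat :: "complex^'n^'n \<Rightarrow> real^'n^'n" where "Im_mat M = (\<chi> i j. Im (M $ i $ j))"

lemma Re_mat_cplx: "Re_mat (cplx M) = M"
  by (simp add: Re_mat_def vec_eq_iff)

lemma bounded_linear_Re_mat: "bounded_linear (Re_mat :: complex^'n^'n \<Rightarrow> _)"
  unfolding linear_conv_bounded_linear[symmetric]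
  by (auto intro!: linearI simp: vec_eq_iff Re_mat_def)

lemma tendsto_exp_poly_0:
  fixes \<delta> :: real
  assumes "\<delta> > 0" shows "((\<lambda>t. exp (- \<delta> * t) * t ^ l) \<longlongrightarrow> 0) at_top"
proof -
  have "filterlim (\<lambda>t. \<delta> * t) at_top at_top" using assms
    by (intro filterlim_tendsto_pos_mult_at_top[OF tendsto_const] filterlim_ident)
  then have "((\<lambda>t. (\<delta> * t) ^ l / exp (\<delta> * t)) \<longlongrightarrow> 0) at_top"
    by (rule filterlim_compose[OF tendsto_power_div_exp_0])
  then have "((\<lambda>t. (1 / \<delta> ^ l) * ((\<delta> * t) ^ l / exp (\<delta> * t))) \<longlongrightarrow> (1 / \<delta> ^ l) * 0) at_top"
    by (rule tendsto_mult[OF tendsto_const])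
  moreover have "(1 / \<delta> ^ l) * ((\<delta> * t) ^ l / exp (\<delta> * t)) = exp (- \<delta> * t) * t ^ l" for t
    using assms by (simp add: power_mult_distrib exp_minus field_simps)
  ultimately show ?thesis by simp
qed

text \<open>Extend the vectors to a basis and map it to an orthonormal one.\<close>
lemma exists_orthonormalising_map:
  fixes x :: "'i \<Rightarrow> 'a::euclidean_space"
  assumes I: "finite I" and indep: "\<And>u. (\<Sum>i\<in>I. u i *\<^sub>R x i) = 0 \<Longrightarrow> \<forall>i\<in>I. u i = 0"
  shows "\<exists>L :: 'a \<Rightarrow> 'a. linear L \<and> bij L \<and> (\<forall>i\<in>I. \<forall>j\<in>I. L (x i) \<bullet> L (x j) = (if i = j then 1 else 0))"
proof -
  have inj: "inj_on x I"
  proof (rule inj_onI, rule ccontr)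
    fix i j assume ij: "i \<in> I" "j \<in> I" "x i = x j" "i \<noteq> j"
    define u where "u = (\<lambda>k. (if k = i then 1 else 0) - (if k = j then 1 else 0 :: real))"
    have "(\<Sum>k\<in>I. u k *\<^sub>R x k) = (\<Sum>k\<in>I. (if k = i then x i else 0)) - (\<Sum>k\<in>I. if k = j then x j else 0)"
      unfolding sum_subtractf[symmetric] by (intro sum.cong refl) (auto simp: u_def)
    also have "\<dots> = 0" using I ij by simp
    finally have "u i = 0" using indep ij(1) by blast
    then show False using ij(4) by (simp add: u_def)
  qed
  have ind: "independent (x ` I)"
  proof
    assume "dependent (x ` I)"
    then obtain v u where u: "v \<in> x ` I" "u v \<noteq> 0" "(\<Sum>v\<in>x ` I. u v *\<^sub>R v) = 0"
      using I by (subst (asm) dependent_finite) auto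
    have "(\<Sum>i\<in>I. u (x i) *\<^sub>R x i) = 0" using u(3) by (subst (asm) sum.reindex[OF inj]) simp
    from indep[OF this] u(1,2) show False by auto
  qed
  obtain B where B: "x ` I \<subseteq> B" "independent B" "UNIV \<subseteq> span B"
    using maximal_independent_subset_extend[of "x ` I" UNIV] ind by auto
  have finB: "finite B" using independent_imp_finite[OF B(2)] .
  have "card B = dim (UNIV :: 'a set)" using basis_card_eq_dim[of B UNIV] B by auto
  then have "card B = card (Basis :: 'a set)" by simp
  then obtain \<pi> where \<pi>: "bij_betw \<pi> B (Basis :: 'a set)" using finite_same_card_bij[OF finB finite_Basis] by blast
  obtain L where L: "linear L" "\<And>b. b \<in> B \<Longrightarrow> L b = \<pi> b"
    using linear_independent_extend[OF B(2)] by blast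
  have "Basis \<subseteq> range L"
  proof
    fix b :: 'a assume "b \<in> Basis"
    then obtain c where "c \<in> B" "b = \<pi> c" using \<pi> by (auto simp: bij_betw_def)
    then show "b \<in> range L" using L(2)[of c] by (metis rangeI)
  qed
  then have "span Basis \<subseteq> range L" using linear_subspace_image[OF L(1) subspace_UNIV] by (rule span_minimal)
  then have surj: "surj L" by auto
  then have "inj L" using linear_surjective_imp_injective[OF L(1)] by blast
  moreover have "L (x i) \<bullet> L (x j) = (if i = j then 1 else 0)" if "i \<in> I" "j \<in> I" for i j
  proof -
    have xB: "x i \<in> B" "x j \<in> B" using B(1) that by auto
    then have "\<pi> (x i) \<in> Basis" "\<pi> (x j) \<in> Basis" using \<pi> by (auto simp: bij_betw_def)
    moreover have "\<pi> (x i) = \<pi> (x j) \<longleftrightarrow> i = j"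
      using \<pi> xB inj that by (auto simp: bij_betw_def inj_on_eq_iff)
    ultimately show ?thesis using L(2) xB by (simp add: inner_Basis)
  qed
  ultimately have "linear L \<and> bij L \<and> (\<forall>i\<in>I. \<forall>j\<in>I. L (x i) \<bullet> L (x j) = (if i = j then 1 else 0))"
    using L(1) surj unfolding bij_def by blast
  then show ?thesis by blast
qed

lemma orthonormal_inner_sum:
  assumes I: "finite I" and e: "\<And>i j. i \<in> I \<Longrightarrow> j \<in> I \<Longrightarrow> e i \<bullet> e j = (if i = j then 1 else 0)"
  shows "(\<Sum>i\<in>I. p i *\<^sub>R e i) \<bullet> (\<Sum>j\<in>I. q j *\<^sub>R e j) = (\<Sum>i\<in>I. p i * q i)"
proof -
  have "(\<Sum>i\<in>I. p i *\<^sub>R e i) \<bullet> (\<Sum>j\<in>I. q j *\<^sub>R e j) = (\<Sum>i\<in>I. (p i *\<^sub>R e i) \<bullet> (\<Sum>j\<in>I. q j *\<^sub>R e j))"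
    by (rule inner_sum_left)
  also have "\<dots> = (\<Sum>i\<in>I. \<Sum>j\<in>I. (p i *\<^sub>R e i) \<bullet> (q j *\<^sub>R e j))"
    by (intro sum.cong refl inner_sum_right)
  also have "\<dots> = (\<Sum>i\<in>I. \<Sum>j\<in>I. if i = j then p i * q i else 0)"
    by (intro sum.cong refl) (auto simp: e)
  finally show ?thesis using I by simp
qed

text \<open>The complex bilinear extension of the inner product of real matrices.\<close>
definition cdot :: "real^'n^'n \<Rightarrow> complex^'n^'n \<Rightarrow> complex" where
  "cdot c W = (\<Sum>i\<in>UNIV. \<Sum>j\<in>UNIV. of_real (c $ i $ j) * W $ i $ j)"

lemma cdot_cplx: "cdot c (cplx M) = of_real (c \<bullet> M)"
  by (simp add: cdot_def inner_vec_def)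

lemma cdot_mat: "cdot c (mat a ** W) = a * cdot c W"
  by (simp add: cdot_def mat_mult_left sum_distrib_left mult_ac)

lemma cdot_sum: "cdot c (\<Sum>i\<in>I. f i) = (\<Sum>i\<in>I. cdot c (f i))"
  by (induction I rule: infinite_finite_induct) (auto simp: cdot_def sum.distrib distrib_left)

lemma cdot_eq_0_iff: "cdot c W = 0 \<longleftrightarrow> c \<bullet> Re_mat W = 0 \<and> c \<bullet> Im_mat W = 0"
  by (simp add: cdot_def complex_eq_iff inner_vec_def Re_mat_def Im_mat_def)

lemma AE_inner_nonzero: "v \<noteq> 0 \<Longrightarrow> AE c in lborel. c \<bullet> v \<noteq> 0" for v :: "'a::euclidean_space"
proof -
  assume "v \<noteq> 0"
  then have "negligible {c. v \<bullet> c = 0}" by (rule negligible_hyperplane[OF disjI1])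
  then have "AE c in lebesgue. c \<bullet> v \<noteq> 0"
    unfolding eventually_ae_filter_negligible by (intro exI[of _ "{c. v \<bullet> c = 0}"]) (auto simp: inner_commute)
  then show ?thesis by (simp add: AE_completion_iff)
qed

context spectral_resolution
begin

definition growth :: real where "growth = fst (dom_pair A)"
definition dom_degree :: nat where "dom_degree = snd (dom_pair A)"
abbreviation "D \<equiv> dom_spectrum A"
text \<open>The coefficient of \<open>t ^ dom_degree * exp (t * z)\<close> in the flow.\<close>
definition dom_coeff :: "complex \<Rightarrow> complex^'n^'n" where
  "dom_coeff z = mat (1 / fact dom_degree) ** (lp z dom_degree ** E z)"

lemma D_iff: "z \<in> D \<longleftrightarrow> z \<in> spectrum A \<and> Re z = growth \<and> spec_index A z = dom_degree"
  by (auto simp: dom_spectrum_def growth_def dom_degree_def prod_eq_iff)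

lemma D_nonempty: "D \<noteq> {}"
  using dom_pair_max(1)[OF finite_spectrum spectrum_nonempty] by (auto simp: dom_spectrum_def)

lemma finite_D: "finite D"
  using finite_spectrum by (rule finite_subset[rotated]) (auto simp: D_iff)

lemma D_cnj: "z \<in> D \<Longrightarrow> cnj z \<in> D"
  by (simp add: D_iff spectrum_cnj spec_index_cnj)

lemma D_subset_Z: "z \<in> D \<Longrightarrow> z \<in> Z"
  using outside_E by (auto simp: D_iff spectrum_iff active_def)

lemma D_active: "z \<in> D \<Longrightarrow> active z dom_degree"
  using active_spec_index[of z] by (simp add: D_iff)

lemma dom_degree_less: "dom_degree < N"
  using D_nonempty D_active active_less by blast

lemma sum_D_cnj: "(\<Sum>z\<in>D. g (cnj z)) = (\<Sum>z\<in>D. g z)"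
proof -
  have "bij_betw cnj D D" by (rule bij_betw_byWitness[where f' = cnj]) (auto intro: D_cnj)
  then show ?thesis by (rule sum.reindex_bij_betw)
qed

text \<open>As conjugation permutes \<open>D\<close>, it suffices to compare the contributions of conjugate pairs.\<close>
lemma sum_D_pair:
  fixes g h :: "complex \<Rightarrow> 'b::real_vector"
  assumes "\<And>z. z \<in> D \<Longrightarrow> g z + g (cnj z) = h z + h (cnj z)"
  shows "(\<Sum>z\<in>D. g z) = (\<Sum>z\<in>D. h z)"
proof -
  have "(\<Sum>z\<in>D. g z) + (\<Sum>z\<in>D. g (cnj z)) = (\<Sum>z\<in>D. h z) + (\<Sum>z\<in>D. h (cnj z))"
    unfolding sum.distrib[symmetric] using assms by (rule sum.cong[OF refl])
  then have "2 *\<^sub>R (\<Sum>z\<in>D. g z) = 2 *\<^sub>R (\<Sum>z\<in>D. h z)" unfolding sum_D_cnj by (simp add: scaleR_2)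
  then show ?thesis by simp
qed

lemma dom_coeff_cnj: "cnj_mat (dom_coeff z) = dom_coeff (cnj z)"
  by (simp add: dom_coeff_def cnj_mat_mult cnj_lin_pow cnj_E map_matrix_mat)

lemma E_dom_coeff: "E w ** dom_coeff z = (if w = z then dom_coeff z else 0)"
proof -
  have "E w ** dom_coeff z = mat (1 / fact dom_degree) ** (lp z dom_degree ** (E w ** E z))"
    unfolding dom_coeff_def mat_left_commute[of "E w"] by (metis lp_E_commute matrix_mul_assoc)
  then show ?thesis using E_idempotent E_orthogonal by (auto simp: dom_coeff_def)
qed

lemma dom_coeff_nonzero: assumes "z \<in> D" shows "dom_coeff z \<noteq> 0"
proof
  assume "dom_coeff z = 0"
  then have "mat (fact dom_degree) ** dom_coeff z = 0" by simp
  moreover have "mat (fact dom_degree) ** dom_coeff z = mat (fact dom_degree * (1 / fact dom_degree)) ** (lp z dom_degree ** E z)"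
    by (simp only: dom_coeff_def mat_mult matrix_mul_assoc)
  ultimately show False using D_active[OF assms] by (simp add: active_def)
qed

text \<open>The projections \<open>E w\<close> separate the coefficients.\<close>
lemma dom_coeff_independent:
  assumes "(\<Sum>z\<in>D. mat (\<gamma> z) ** dom_coeff z) = 0" "w \<in> D"
  shows "\<gamma> w = 0"
proof (rule ccontr)
  assume nz: "\<gamma> w \<noteq> 0"
  have "E w ** (\<Sum>z\<in>D. mat (\<gamma> z) ** dom_coeff z) = (\<Sum>z\<in>D. if z = w then mat (\<gamma> w) ** dom_coeff w else 0)"
    unfolding matrix_sum_ldistrib mat_left_commute[of "E w"] by (intro sum.cong refl) (auto simp: E_dom_coeff)
  also have "\<dots> = mat (\<gamma> w) ** dom_coeff w" using finite_D assms(2) by simp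
  finally have "mat (\<gamma> w) ** dom_coeff w = 0" using assms(1) by simp
  then have "mat (inverse (\<gamma> w)) ** (mat (\<gamma> w) ** dom_coeff w) = 0" by simp
  then have "mat (inverse (\<gamma> w) * \<gamma> w) ** dom_coeff w = 0" by (simp only: mat_mult matrix_mul_assoc)
  then show False using nz dom_coeff_nonzero[OF assms(2)] by simp
qed

text \<open>The real form of the sum of \<open>cis (Im z * t)\<close> times \<open>dom_coeff z\<close>, whose imaginary part cancels between conjugate
  eigenvalues.\<close>
definition principal :: "real \<Rightarrow> real^'n^'n" where
  "principal t = (\<Sum>z\<in>D. cos (Im z * t) *\<^sub>R Re_mat (dom_coeff z) - sin (Im z * t) *\<^sub>R Im_mat (dom_coeff z))"

lemma cplx_principal: "cplx (principal t) = (\<Sum>z\<in>D. mat (cis (Im z * t)) ** dom_coeff z)"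
proof -
  have cp: "cplx (principal t) = (\<Sum>z\<in>D. cplx (cos (Im z * t) *\<^sub>R Re_mat (dom_coeff z) - sin (Im z * t) *\<^sub>R Im_mat (dom_coeff z)))"
    unfolding principal_def by (simp add: vec_eq_iff)
  show ?thesis
    unfolding cp
  proof (rule sum_D_pair)
    fix z
    have "dom_coeff (cnj z) = cnj_mat (dom_coeff z)" by (simp add: dom_coeff_cnj)
    then show "cplx (cos (Im z * t) *\<^sub>R Re_mat (dom_coeff z) - sin (Im z * t) *\<^sub>R Im_mat (dom_coeff z))
       + cplx (cos (Im (cnj z) * t) *\<^sub>R Re_mat (dom_coeff (cnj z)) - sin (Im (cnj z) * t) *\<^sub>R Im_mat (dom_coeff (cnj z)))
       = mat (cis (Im z * t)) ** dom_coeff z + mat (cis (Im (cnj z) * t)) ** dom_coeff (cnj z)"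
      by (simp add: vec_eq_iff mat_mult_left Re_mat_def Im_mat_def complex_eq_iff)
  qed
qed

text \<open>An active pair that is not dominant has smaller growth rate, or the same growth rate and a smaller power of \<open>t\<close>, by the
  lexicographic maximality of the dominant pair.\<close>
lemma subdominant_vanishes:
  assumes act: "active z l" and nd: "\<not> (z \<in> D \<and> l = dom_degree)"
  shows "((\<lambda>t. exp (of_real t * z) * of_real t ^ l / fact l / of_real (exp (growth * t) * t ^ dom_degree)) \<longlongrightarrow> 0) at_top"
proof -
  have zs: "z \<in> spectrum A" using act active_mono[of z l 0] by (simp add: spectrum_iff)
  have l: "l \<le> spec_index A z" by (rule active_le_spec_index[OF zs act])
  have lex: "Re z < growth \<or> Re z = growth \<and> spec_index A z \<le> dom_degree"
    using dom_pair_max(2)[OF finite_spectrum spectrum_nonempty zs] by (auto simp: lex_le_def growth_def dom_degree_def)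
  have n: "norm (exp (of_real t * z) * of_real t ^ l / fact l / of_real (exp (growth * t) * t ^ dom_degree))
      = exp (- (growth - Re z) * t) * t ^ l / t ^ dom_degree / fact l" if "t > 0" for t
    using that by (simp add: norm_mult norm_divide norm_power norm_exp_eq_Re left_diff_distrib exp_diff mult.commute[of t] divide_simps)
  have f1: "1 / fact l \<le> (1 :: real)" by simp
  show ?thesis
  proof (cases "Re z < growth")
    case True
    then have lim: "((\<lambda>t. exp (- (growth - Re z) * t) * t ^ l) \<longlongrightarrow> 0) at_top" by (intro tendsto_exp_poly_0) simp
    show ?thesis
    proof (rule Lim_null_comparison[OF _ lim])
      show "\<forall>\<^sub>F t in at_top. norm (exp (of_real t * z) * of_real t ^ l / fact l / of_real (exp (growth * t) * t ^ dom_degree))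
         \<le> exp (- (growth - Re z) * t) * t ^ l"
        using eventually_ge_at_top[of 1]
      proof eventually_elim
        case (elim t)
        have "1 \<le> t ^ dom_degree * fact l" using mult_mono[OF one_le_power[OF elim, of dom_degree] fact_ge_1[of l]] elim by simp
        then have "exp (- (growth - Re z) * t) * t ^ l / (t ^ dom_degree * fact l) \<le> exp (- (growth - Re z) * t) * t ^ l / 1"
          using elim by (intro divide_left_mono) auto
        then show ?case using n[of t] elim by simp
      qed
    qed
  next
    case False
    then have re: "Re z = growth" "spec_index A z \<le> dom_degree" using lex by auto
    have ld: "l < dom_degree"
    proof (rule ccontr)
      assume "\<not> l < dom_degree"
      then have "l = dom_degree" "spec_index A z = dom_degree" using l re by auto
      then show False using nd zs re(1) by (simp add: D_iff)
    qed
    have lim: "((\<lambda>t. 1 / t) \<longlongrightarrow> (0::real)) at_top" by real_asymp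
    show ?thesis
    proof (rule Lim_null_comparison[OF _ lim])
      show "\<forall>\<^sub>F t in at_top. norm (exp (of_real t * z) * of_real t ^ l / fact l / of_real (exp (growth * t) * t ^ dom_degree)) \<le> 1 / t"
        using eventually_ge_at_top[of 1]
      proof eventually_elim
        case (elim t)
        have "t ^ Suc l \<le> t ^ dom_degree * 1" using elim ld by (simp add: power_increasing del: power_Suc)
        also have "\<dots> \<le> t ^ dom_degree * fact l" using elim by (intro mult_left_mono) auto
        finally have "t ^ l * t \<le> t ^ dom_degree * fact l" by (simp add: mult.commute)
        then have "t ^ l / (t ^ dom_degree * fact l) \<le> 1 / t" using elim by (simp add: divide_simps)
        then show ?case using n[of t] elim re(1) by simp
      qed
    qed
  qed
qed

lemma res_exp_asymptotics:
  fixes M :: "real \<Rightarrow> real^'n^'n"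
  assumes M: "\<And>t. cplx (M t) = res_exp t"
  defines "R \<equiv> \<lambda>t. inverse (exp (growth * t) * t ^ dom_degree) *\<^sub>R M t - principal t"
  shows "(R \<longlongrightarrow> 0) at_top"
    and "\<And>t. t > 0 \<Longrightarrow> M t = (exp (growth * t) * t ^ dom_degree) *\<^sub>R (principal t + R t)"
proof -
  show "M t = (exp (growth * t) * t ^ dom_degree) *\<^sub>R (principal t + R t)" if "t > 0" for t
  proof -
    have "exp (growth * t) * t ^ dom_degree \<noteq> 0" using that by simp
    then have "(exp (growth * t) * t ^ dom_degree) *\<^sub>R inverse (exp (growth * t) * t ^ dom_degree) *\<^sub>R M t = M t"
      unfolding scaleR_scaleR by (metis right_inverse scaleR_one)
    then show ?thesis by (simp add: R_def)
  qed
  define s where "s = (\<lambda>t. complex_of_real (exp (growth * t) * t ^ dom_degree))"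
  define c where "c = (\<lambda>z l t. exp (of_real t * z) * of_real t ^ l / fact l / s t
      - (if z \<in> D \<and> l = dom_degree then cis (Im z * t) / fact dom_degree else 0))"
  have cR: "cplx (R t) = (\<Sum>z\<in>Z. \<Sum>l<N. mat (c z l t) ** (lp z l ** E z))" for t
  proof -
    have "cplx (principal t) = (\<Sum>z\<in>D. mat (cis (Im z * t) / fact dom_degree) ** (lp z dom_degree ** E z))"
      unfolding cplx_principal dom_coeff_def
      by (intro sum.cong refl) (simp add: matrix_mul_assoc flip: mat_mult)
    also have "\<dots> = (\<Sum>z\<in>Z. if z \<in> D then mat (cis (Im z * t) / fact dom_degree) ** (lp z dom_degree ** E z) else 0)"
      using finite_Z D_subset_Z by (intro sum.mono_neutral_cong_left) auto
    also have "\<dots> = (\<Sum>z\<in>Z. \<Sum>l<N. mat (if z \<in> D \<and> l = dom_degree then cis (Im z * t) / fact dom_degree else 0) ** (lp z l ** E z))"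
    proof (intro sum.cong refl)
      fix z
      have "(\<Sum>l<N. mat (if z \<in> D \<and> l = dom_degree then cis (Im z * t) / fact dom_degree else 0) ** (lp z l ** E z))
        = (\<Sum>l\<in>{dom_degree}. mat (if z \<in> D \<and> l = dom_degree then cis (Im z * t) / fact dom_degree else 0) ** (lp z l ** E z))"
        using dom_degree_less by (intro sum.mono_neutral_right) auto
      then show "(if z \<in> D then mat (cis (Im z * t) / fact dom_degree) ** (lp z dom_degree ** E z) else 0)
        = (\<Sum>l<N. mat (if z \<in> D \<and> l = dom_degree then cis (Im z * t) / fact dom_degree else 0) ** (lp z l ** E z))" by simp
    qed
    finally have p: "cplx (principal t) = (\<Sum>z\<in>Z. \<Sum>l<N. mat (if z \<in> D \<and> l = dom_degree then cis (Im z * t) / fact dom_degree else 0) ** (lp z l ** E z))" .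
    have "cplx (R t) = mat (inverse (s t)) ** cplx (M t) - cplx (principal t)"
      by (simp add: R_def s_def vec_eq_iff mat_mult_left)
    also have "mat (inverse (s t)) ** cplx (M t) = (\<Sum>z\<in>Z. \<Sum>l<N. mat (exp (of_real t * z) * of_real t ^ l / fact l / s t) ** (lp z l ** E z))"
      unfolding M res_exp_def matrix_sum_ldistrib
      by (intro sum.cong refl) (simp add: matrix_mul_assoc divide_inverse mult.commute flip: mat_mult)
    also have "(\<Sum>z\<in>Z. \<Sum>l<N. mat (exp (of_real t * z) * of_real t ^ l / fact l / s t) ** (lp z l ** E z)) - cplx (principal t)
       = (\<Sum>z\<in>Z. \<Sum>l<N. mat (c z l t) ** (lp z l ** E z))"
      unfolding p sum_subtractf[symmetric]
      by (intro sum.cong refl) (simp add: c_def vec_eq_iff mat_mult_left left_diff_distrib)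
    finally show ?thesis .
  qed
  have term0: "((\<lambda>t. mat (c z l t) ** (lp z l ** E z)) \<longlongrightarrow> 0) at_top" for z l
  proof (cases "active z l")
    case True
    have "(c z l \<longlongrightarrow> 0) at_top"
    proof (cases "z \<in> D \<and> l = dom_degree")
      case True
      have "c z l t = 0" if "t > 0" for t
      proof -
        have "exp (of_real t * z) = of_real (exp (growth * t)) * cis (Im z * t)"
        proof -
          have "of_real t * z = of_real (growth * t) + \<i> * of_real (Im z * t)"
            using True by (simp add: complex_eq_iff D_iff mult.commute)
          then show ?thesis by (simp add: exp_add cis_conv_exp exp_of_real[symmetric])
        qed
        then show ?thesis using that True by (simp add: c_def s_def)
      qed
      then have "\<forall>\<^sub>F t in at_top. c z l t = 0" by (intro eventually_mono[OF eventually_gt_at_top[of 0]])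
      then show ?thesis by (rule tendsto_eventually)
    next
      case False
      show ?thesis unfolding c_def s_def if_not_P[OF False] diff_zero
        by (rule subdominant_vanishes[OF \<open>active z l\<close> False])
    qed
    then have "((\<lambda>t. mat (c z l t) ** (lp z l ** E z)) \<longlongrightarrow> mat 0 ** (lp z l ** E z)) at_top"
      by (rule bounded_linear.tendsto[OF bounded_linear_mat_mult])
    then show ?thesis by simp
  qed (simp add: active_def)
  have "((\<lambda>t. cplx (R t)) \<longlongrightarrow> (\<Sum>z\<in>Z. \<Sum>l<N. 0)) at_top"
    unfolding cR by (intro tendsto_sum term0)
  then have "((\<lambda>t. Re_mat (cplx (R t))) \<longlongrightarrow> Re_mat 0) at_top"
    by (intro bounded_linear.tendsto[OF bounded_linear_Re_mat]) simp
  then show "(R \<longlongrightarrow> 0) at_top" by (simp add: Re_mat_cplx) (simp add: Re_mat_def zero_vec_def)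
qed

lemma inj_Im_D: "inj_on Im D"
  by (rule inj_onI) (auto simp: D_iff complex_eq_iff)

text \<open>Some coefficient of \<open>c \<bullet> principal t\<close> is nonzero unless \<open>c\<close> lies in a hyperplane.\<close>
lemma AE_benford_if_nonresonant:
  fixes M :: "real \<Rightarrow> real^'n^'n"
  assumes M: "\<And>t. cplx (M t) = res_exp t" and Mc: "continuous_on UNIV M" and b: "b \<ge> 2"
    and nr: "2 * pi / ln b * growth \<notin> rspan (Im ` D)"
  shows "AE c in lborel. benford b (\<lambda>t. c \<bullet> M t)"
proof -
  obtain z0 where z0: "z0 \<in> D" using D_nonempty by blast
  have "Re_mat (dom_coeff z0) \<noteq> 0 \<or> Im_mat (dom_coeff z0) \<noteq> 0"
    using dom_coeff_nonzero[OF z0] by (auto simp: vec_eq_iff Re_mat_def Im_mat_def complex_eq_iff)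
  then have "AE c in lborel. cdot c (dom_coeff z0) \<noteq> 0"
    using AE_inner_nonzero[of "Re_mat (dom_coeff z0)"] AE_inner_nonzero[of "Im_mat (dom_coeff z0)"]
    unfolding cdot_eq_0_iff by (auto elim!: eventually_mono)
  then show ?thesis
  proof eventually_elim
    case (elim c)
    define R where "R = (\<lambda>t. inverse (exp (growth * t) * t ^ dom_degree) *\<^sub>R M t - principal t)"
    have R: "(R \<longlongrightarrow> 0) at_top" "\<And>t. t > 0 \<Longrightarrow> M t = (exp (growth * t) * t ^ dom_degree) *\<^sub>R (principal t + R t)"
      using res_exp_asymptotics[of M, OF M] unfolding R_def by blast+
    show ?case
    proof (rule nonresonant_imp_benford[OF b])
      show "(\<lambda>t. c \<bullet> M t) \<in> borel_measurable borel"
        by (intro borel_measurable_continuous_onI continuous_intros Mc)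
      show "c \<bullet> M t = exp (growth * t) * t ^ dom_degree * (c \<bullet> principal t + c \<bullet> R t)" if "t > 0" for t
        using R(2)[OF that] by (simp add: inner_add_right)
      show "complex_of_real (c \<bullet> principal t) = (\<Sum>\<theta>\<in>Im ` D. cdot c (dom_coeff (Complex growth \<theta>)) * cis (\<theta> * t))" for t
      proof -
        have "complex_of_real (c \<bullet> principal t) = (\<Sum>z\<in>D. cdot c (dom_coeff z) * cis (Im z * t))"
          by (simp add: cdot_cplx[symmetric] cplx_principal cdot_sum cdot_mat mult.commute)
        also have "\<dots> = (\<Sum>z\<in>D. cdot c (dom_coeff (Complex growth (Im z))) * cis (Im z * t))"
        proof (rule sum.cong[OF refl])
          fix z assume "z \<in> D"
          then have "Complex growth (Im z) = z" by (simp add: D_iff complex_eq_iff)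
          then show "cdot c (dom_coeff z) * cis (Im z * t) = cdot c (dom_coeff (Complex growth (Im z))) * cis (Im z * t)" by simp
        qed
        also have "\<dots> = (\<Sum>\<theta>\<in>Im ` D. cdot c (dom_coeff (Complex growth \<theta>)) * cis (\<theta> * t))"
          by (simp add: sum.reindex[OF inj_Im_D])
        finally show ?thesis .
      qed
      show "finite (Im ` D)" using finite_D by simp
      show "Im z0 \<in> Im ` D" using z0 by simp
      have "Complex growth (Im z0) = z0" using z0 by (simp add: D_iff complex_eq_iff)
      then show "cdot c (dom_coeff (Complex growth (Im z0))) \<noteq> 0" using elim by simp
      show "((\<lambda>t. c \<bullet> R t) \<longlongrightarrow> 0) at_top" using tendsto_inner[OF tendsto_const R(1), of c] by simp
      show "2 * pi / ln b * growth \<notin> rspan (Im ` D)" by (rule nr)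
    qed
  qed
qed

text \<open>Each conjugate pair \<open>z\<close>, \<open>cnj z\<close> contributes two real matrices, the real and the imaginary part of its coefficient. The sign of
  \<open>Im z\<close> decides which of the two is attached to which element of the pair, so the family is indexed by \<open>D\<close>.\<close>
definition frame :: "complex \<Rightarrow> real^'n^'n" where
  "frame z = (if Im z \<ge> 0 then Re_mat (dom_coeff z) else Im_mat (dom_coeff z))"

text \<open>The squares of the two coordinates of a nonreal conjugate pair add up to 4. This makes the length of \<open>principal t\<close> constant
  once the frame is orthonormal.\<close>
definition frame_coord :: "complex \<Rightarrow> real \<Rightarrow> real" where
  "frame_coord z t = (if Im z = 0 then 1 else if Im z > 0 then 2 * cos (Im z * t) else - 2 * sin (Im z * t))"

lemma Re_Im_dom_coeff_cnj: "Re_mat (dom_coeff (cnj z)) = Re_mat (dom_coeff z)" "Im_mat (dom_coeff (cnj z)) = - Im_mat (dom_coeff z)"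
  by (simp_all add: dom_coeff_cnj[symmetric] Re_mat_def Im_mat_def vec_eq_iff)

lemma principal_frame: "principal t = (\<Sum>z\<in>D. frame_coord z t *\<^sub>R frame z)"
  unfolding principal_def
proof (rule sum_D_pair)
  fix z
  have im0: "Im_mat (dom_coeff z) = 0" if "Im z = 0"
  proof -
    have "cnj z = z" using that by (simp add: complex_eq_iff)
    then have "Im_mat (dom_coeff z) = - Im_mat (dom_coeff z)" using Re_Im_dom_coeff_cnj(2)[of z] by simp
    then show ?thesis by (simp add: vec_eq_iff)
  qed
  show "cos (Im z * t) *\<^sub>R Re_mat (dom_coeff z) - sin (Im z * t) *\<^sub>R Im_mat (dom_coeff z) +
       (cos (Im (cnj z) * t) *\<^sub>R Re_mat (dom_coeff (cnj z)) - sin (Im (cnj z) * t) *\<^sub>R Im_mat (dom_coeff (cnj z)))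
     = frame_coord z t *\<^sub>R frame z + frame_coord (cnj z) t *\<^sub>R frame (cnj z)"
    by (cases "Im z" "0::real" rule: linorder_cases)
       (simp_all add: frame_coord_def frame_def Re_Im_dom_coeff_cnj im0 vec_eq_iff)
qed

text \<open>The complexified frame arises from the linearly independent coefficients \<open>dom_coeff z\<close> by an invertible change of basis
  within each conjugate pair.\<close>
lemma frame_independent:
  assumes "(\<Sum>z\<in>D. u z *\<^sub>R frame z) = 0" shows "\<forall>z\<in>D. u z = 0"
proof
  fix w assume w: "w \<in> D"
  define \<alpha> where "\<alpha> = (\<lambda>z. if Im z \<ge> 0 then 1 / 2 else - \<i> / 2 :: complex)"
  define \<beta> where "\<beta> = (\<lambda>z. if Im z \<ge> 0 then 1 / 2 else \<i> / 2 :: complex)"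
  have cf: "cplx (frame z) = mat (\<alpha> z) ** dom_coeff z + mat (\<beta> z) ** dom_coeff (cnj z)" for z
    by (simp add: frame_def \<alpha>_def \<beta>_def dom_coeff_cnj[symmetric] vec_eq_iff mat_mult_left Re_mat_def Im_mat_def complex_eq_iff)
  define \<gamma> where "\<gamma> = (\<lambda>z. of_real (u z) * \<alpha> z + of_real (u (cnj z)) * \<beta> (cnj z))"
  have "0 = cplx (\<Sum>z\<in>D. u z *\<^sub>R frame z)" using assms by (simp add: vec_eq_iff)
  also have "\<dots> = (\<Sum>z\<in>D. mat (of_real (u z)) ** cplx (frame z))"
    by (simp add: vec_eq_iff mat_mult_left)
  also have "\<dots> = (\<Sum>z\<in>D. mat (of_real (u z) * \<alpha> z) ** dom_coeff z) + (\<Sum>z\<in>D. mat (of_real (u z) * \<beta> z) ** dom_coeff (cnj z))"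
    unfolding cf matrix_add_ldistrib sum.distrib by (simp only: mat_mult matrix_mul_assoc)
  also have "(\<Sum>z\<in>D. mat (of_real (u z) * \<beta> z) ** dom_coeff (cnj z)) = (\<Sum>z\<in>D. mat (of_real (u (cnj z)) * \<beta> (cnj z)) ** dom_coeff z)"
    using sum_D_cnj[of "\<lambda>z. mat (of_real (u z) * \<beta> z) ** dom_coeff (cnj z)"] by simp
  finally have "(\<Sum>z\<in>D. mat (\<gamma> z) ** dom_coeff z) = 0"
    by (simp add: \<gamma>_def mat_add matrix_add_rdistrib sum.distrib)
  then have g: "\<gamma> z = 0" if "z \<in> D" for z using dom_coeff_independent that by blast
  have cw: "cnj w = w" if "Im w = 0" using that by (simp add: complex_eq_iff)
  show "u w = 0"
    using cw[THEN arg_cong[where f = u]] g[OF w] g[OF D_cnj[OF w]]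
    by (cases "Im w" "0::real" rule: linorder_cases) (auto simp: \<gamma>_def \<alpha>_def \<beta>_def complex_eq_iff)
qed

lemma not_AE_benford_if_resonant:
  fixes M :: "real \<Rightarrow> real^'n^'n"
  assumes M: "\<And>t. cplx (M t) = res_exp t" and Mc: "continuous_on UNIV M" and b: "b \<ge> 2"
    and res: "2 * pi / ln b * growth \<in> rspan (Im ` D)"
  shows "\<not> (AE c in lborel. benford b (\<lambda>t. c \<bullet> M t))"
proof -
  obtain L :: "real^'n^'n \<Rightarrow> real^'n^'n" where L: "linear L" "bij L" "\<And>z w. z \<in> D \<Longrightarrow> w \<in> D \<Longrightarrow> L (frame z) \<bullet> L (frame w) = (if z = w then 1 else 0)"
    using exists_orthonormalising_map[OF finite_D frame_independent] by blast
  have LQ: "L (principal t) = (\<Sum>z\<in>D. frame_coord z t *\<^sub>R L (frame z))" for t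
    unfolding principal_frame using L(1) by (simp add: linear_sum linear_scale)
  define s where "s = sqrt (\<Sum>z\<in>D. if Im z = 0 then 1 else 2)"
  have spos: "s > 0" unfolding s_def
    using D_nonempty finite_D by (intro real_sqrt_gt_zero sum_pos) auto
  have normLQ: "norm (L (principal t)) = s" for t
  proof -
    have "L (principal t) \<bullet> L (principal t) = (\<Sum>z\<in>D. frame_coord z t * frame_coord z t)"
      unfolding LQ by (rule orthonormal_inner_sum[OF finite_D L(3)])
    also have "\<dots> = (\<Sum>z\<in>D. if Im z = 0 then 1 else 2)"
    proof (rule sum_D_pair)
      fix z
      have "4 * (cos (Im z * t) * cos (Im z * t)) + 4 * (sin (Im z * t) * sin (Im z * t)) = 4"
        using sin_cos_squared_add3[of "Im z * t"] by linarith
      then show "frame_coord z t * frame_coord z t + frame_coord (cnj z) t * frame_coord (cnj z) t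
         = (if Im z = 0 then 1 else 2) + (if Im (cnj z) = 0 then 1 else 2)"
        by (cases "Im z" "0::real" rule: linorder_cases) (simp_all add: frame_coord_def)
    qed
    finally show ?thesis by (simp add: norm_eq_sqrt_inner s_def)
  qed
  \<comment> \<open>Pairing with \<open>e\<close> picks the cosine coordinates; the factor 2 accounts for both elements of a conjugate pair.\<close>
  define e where "e = (\<Sum>z\<in>D. (if Im z \<ge> 0 then 1 else 0) *\<^sub>R L (frame z))"
  define c0 where "c0 = adjoint L e"
  have c0: "c0 \<bullet> principal t = (\<Sum>\<theta>\<in>Im ` D. cos (\<theta> * t))" for t
  proof -
    have "c0 \<bullet> principal t = e \<bullet> L (principal t)"
      unfolding c0_def using adjoint_works[OF L(1), of "principal t" e] by (simp add: inner_commute)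
    also have "\<dots> = (\<Sum>z\<in>D. (if Im z \<ge> 0 then 1 else 0) * frame_coord z t)"
      unfolding e_def LQ by (rule orthonormal_inner_sum[OF finite_D L(3)])
    also have "\<dots> = (\<Sum>z\<in>D. cos (Im z * t))"
    proof (rule sum_D_pair)
      fix z
      show "(if Im z \<ge> 0 then 1 else 0) * frame_coord z t + (if Im (cnj z) \<ge> 0 then 1 else 0) * frame_coord (cnj z) t
        = cos (Im z * t) + cos (Im (cnj z) * t)"
        by (cases "Im z" "0::real" rule: linorder_cases) (simp_all add: frame_coord_def)
    qed
    finally show ?thesis by (simp add: sum.reindex[OF inj_Im_D])
  qed
  define R where "R = (\<lambda>t. inverse (exp (growth * t) * t ^ dom_degree) *\<^sub>R M t - principal t)"
  have R: "(R \<longlongrightarrow> 0) at_top" "\<And>t. t > 0 \<Longrightarrow> M t = (exp (growth * t) * t ^ dom_degree) *\<^sub>R (principal t + R t)"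
    using res_exp_asymptotics[of M, OF M] unfolding R_def by blast+
  define K where "K = (\<lambda>x. (1 / s) *\<^sub>R L x)"
  have "linear K" unfolding K_def using L(1) by (rule linear_compose_scale_right)
  moreover have "bij K"
  proof -
    have "bij (\<lambda>x :: real^'n^'n. (1 / s) *\<^sub>R x)"
      by (rule bij_betw_byWitness[where f' = "\<lambda>x. s *\<^sub>R x"]) (use spos in auto)
    then have "bij ((\<lambda>x. (1 / s) *\<^sub>R x) \<circ> L)" using L(2) bij_comp by blast
    then show ?thesis by (simp add: K_def o_def)
  qed
  moreover have "norm (K (principal t)) = 1" for t using normLQ[of t] spos by (simp add: K_def)
  moreover have "finite (Im ` D)" "Im ` D \<noteq> {}" using finite_D D_nonempty by auto
  ultimately show ?thesis
    using resonant_imp_not_benford[OF b Mc R(2) R(1) _ _ _ _ _ c0 res] by blast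
qed

end

theorem theorem3p11:
  fixes b :: nat and \<phi> :: "real \<Rightarrow> real^'n \<Rightarrow> real^'n"
  assumes "b \<ge> 2" and "linear_flow \<phi>"
  shows "exp_nonresonant b (flow_dom_spectrum \<phi>) \<longleftrightarrow>
         almost_every_functional (\<lambda>H. benford b (\<lambda>t. H (matrix (\<phi> t))))"
proof -
  define M where "M = (\<lambda>t. matrix (\<phi> t))"
  obtain E Z N where "spectral_resolution (generator \<phi>) E Z N" using spectral_resolution_exists by blast
  then interpret spectral_resolution "generator \<phi>" E Z N .
  have M: "cplx (M t) = res_exp t" for t
    unfolding M_def using flow_matrix_deriv[OF assms(2)] flow_matrix_0[OF assms(2)] by (rule cplx_solution)
  have Mc: "continuous_on UNIV M" unfolding M_def by (rule continuous_flow_matrix[OF assms(2)])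
  have "almost_every_functional (\<lambda>H. benford b (\<lambda>t. H (matrix (\<phi> t)))) \<longleftrightarrow> (AE c in lborel. benford b (\<lambda>t. c \<bullet> M t))"
    by (simp add: almost_every_functional_def functional_eq_inner M_def AE_completion_iff)
  also have "\<dots> \<longleftrightarrow> 2 * pi / ln b * growth \<notin> rspan (Im ` D)"
    using AE_benford_if_nonresonant[OF M Mc assms(1)] not_AE_benford_if_resonant[OF M Mc assms(1)] by blast
  also have "\<dots> \<longleftrightarrow> exp_nonresonant b D"
    using exp_nonresonant_imp[OF D_nonempty _ D_cnj assms(1), of growth]
      exp_nonresonant_if[OF finite_D D_nonempty _ assms(1), of growth] by (auto simp: D_iff)
  finally show ?thesis by (simp add: flow_dom_spectrum_def)
qed

end
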